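(* Let $1\leq p,q<\infty$ and let $(M,g)$ be a possibly incomplete (connected) Riemannian manifold. Assume that $M$ has infinite volume and that for some compact set $F\subset M$ the $L^{q,p}$-Sobolev inequality holds on $M\setminus F$, i.e. there is a constant $S>0$ such that $$S\,\|\varphi\|_{L^q}\leq\|\nabla\varphi\|_{L^p}\qquad\text{for every }\varphi\in C_c^\infty(M\setminus F).$$ Then $M$ is $p$-hyperbolic, and the same Sobolev inequality, possibly with a different constant, holds on all of $M$: there is a constant $S'>0$ such that $$S'\,\|\varphi\|_{L^q}\leq\|\nabla\varphi\|_{L^p}\qquad\text{for every }\varphi\in C_c^\infty(M).$$
   Context: The $p$-capacity of a compact set $K\subset M$ is $\mathrm{cap}_p(K)=\inf\int_M|\nabla\varphi|^p\,d\mathrm{vol}_g$, the infimum being over all $\varphi\in C_c^1(M)$ with $\varphi\geq 1$ on $K$. The manifold $M$ is $p$-hyperbolic if it contains a compact set of positive $p$-capacity. *)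

theory Defs
  imports "HOL-Analysis.Analysis"
begin

section \<open>Functions of class \<open>C\<^sup>k\<close> on open subsets of normed spaces\<close>

primrec Ck_on :: "nat \<Rightarrow> 'a::real_normed_vector set \<Rightarrow> ('a \<Rightarrow> 'b::real_normed_vector) \<Rightarrow> bool" where
  "Ck_on 0 S f \<longleftrightarrow> continuous_on S f"
| "Ck_on (Suc k) S f \<longleftrightarrow> (\<forall>x\<in>S. f differentiable (at x)) \<and>
     (\<forall>v. Ck_on k S (\<lambda>x. frechet_derivative f (at x) v))"

definition smooth_on :: "'a::real_normed_vector set \<Rightarrow> ('a \<Rightarrow> 'b::real_normed_vector) \<Rightarrow> bool" where
  "smooth_on S f \<longleftrightarrow> (\<forall>k. Ck_on k S f)"


section \<open>Smooth manifolds\<close>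

text \<open>The underlying space of the manifold is a whole (Hausdorff, second countable) type \<open>'m\<close>.
  A chart is a pair of its open domain and its coordinate map; only the values of the coordinate
  map on the domain matter.\<close>

type_synonym ('m, 'n) chart = "'m set \<times> ('m \<Rightarrow> real^'n)"

abbreviation cdom :: "('m, 'n) chart \<Rightarrow> 'm set" where
  "cdom c \<equiv> fst c"

abbreviation cmap :: "('m, 'n) chart \<Rightarrow> 'm \<Rightarrow> real^'n" where
  "cmap c \<equiv> snd c"

abbreviation cinv :: "('m, 'n) chart \<Rightarrow> real^'n \<Rightarrow> 'm" where
  "cinv c \<equiv> inv_into (cdom c) (cmap c)"

definition is_chart :: "('m::topological_space, 'n::finite) chart \<Rightarrow> bool" where
  "is_chart c \<longleftrightarrow> open (cdom c) \<and> open (cmap c ` cdom c) \<and>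
     homeomorphism (cdom c) (cmap c ` cdom c) (cmap c) (cinv c)"

definition smooth_atlas :: "('m::topological_space, 'n::finite) chart set \<Rightarrow> bool" where
  "smooth_atlas A \<longleftrightarrow> (\<forall>c\<in>A. is_chart c) \<and> (\<Union>c\<in>A. cdom c) = UNIV \<and>
     (\<forall>c\<in>A. \<forall>d\<in>A. smooth_on (cmap c ` (cdom c \<inter> cdom d)) (cmap d \<circ> cinv c))"

definition manifold_Ck :: "('m, 'n::finite) chart set \<Rightarrow> nat \<Rightarrow> ('m \<Rightarrow> real) \<Rightarrow> bool" where
  "manifold_Ck A k \<phi> \<longleftrightarrow> (\<forall>c\<in>A. Ck_on k (cmap c ` cdom c) (\<phi> \<circ> cinv c))"

text \<open>\<open>Cc_k A k U\<close> is \<open>C\<^sub>c\<^sup>k(U)\<close> and \<open>Cc_inf A U\<close> is \<open>C\<^sub>c\<^sup>\<infinity>(U)\<close>, for \<open>U\<close> open in \<open>M\<close>. As usual, such functions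
  are identified with their extension by zero to all of \<open>M\<close>.\<close>

definition Cc_k :: "('m::topological_space, 'n::finite) chart set \<Rightarrow> nat \<Rightarrow> 'm set \<Rightarrow> ('m \<Rightarrow> real) set" where
  "Cc_k A k U = {\<phi>. manifold_Ck A k \<phi> \<and> compact (closure {x. \<phi> x \<noteq> 0}) \<and> closure {x. \<phi> x \<noteq> 0} \<subseteq> U}"

definition Cc_inf :: "('m::topological_space, 'n::finite) chart set \<Rightarrow> 'm set \<Rightarrow> ('m \<Rightarrow> real) set" where
  "Cc_inf A U = (\<Inter>k. Cc_k A k U)"


section \<open>Riemannian metrics\<close>

text \<open>A metric is given by its components: \<open>g c x $ i $ j\<close> is \<open>g(\<partial>\<^sub>i, \<partial>\<^sub>j)\<close> at the point \<open>x\<close>, for the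
  coordinate frame of the chart \<open>c\<close>. The last clause below is the transformation rule of a covariant
  2-tensor, \<open>J\<close> being the Jacobian matrix of the coordinate change from \<open>c\<close> to \<open>d\<close>.\<close>

type_synonym ('m, 'n) metric = "('m, 'n) chart \<Rightarrow> 'm \<Rightarrow> real^'n^'n"

definition riemannian_metric ::
    "('m::topological_space, 'n::finite) chart set \<Rightarrow> ('m, 'n) metric \<Rightarrow> bool" where
  "riemannian_metric A g \<longleftrightarrow>
     (\<forall>c\<in>A. smooth_on (cmap c ` cdom c) (g c \<circ> cinv c)) \<and>
     (\<forall>c\<in>A. \<forall>x\<in>cdom c. transpose (g c x) = g c x \<and> (\<forall>v. v \<noteq> 0 \<longrightarrow> v \<bullet> (g c x *v v) > 0)) \<and>
     (\<forall>c\<in>A. \<forall>d\<in>A. \<forall>x\<in>cdom c \<inter> cdom d.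
        let J = matrix (frechet_derivative (cmap d \<circ> cinv c) (at (cmap c x)))
        in g c x = transpose J ** g d x ** J)"

definition riemannian_manifold ::
    "('m::{t2_space,second_countable_topology}, 'n::finite) chart set \<Rightarrow> ('m, 'n) metric \<Rightarrow> bool" where
  "riemannian_manifold A g \<longleftrightarrow> smooth_atlas A \<and> riemannian_metric A g"

text \<open>The Riemannian volume is the unique Borel measure equal to \<open>sqrt (det g) dx\<close> in every chart.\<close>

definition riem_vol ::
    "('m::topological_space, 'n::finite) chart set \<Rightarrow> ('m, 'n) metric \<Rightarrow> 'm measure" where
  "riem_vol A g = (THE \<mu>. sets \<mu> = sets borel \<and>
     (\<forall>c\<in>A. \<forall>B\<in>sets borel. B \<subseteq> cdom c \<longrightarrow>
        emeasure \<mu> B = (\<integral>\<^sup>+y \<in> cmap c ` B. ennreal (sqrt (det (g c (cinv c y)))) \<partial>lborel)))"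

text \<open>In the chart \<open>c\<close>, the gradient has components \<open>\<Sum>\<^sub>j g\<^sup>i\<^sup>j \<partial>\<^sub>j \<phi>\<close>.\<close>

definition grad_in :: "('m, 'n::finite) metric \<Rightarrow> ('m, 'n) chart \<Rightarrow> ('m \<Rightarrow> real) \<Rightarrow> 'm \<Rightarrow> real^'n" where
  "grad_in g c \<phi> x =
     matrix_inv (g c x) *v (\<chi> j. frechet_derivative (\<phi> \<circ> cinv c) (at (cmap c x)) (axis j 1))"

text \<open>For differentiable \<open>\<phi>\<close> the length of the gradient does not depend on the chosen chart.\<close>

definition grad_norm ::
    "('m, 'n::finite) chart set \<Rightarrow> ('m, 'n) metric \<Rightarrow> ('m \<Rightarrow> real) \<Rightarrow> 'm \<Rightarrow> real" where
  "grad_norm A g \<phi> x =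
     (let c = (SOME c. c \<in> A \<and> x \<in> cdom c); v = grad_in g c \<phi> x in sqrt (v \<bullet> (g c x *v v)))"


section \<open>Capacity and Sobolev inequalities\<close>

text \<open>This is used only for continuous functions with compact support, for which \<open>\<bar>f\<bar>\<^sup>p\<close> is integrable.\<close>

definition Lp_norm :: "'m measure \<Rightarrow> real \<Rightarrow> ('m \<Rightarrow> real) \<Rightarrow> real" where
  "Lp_norm \<mu> p f = (\<integral>x. \<bar>f x\<bar> powr p \<partial>\<mu>) powr (1 / p)"

definition capacity ::
    "('m::topological_space, 'n::finite) chart set \<Rightarrow> ('m, 'n) metric \<Rightarrow> real \<Rightarrow> 'm set \<Rightarrow> ennreal" where
  "capacity A g p K =
     (INF \<phi> \<in> {\<phi> \<in> Cc_k A 1 UNIV. \<forall>x\<in>K. \<phi> x \<ge> 1}.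
        \<integral>\<^sup>+x. ennreal (grad_norm A g \<phi> x powr p) \<partial>riem_vol A g)"

definition p_hyperbolic ::
    "('m::topological_space, 'n::finite) chart set \<Rightarrow> ('m, 'n) metric \<Rightarrow> real \<Rightarrow> bool" where
  "p_hyperbolic A g p \<longleftrightarrow> (\<exists>K. compact K \<and> capacity A g p K > 0)"

definition sobolev_inequality ::
    "('m::topological_space, 'n::finite) chart set \<Rightarrow> ('m, 'n) metric \<Rightarrow> real \<Rightarrow> real \<Rightarrow> 'm set \<Rightarrow> bool" where
  "sobolev_inequality A g q p U \<longleftrightarrow>
     (\<exists>S>0. \<forall>\<phi>\<in>Cc_inf A U.
        S * Lp_norm (riem_vol A g) q \<phi> \<le> Lp_norm (riem_vol A g) p (grad_norm A g \<phi>))"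

end

theory Submission
  imports Defs
begin

text \<open>Hyperbolicity: were all compact sets of capacity zero, a function \<open>h\<close> of energy at most a constant would
  equal \<open>1\<close> on an arbitrarily large compact set; subtracting a fixed cutoff that is \<open>1\<close> near \<open>F\<close> gives a test
  function on \<open>M - F\<close>, so the Sobolev inequality there would bound the volume of \<open>M\<close>.

  Sobolev on \<open>M\<close>: the inequality off \<open>F\<close> restricts to a coordinate ball, and since Riemannian metrics are locally
  comparable to the Euclidean one it can be translated to a coordinate ball around any point. Gluing with cutoffs
  yields the inequality with an additional \<open>L\<^sup>p\<close> norm over a compact set \<open>L\<close>. That norm is absorbed by a Poincare
  inequality \<open>\<parallel>u - c\<parallel> \<le> C \<parallel>\<nabla>u\<parallel>\<close> on \<open>L\<close>, the constant \<open>c\<close> being controlled by the positive capacity.\<close>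

section \<open>Calculus of \<open>C\<^sup>k\<close> functions\<close>

text \<open>For general \<open>p\<close> and \<open>q\<close> a Sobolev inequality can fail even on
  small Euclidean balls, so the local inequalities near \<open>F\<close> cannot be quoted: the
  hypothesis is their only source, and infinite volume guarantees a point off the compact set
  \<open>F\<close> from which one can be carried over. Capacity is tested by C^1 functions and the
  Sobolev hypothesis by smooth ones, hence the mollification in charts, which lets a competitor for
  the capacity enter the Sobolev inequality. Such a competitor is only at least 1 on the compact
  set; composing it with a smooth step makes it exactly 1 there, at the price of a constant factor
  in the energy. Estimates are made for integrals of powers, without roots. Only the finiteness of
  constants matters, so crude inequalities such as (a + b)^p \<le> 2^p (a^p + b^p) serve
  throughout.\<close>

lemma Ck_on_cong:
  assumes "open S" "\<And>x. x \<in> S \<Longrightarrow> f x = g x" "Ck_on k S f"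
  shows "Ck_on k S g"
  using assms
proof (induction k arbitrary: f g)
  case 0
  then show ?case by (metis Ck_on.simps(1) continuous_on_cong)
next
  case (Suc k)
  have diff: "f differentiable (at x)" if "x \<in> S" for x
    using Suc.prems(3) that by simp
  have fr: "frechet_derivative f (at x) = frechet_derivative g (at x)" if "x \<in> S" for x
    using frechet_derivative_transform_within_open[OF diff[OF that] \<open>open S\<close> that] Suc.prems(2) by blast
  have "g differentiable (at x)" if "x \<in> S" for x
    using diff[OF that] has_derivative_transform_within_open[OF _ \<open>open S\<close> that, of f _ UNIV g] Suc.prems(2)
    unfolding differentiable_def by metis
  moreover have "Ck_on k S (\<lambda>x. frechet_derivative g (at x) v)" for v
    by (rule Suc.IH[of "\<lambda>x. frechet_derivative f (at x) v"]) (use Suc.prems fr in auto)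
  ultimately show ?case by simp
qed

lemma Ck_on_subset: "Ck_on k S f \<Longrightarrow> T \<subseteq> S \<Longrightarrow> Ck_on k T f"
  by (induction k arbitrary: f) (auto intro: continuous_on_subset)

text \<open>Serves the extensions by zero \<open>push\<close> and \<open>pull\<close>, which are C^k
  separately inside a chart and off a compact support. The induction works because the successor
  step only asks for derivatives at single points.\<close>

lemma Ck_on_locally:
  assumes "\<And>x. x \<in> S \<Longrightarrow> \<exists>T. open T \<and> x \<in> T \<and> Ck_on k T f"
  shows "Ck_on k S f"
  using assms
proof (induction k arbitrary: f)
  case 0
  then have "isCont f x" if "x \<in> S" for x
    using that by (metis Ck_on.simps(1) continuous_on_eq_continuous_at)
  then show ?case by (simp add: continuous_at_imp_continuous_on)
next
  case (Suc k)
  have "f differentiable (at x)" if "x \<in> S" for x using Suc.prems[OF that] by auto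
  moreover have "Ck_on k S (\<lambda>x. frechet_derivative f (at x) v)" for v
    by (rule Suc.IH) (use Suc.prems in fastforce)
  ultimately show ?case by simp
qed

text \<open>Turns the recursion on \<open>frechet_derivative\<close>, a choice, into a rule for an
  explicit derivative \<open>D\<close>. Openness enters through \<open>Ck_on_cong\<close>, since the
  two agree on \<open>S\<close> only.\<close>

lemma Ck_on_SucI:
  assumes "open S" "\<And>x. x \<in> S \<Longrightarrow> (f has_derivative D x) (at x)" "\<And>v. Ck_on k S (\<lambda>x. D x v)"
  shows "Ck_on (Suc k) S f"
proof -
  have "D x = frechet_derivative f (at x)" if "x \<in> S" for x
    using frechet_derivative_at assms(2)[OF that] by blast
  then have "Ck_on k S (\<lambda>x. frechet_derivative f (at x) v)" for v
    by (intro Ck_on_cong[OF assms(1) _ assms(3)[of v]]) simp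
  then show ?thesis using assms(2) by (auto simp: differentiable_def)
qed

lemma Ck_on_SucD:
  assumes "Ck_on (Suc k) S f" "x \<in> S"
  shows "(f has_derivative frechet_derivative f (at x)) (at x)"
  using assms frechet_derivative_works by auto

lemma Ck_on_Suc: "Ck_on (Suc k) S f \<Longrightarrow> Ck_on k S f"
proof (induction k arbitrary: f)
  case 0
  then show ?case
    by (auto intro!: continuous_at_imp_continuous_on differentiable_imp_continuous_within)
qed auto

lemma Ck_on_le: "Ck_on k S f \<Longrightarrow> j \<le> k \<Longrightarrow> Ck_on j S f"
  by (induction k) (auto simp: le_Suc_eq simp del: Ck_on.simps dest: Ck_on_Suc)

lemma Ck_on_imp_continuous_on: "Ck_on k S f \<Longrightarrow> continuous_on S f"
  using Ck_on_le[of k S f 0] by simp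

lemma Ck_on_const: "Ck_on k S (\<lambda>x. c)"
  by (induction k arbitrary: c) auto

lemma Ck_on_bounded_linear:
  assumes "bounded_linear f"
  shows "Ck_on k S f"
proof (cases k)
  case 0
  then show ?thesis by (simp add: linear_continuous_on assms)
next
  case (Suc j)
  have "Ck_on k UNIV f" unfolding Suc
    by (rule Ck_on_SucI[where D = "\<lambda>x. f"]) (auto intro: bounded_linear_imp_has_derivative assms Ck_on_const)
  then show ?thesis by (rule Ck_on_subset) simp
qed

lemma Ck_on_ident: "Ck_on k S (\<lambda>x. x)"
  by (rule Ck_on_bounded_linear) (rule bounded_linear_ident)

lemma Ck_on_bounded_linear_compose:
  assumes "bounded_linear h" "open S" "Ck_on k S f"
  shows "Ck_on k S (\<lambda>x. h (f x))"
  using assms(3)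
proof (induction k arbitrary: f)
  case 0
  then show ?case by (simp add: bounded_linear.continuous_on[OF assms(1)])
next
  case (Suc k)
  show ?case
  proof (rule Ck_on_SucI[OF assms(2), where D = "\<lambda>x v. h (frechet_derivative f (at x) v)"])
    show "((\<lambda>x. h (f x)) has_derivative (\<lambda>v. h (frechet_derivative f (at x) v))) (at x)" if "x \<in> S" for x
      by (rule bounded_linear.has_derivative[OF assms(1) Ck_on_SucD[OF Suc.prems that]])
    show "Ck_on k S (\<lambda>x. h (frechet_derivative f (at x) v))" for v
      using Suc by simp
  qed
qed

lemma Ck_on_add:
  assumes "open S" "Ck_on k S f" "Ck_on k S g"
  shows "Ck_on k S (\<lambda>x. f x + g x)"
  using assms(2,3)
proof (induction k arbitrary: f g)
  case 0
  then show ?case by (simp add: continuous_on_add)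
next
  case (Suc k)
  show ?case
  proof (rule Ck_on_SucI[OF assms(1), where D = "\<lambda>x v. frechet_derivative f (at x) v + frechet_derivative g (at x) v"])
    show "((\<lambda>x. f x + g x) has_derivative (\<lambda>v. frechet_derivative f (at x) v + frechet_derivative g (at x) v)) (at x)"
      if "x \<in> S" for x
      by (intro has_derivative_add Ck_on_SucD[OF Suc.prems(1) that] Ck_on_SucD[OF Suc.prems(2) that])
    show "Ck_on k S (\<lambda>x. frechet_derivative f (at x) v + frechet_derivative g (at x) v)" for v
      using Suc by simp
  qed
qed

lemma Ck_on_sum:
  assumes "open S" "\<And>i. i \<in> I \<Longrightarrow> Ck_on k S (f i)"
  shows "Ck_on k S (\<lambda>x. \<Sum>i\<in>I. f i x)"
  using assms(2)
  by (induction I rule: infinite_finite_induct) (auto intro!: Ck_on_add Ck_on_const assms(1))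

lemma Ck_on_scaleR:
  fixes f :: "'a::real_normed_vector \<Rightarrow> real"
  assumes "open S" "Ck_on k S f" "Ck_on k S g"
  shows "Ck_on k S (\<lambda>x. f x *\<^sub>R g x)"
  using assms(2,3)
proof (induction k arbitrary: f g)
  case 0
  then show ?case by (simp add: continuous_on_scaleR)
next
  case (Suc k)
  let ?D = "\<lambda>x v. f x *\<^sub>R frechet_derivative g (at x) v + frechet_derivative f (at x) v *\<^sub>R g x"
  show ?case
  proof (rule Ck_on_SucI[OF assms(1), where D = ?D])
    show "((\<lambda>x. f x *\<^sub>R g x) has_derivative ?D x) (at x)"
      if "x \<in> S" for x
      by (intro has_derivative_scaleR Ck_on_SucD[OF Suc.prems(1) that] Ck_on_SucD[OF Suc.prems(2) that])
    show "Ck_on k S (\<lambda>x. ?D x v)" for v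
      using Suc Ck_on_Suc[OF Suc.prems(1)] Ck_on_Suc[OF Suc.prems(2)] by (auto intro!: Ck_on_add assms(1))
  qed
qed

lemma Ck_on_mult:
  fixes f g :: "'a::real_normed_vector \<Rightarrow> real"
  assumes "open S" "Ck_on k S f" "Ck_on k S g"
  shows "Ck_on k S (\<lambda>x. f x * g x)"
  using Ck_on_scaleR[OF assms] by simp

text \<open>In the chain rule the direction in which \<open>f\<close> is differentiated varies with
  \<open>x\<close>. Expanding it in the basis of the middle space leaves products of a C^k
  coefficient with a derivative of \<open>f\<close> in a fixed direction, to which the induction
  hypothesis applies.\<close>

lemma Ck_on_compose:
  fixes g :: "'a::real_normed_vector \<Rightarrow> 'b::euclidean_space"
  assumes "open S" "open T" "g ` S \<subseteq> T" "Ck_on k S g" "Ck_on k T f"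
  shows "Ck_on k S (\<lambda>x. f (g x))"
  using assms(4,5)
proof (induction k arbitrary: f)
  case 0
  then show ?case using assms(3) continuous_on_compose2 by (metis Ck_on.simps(1))
next
  case (Suc k)
  let ?D = "\<lambda>x v. frechet_derivative f (at (g x)) (frechet_derivative g (at x) v)"
  let ?E = "\<lambda>x v. \<Sum>i\<in>Basis. (frechet_derivative g (at x) v \<bullet> i) *\<^sub>R frechet_derivative f (at (g x)) i"
  have eq: "?D x v = ?E x v" if "x \<in> S" for x v
  proof -
    have "linear (frechet_derivative f (at (g x)))"
      by (rule linear_frechet_derivative) (use Suc.prems(2) that assms(3) in auto)
    then show ?thesis
      by (subst euclidean_representation[symmetric])
         (simp only: linear_sum linear_cmul)
  qed
  show ?case
  proof (rule Ck_on_SucI[OF assms(1), where D = ?E])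
    fix x assume x: "x \<in> S"
    have "((\<lambda>x. f (g x)) has_derivative ?D x) (at x)"
      by (rule has_derivative_compose[OF Ck_on_SucD[OF Suc.prems(1) x] Ck_on_SucD[OF Suc.prems(2)]])
         (use x assms(3) in auto)
    moreover have "?D x = ?E x" using eq[OF x] by auto
    ultimately show "((\<lambda>x. f (g x)) has_derivative ?E x) (at x)" by simp
  next
    fix v
    have g: "Ck_on k S g" by (rule Ck_on_Suc) fact
    have "Ck_on k S (\<lambda>x. frechet_derivative f (at (g x)) i)" for i
      by (rule Suc.IH[OF g]) (use Suc.prems in simp)
    moreover have "Ck_on k S (\<lambda>x. frechet_derivative g (at x) v \<bullet> i)" for i
      by (rule Ck_on_bounded_linear_compose[OF bounded_linear_inner_left assms(1)]) (use Suc.prems in simp)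
    ultimately show "Ck_on k S (\<lambda>x. ?E x v)"
      by (intro Ck_on_sum Ck_on_scaleR assms(1))
  qed
qed

lemma Ck_on_real_SucI:
  fixes f :: "real \<Rightarrow> real"
  assumes "open S" "\<And>x. x \<in> S \<Longrightarrow> (f has_real_derivative D x) (at x)" "Ck_on k S D"
  shows "Ck_on (Suc k) S f"
  by (rule Ck_on_SucI[OF assms(1), where D = "\<lambda>x v. D x * v"])
     (use assms in \<open>auto simp: has_field_derivative_def intro!: Ck_on_mult Ck_on_const\<close>)

text \<open>The derivative is a product of copies of the function itself, so the order climbs by one
  at each step.\<close>

lemma Ck_on_inverse: "Ck_on k (- {0}) (inverse :: real \<Rightarrow> real)"
proof (induction k)
  case 0
  show ?case by (auto intro!: continuous_intros)
next
  case (Suc k)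
  show ?case
  proof (rule Ck_on_real_SucI)
    show "Ck_on k (- {0}) (\<lambda>x::real. - 1 * (inverse x * inverse x))"
      by (intro Ck_on_mult Suc Ck_on_const) auto
  qed (auto intro!: derivative_eq_intros simp: power2_eq_square)
qed

lemma Ck_on_divide:
  fixes f g :: "'a::real_normed_vector \<Rightarrow> real"
  assumes "open S" "Ck_on k S f" "Ck_on k S g" "\<And>x. x \<in> S \<Longrightarrow> g x \<noteq> 0"
  shows "Ck_on k S (\<lambda>x. f x / g x)"
  unfolding divide_inverse
  by (intro Ck_on_mult assms(1,2) Ck_on_compose[OF assms(1) _ _ assms(3) Ck_on_inverse])
     (use assms(4) in auto)

section \<open>Smooth cutoff functions\<close>

text \<open>A class containing e^(-1/t), extended by 0, that is closed under differentiation; this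
  is what makes the induction for smoothness go through.\<close>

definition flat_poly :: "real poly \<Rightarrow> real \<Rightarrow> real" where
  "flat_poly P t = (if t > 0 then poly P (1 / t) * exp (- 1 / t) else 0)"

lemma poly_times_exp_tendsto_0: "((\<lambda>s. poly P s * exp (- s)) \<longlongrightarrow> 0) (at_top :: real filter)"
proof -
  have "((\<lambda>s. \<Sum>i\<le>degree P. coeff P i * (s ^ i / exp s)) \<longlongrightarrow> (\<Sum>i\<le>degree P. coeff P i * 0)) (at_top :: real filter)"
    by (intro tendsto_intros tendsto_power_div_exp_0)
  moreover have "(\<Sum>i\<le>degree P. coeff P i * (s ^ i / exp s)) = poly P s * exp (- s)" for s :: real
    unfolding poly_altdef sum_distrib_right by (simp add: exp_minus divide_inverse mult_ac)
  ultimately show ?thesis by simp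
qed

text \<open>With \<open>x = 1 / t\<close>, differentiating \<open>P(x) e\<^sup>-\<^sup>x\<close> in \<open>t\<close> replaces \<open>P\<close> by \<open>x\<^sup>2 (P - P')\<close>.\<close>

lemma flat_poly_has_derivative:
  "(flat_poly P has_real_derivative flat_poly (pCons 0 (pCons 0 (P - pderiv P))) t) (at t)"
proof -
  consider "t > 0" | "t < 0" | "t = 0" by linarith
  then show ?thesis
  proof cases
    case 1
    have "((\<lambda>t. poly P (1 / t) * exp (- 1 / t)) has_real_derivative
        flat_poly (pCons 0 (pCons 0 (P - pderiv P))) t) (at t)"
      using 1 by (auto intro!: derivative_eq_intros DERIV_chain2[OF poly_DERIV] simp: flat_poly_def field_simps power2_eq_square)
    then show ?thesis
      by (rule has_field_derivative_transform_within_open[where S = "{0<..}"]) (use 1 in \<open>auto simp: flat_poly_def\<close>)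
  next
    case 2
    have "((\<lambda>t. 0) has_real_derivative flat_poly (pCons 0 (pCons 0 (P - pderiv P))) t) (at t)"
      using 2 by (auto simp: flat_poly_def)
    then show ?thesis
      by (rule has_field_derivative_transform_within_open[where S = "{..<0}"]) (use 2 in \<open>auto simp: flat_poly_def\<close>)
  next
    case 3
    \<comment> \<open>With s = 1/h the difference quotient is s P(s) e^(-s): the polynomial
      \<open>pCons 0 P\<close> absorbs the division by h.\<close>
    have "((\<lambda>h. flat_poly P h / h) \<longlongrightarrow> 0) (at_right 0)"
    proof (rule Lim_transform_eventually)
      have "filterlim (\<lambda>h::real. 1 / h) at_top (at_right 0)"
        using filterlim_inverse_at_top_right by (simp add: inverse_eq_divide)
      from filterlim_compose[OF poly_times_exp_tendsto_0[of "pCons 0 P"] this]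
      show "((\<lambda>h. poly (pCons 0 P) (1 / h) * exp (- (1 / h))) \<longlongrightarrow> 0) (at_right 0)" .
      show "\<forall>\<^sub>F h in at_right 0. poly (pCons 0 P) (1 / h) * exp (- (1 / h)) = flat_poly P h / h"
        by (auto simp: eventually_at_filter flat_poly_def)
    qed
    moreover have "((\<lambda>h. flat_poly P h / h) \<longlongrightarrow> 0) (at_left 0)"
      by (rule tendsto_eventually) (auto simp: eventually_at_filter flat_poly_def)
    ultimately have "((\<lambda>h. flat_poly P h / h) \<longlongrightarrow> 0) (at 0)"
      by (simp add: filterlim_split_at)
    then show ?thesis unfolding 3 by (simp add: DERIV_def flat_poly_def)
  qed
qed

lemma Ck_on_flat_poly: "Ck_on k UNIV (flat_poly P)"
proof (induction k arbitrary: P)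
  case 0
  show ?case
    using flat_poly_has_derivative by (auto intro!: continuous_at_imp_continuous_on DERIV_isCont)
next
  case (Suc k)
  show ?case by (rule Ck_on_real_SucI[OF _ flat_poly_has_derivative Suc]) simp
qed

definition smooth_step :: "real \<Rightarrow> real" where
  "smooth_step t = flat_poly 1 t / (flat_poly 1 t + flat_poly 1 (1 - t))"

text \<open>At least one of \<open>t\<close> and \<open>1 - t\<close> is positive.\<close>

lemma smooth_step_denominator_pos: "flat_poly 1 t + flat_poly 1 (1 - t) > 0"
  by (cases "t > 0"; cases "t < 1") (auto simp: flat_poly_def intro!: add_pos_pos)

lemma Ck_on_smooth_step: "Ck_on k UNIV smooth_step"
proof -
  have "Ck_on k UNIV (\<lambda>t. flat_poly 1 (1 + (- 1) * t))"
    by (intro Ck_on_compose[OF _ _ _ _ Ck_on_flat_poly] Ck_on_add Ck_on_mult Ck_on_const Ck_on_ident) auto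
  then show ?thesis
    unfolding smooth_step_def using smooth_step_denominator_pos
    by (auto intro!: Ck_on_divide Ck_on_add Ck_on_flat_poly simp: less_imp_neq[symmetric])
qed

lemma smooth_step_le_0: "t \<le> 0 \<Longrightarrow> smooth_step t = 0"
  by (simp add: smooth_step_def flat_poly_def)

lemma smooth_step_ge_1: "t \<ge> 1 \<Longrightarrow> smooth_step t = 1"
  by (simp add: smooth_step_def flat_poly_def)

lemma smooth_step_bounds: "0 \<le> smooth_step t" "smooth_step t \<le> 1"
  using smooth_step_denominator_pos[of t]
  by (auto simp: smooth_step_def flat_poly_def field_simps)

text \<open>Off the unit interval the step is constant, so its derivative vanishes there and is
  bounded by compactness. \<open>B\<close> is later the factor by which composition with the step
  can enlarge a gradient; \<open>max B 1\<close> makes it positive.\<close>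

lemma smooth_step_deriv:
  obtains D B where "\<And>t. (smooth_step has_real_derivative D t) (at t)" "continuous_on UNIV D" "\<And>t. \<bar>D t\<bar> \<le> B" "B > 0"
proof -
  define D where "D t = frechet_derivative smooth_step (at t) 1" for t
  have der: "(smooth_step has_real_derivative D t) (at t)" for t
  proof -
    have d: "(smooth_step has_derivative frechet_derivative smooth_step (at t)) (at t)"
      using Ck_on_SucD[OF Ck_on_smooth_step[of "Suc 0"]] by simp
    then have lin: "linear (frechet_derivative smooth_step (at t))"
      by (rule has_derivative_linear)
    have "frechet_derivative smooth_step (at t) h = D t * h" for h
      using linear_cmul[OF lin, of h 1] by (simp add: D_def mult.commute)
    then have "frechet_derivative smooth_step (at t) = (*) (D t)" by auto
    then show ?thesis using d by (simp add: has_field_derivative_def)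
  qed
  have cont: "continuous_on UNIV D"
    using Ck_on_smooth_step[of "Suc 0"] by (simp add: D_def[abs_def])
  have "compact (D ` {0..1})"
    by (intro compact_continuous_image continuous_on_subset[OF cont]) auto
  then obtain B where B: "\<And>t. t \<in> {0..1} \<Longrightarrow> \<bar>D t\<bar> \<le> B"
    by (meson compact_imp_bounded bounded_real image_eqI)
  have "D t = 0" if "t < 0" for t
  proof -
    have "((\<lambda>t. 0) has_real_derivative D t) (at t)"
      by (rule has_field_derivative_transform_within_open[OF der, of "{..<0}"])
         (use that smooth_step_le_0 in auto)
    then show ?thesis using DERIV_unique DERIV_const by blast
  qed
  moreover have "D t = 0" if "t > 1" for t
  proof -
    have "((\<lambda>t. 1) has_real_derivative D t) (at t)"
      by (rule has_field_derivative_transform_within_open[OF der, of "{1<..}"])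
         (use that smooth_step_ge_1 in auto)
    then show ?thesis using DERIV_unique DERIV_const by blast
  qed
  ultimately have "\<bar>D t\<bar> \<le> max B 1" for t
    using B[of t] by (cases "t < 0"; cases "t > 1") auto
  then show thesis using that[OF der cont, of "max B 1"] by auto
qed

lemma smooth_bump:
  fixes a :: "'a::euclidean_space"
  assumes "0 < r" "r < s"
  obtains b :: "'a \<Rightarrow> real" where "\<And>k. Ck_on k UNIV b" "\<And>x. 0 \<le> b x" "\<And>x. b x \<le> 1"
    "\<And>x. dist a x \<le> r \<Longrightarrow> b x = 1" "\<And>x. s \<le> dist a x \<Longrightarrow> b x = 0"
proof -
  define c where "c = s\<^sup>2 - r\<^sup>2"
  have c: "c > 0" using assms by (simp add: c_def power_strict_mono)
  \<comment> \<open>The squared distance is a polynomial, so nothing goes wrong at the centre.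
    Division by \<open>c\<close> makes the argument at least 1 within radius \<open>r\<close> and at
    most 0 beyond \<open>s\<close>.\<close>
  define b where "b x = smooth_step ((s\<^sup>2 + (- 1) * ((x - a) \<bullet> (x - a))) * (1 / c))" for x
  have nx: "(x - a) \<bullet> (x - a) = (dist a x)\<^sup>2" for x
    by (metis dist_commute dist_norm power2_norm_eq_inner)
  show thesis
  proof (rule that[of b])
    show "Ck_on k UNIV b" for k
    proof -
      have "Ck_on k UNIV (\<lambda>x. \<Sum>i\<in>Basis. ((x + - a) \<bullet> i) * ((x + - a) \<bullet> i))"
        by (intro Ck_on_sum Ck_on_mult Ck_on_bounded_linear_compose[OF bounded_linear_inner_left] Ck_on_add
            Ck_on_const Ck_on_bounded_linear) (auto intro: bounded_linear_intros)
      then have "Ck_on k UNIV (\<lambda>x. (x - a) \<bullet> (x - a))"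
        by (subst euclidean_inner) simp
      then show ?thesis unfolding b_def
        by (intro Ck_on_compose[OF _ _ _ _ Ck_on_smooth_step] Ck_on_mult Ck_on_add Ck_on_const) auto
    qed
    show "b x = 1" if "dist a x \<le> r" for x
    proof -
      have "(dist a x)\<^sup>2 \<le> r\<^sup>2" using that by (simp add: power_mono)
      then have "(s\<^sup>2 + (- 1) * ((x - a) \<bullet> (x - a))) * (1 / c) \<ge> 1" using c unfolding nx by (simp add: c_def)
      then show ?thesis unfolding b_def by (rule smooth_step_ge_1)
    qed
    show "b x = 0" if "s \<le> dist a x" for x
    proof -
      have "s\<^sup>2 \<le> (dist a x)\<^sup>2" using that assms by (simp add: power_mono)
      then have "(s\<^sup>2 + (- 1) * ((x - a) \<bullet> (x - a))) * (1 / c) \<le> 0" using c unfolding nx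
        by (simp add: divide_nonpos_pos)
      then show ?thesis unfolding b_def by (rule smooth_step_le_0)
    qed
  qed (auto simp: b_def smooth_step_bounds)
qed

section \<open>Mollification\<close>

text \<open>\<open>Ck_on\<close> sees one direction at a time. In finite dimension continuity in the
  basis directions gives continuity in operator norm, the form that differentiation under the
  integral asks for.\<close>

lemma Ck_on_Suc_blinfun:
  fixes f :: "'a::euclidean_space \<Rightarrow> 'b::real_normed_vector"
  assumes "Ck_on (Suc k) S f"
  obtains f' where "\<And>x. x \<in> S \<Longrightarrow> (f has_derivative blinfun_apply (f' x)) (at x)" "continuous_on S f'"
    "\<And>x v. x \<in> S \<Longrightarrow> blinfun_apply (f' x) v = frechet_derivative f (at x) v"
proof -
  define f' where "f' x = Blinfun (frechet_derivative f (at x))" for x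
  have eq: "blinfun_apply (f' x) = frechet_derivative f (at x)" if "x \<in> S" for x
    unfolding f'_def
    by (rule bounded_linear_Blinfun_apply) (rule has_derivative_bounded_linear[OF Ck_on_SucD[OF assms that]])
  show thesis
  proof (rule that[of f'])
    show "(f has_derivative blinfun_apply (f' x)) (at x)" if "x \<in> S" for x
      using Ck_on_SucD[OF assms that] eq[OF that] by simp
    show "continuous_on S f'"
    proof (rule continuous_on_blinfun_componentwise)
      fix i :: 'a
      have "continuous_on S (\<lambda>x. frechet_derivative f (at x) i)"
        using assms Ck_on_imp_continuous_on[of k S "\<lambda>x. frechet_derivative f (at x) i"] by simp
      then show "continuous_on S (\<lambda>x. blinfun_apply (f' x) i)"
        by (subst continuous_on_cong[OF refl]) (simp_all add: eq)
    qed
  qed (simp add: eq)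
qed

lemma convolution_has_derivative:
  fixes u f :: "'a::euclidean_space \<Rightarrow> real"
  assumes "continuous_on UNIV u" "\<And>x. (f has_derivative blinfun_apply (f' x)) (at x)" "continuous_on UNIV f'"
  shows "((\<lambda>x. integral (cbox a b) (\<lambda>y. u y * f (x - y))) has_derivative
    blinfun_apply (integral (cbox a b) (\<lambda>y. u y *\<^sub>R f' (x - y)))) (at x)"
proof (rule leibniz_rule[where U = UNIV and fx = "\<lambda>x y. u y *\<^sub>R f' (x - y)", simplified])
  have contf: "continuous_on UNIV f"
    using assms(2) by (meson continuous_at_imp_continuous_on has_derivative_continuous)
  show "((\<lambda>x. u t * f (x - t)) has_derivative blinfun_apply (u t *\<^sub>R f' (x - t))) (at x)" for x t
  proof -
    have "((\<lambda>x. f (x - t)) has_derivative (\<lambda>h. blinfun_apply (f' (x - t)) h)) (at x)"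
      by (rule has_derivative_compose[where f = "\<lambda>x. x - t" and s = UNIV, OF _ assms(2), simplified])
         (auto intro!: derivative_eq_intros)
    then have "((\<lambda>x. u t * f (x - t)) has_derivative (\<lambda>h. u t * blinfun_apply (f' (x - t)) h)) (at x)"
      by (rule has_derivative_mult_right)
    moreover have "blinfun_apply (u t *\<^sub>R f' (x - t)) = (\<lambda>h. u t * blinfun_apply (f' (x - t)) h)"
      by (auto simp: blinfun.scaleR_left)
    ultimately show ?thesis by simp
  qed
  show "(\<lambda>y. u y * f (x - y)) integrable_on cbox a b" for x
    by (intro integrable_continuous continuous_on_mult continuous_on_subset[OF assms(1)]
        continuous_on_compose2[OF contf]) (auto intro!: continuous_intros)
  show "continuous_on (UNIV \<times> cbox a b) (\<lambda>(x, t). u t *\<^sub>R f' (x - t))"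
    unfolding split_beta
    by (intro continuous_on_scaleR continuous_on_compose2[OF assms(1)] continuous_on_compose2[OF assms(3)])
       (auto intro!: continuous_intros)
qed

text \<open>All derivatives fall on the kernel \<open>f\<close>, whose directional derivatives are
  again smooth; hence the induction runs over \<open>f\<close> while \<open>u\<close> stays
  fixed.\<close>

lemma Ck_on_convolution:
  fixes u f :: "'a::euclidean_space \<Rightarrow> real"
  assumes "continuous_on UNIV u" "\<And>k. Ck_on k UNIV f"
  shows "Ck_on k UNIV (\<lambda>x. integral (cbox a b) (\<lambda>y. u y * f (x - y)))"
  using assms(2)
proof (induction k arbitrary: f)
  case 0
  obtain f' where f': "\<And>x. (f has_derivative blinfun_apply (f' x)) (at x)" "continuous_on UNIV f'"
    using Ck_on_Suc_blinfun[OF 0[of "Suc 0"]] by (metis UNIV_I)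
  show ?case
    using convolution_has_derivative[OF assms(1) f'] has_derivative_continuous
    by (force intro!: continuous_at_imp_continuous_on)
next
  case (Suc k)
  obtain f' where f': "\<And>x. (f has_derivative blinfun_apply (f' x)) (at x)" "continuous_on UNIV f'"
     and eq: "\<And>x v. blinfun_apply (f' x) v = frechet_derivative f (at x) v"
    using Ck_on_Suc_blinfun[OF Suc.prems[of "Suc 0"]] by auto
  show ?case
  proof (rule Ck_on_SucI)
    show "((\<lambda>x. integral (cbox a b) (\<lambda>y. u y * f (x - y))) has_derivative
        (\<lambda>v. blinfun_apply (integral (cbox a b) (\<lambda>y. u y *\<^sub>R f' (x - y))) v)) (at x)" for x
      by (rule convolution_has_derivative[OF assms(1) f'])
    have int: "(\<lambda>y. u y *\<^sub>R f' (x - y)) integrable_on cbox a b" for x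
      by (intro integrable_continuous continuous_on_scaleR continuous_on_subset[OF assms(1)]
        continuous_on_compose2[OF f'(2)]) (auto intro!: continuous_intros)
    show "Ck_on k UNIV (\<lambda>x. blinfun_apply (integral (cbox a b) (\<lambda>y. u y *\<^sub>R f' (x - y))) v)" for v
    proof -
      have "Ck_on k UNIV (\<lambda>x. integral (cbox a b) (\<lambda>y. u y * frechet_derivative f (at (x - y)) v))"
        by (rule Suc.IH) (use Suc.prems[of "Suc _"] in auto)
      moreover have "integral (cbox a b) (\<lambda>y. u y * frechet_derivative f (at (x - y)) v)
          = blinfun_apply (integral (cbox a b) (\<lambda>y. u y *\<^sub>R f' (x - y))) v" for x
        by (subst blinfun_apply_integral[OF int]) (simp add: blinfun.scaleR_left eq)
      ultimately show ?thesis by simp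
    qed
  qed simp
qed

lemma lborel_integral_reflect:
  fixes f :: "'a::euclidean_space \<Rightarrow> real"
  assumes "f \<in> borel_measurable borel"
  shows "(\<integral>y. f (x - y) \<partial>lborel) = (\<integral>z. f z \<partial>lborel)"
proof -
  have "lborel = density (distr lborel borel (\<lambda>y. x + (-1) *\<^sub>R y)) (\<lambda>_. ennreal (\<bar>-1\<bar> ^ DIM('a)))"
    by (rule lborel_affine) simp
  then have eq: "lborel = distr lborel borel (\<lambda>y. x - y)" by (simp add: density_1)
  show ?thesis by (subst (2) eq, subst integral_distr) (use assms in auto)
qed

lemma integral_cbox_eq_lborel:
  fixes f :: "'a::euclidean_space \<Rightarrow> real"
  assumes "continuous_on UNIV f" "\<And>x. x \<notin> cbox a b \<Longrightarrow> f x = 0"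
  shows "integral (cbox a b) f = (\<integral>x. f x \<partial>lborel)"
proof -
  have "set_integrable lborel (cbox a b) f"
    unfolding set_integrable_def
    by (intro borel_integrable_compact continuous_on_subset[OF assms(1)]) auto
  from set_borel_integral_eq_integral(2)[OF this]
  have "integral (cbox a b) f = (\<integral>x. indicator (cbox a b) x *\<^sub>R f x \<partial>lborel)"
    by (simp add: set_lebesgue_integral_def)
  also have "\<dots> = (\<integral>x. f x \<partial>lborel)"
    using assms(2) by (intro Bochner_Integration.integral_cong) (auto simp: indicator_def)
  finally show ?thesis .
qed

text \<open>\<open>L\<close> is the closed 1-neighbourhood of \<open>K\<close>. If one of two points
  at distance at most 1 lies in \<open>K\<close>, both lie in the compact \<open>L\<close>;
  otherwise both values are 0. Halving \<open>d\<close> turns the strict inequality into a weak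
  one.\<close>

lemma compact_support_uniformly_continuous:
  fixes f :: "'a::euclidean_space \<Rightarrow> 'b::real_normed_vector"
  assumes "continuous_on UNIV f" "compact K" "\<And>x. x \<notin> K \<Longrightarrow> f x = 0" "e > 0"
  obtains d where "d > 0" "\<And>x y. dist x y \<le> d \<Longrightarrow> dist (f x) (f y) \<le> e"
proof -
  define L where "L = {x + y |x y. x \<in> K \<and> y \<in> cball 0 1}"
  have "compact L" unfolding L_def by (intro compact_sums assms) simp
  then have "uniformly_continuous_on L f"
    by (intro compact_uniformly_continuous continuous_on_subset[OF assms(1)]) auto
  then obtain d where d: "d > 0" "\<And>x y. x \<in> L \<Longrightarrow> y \<in> L \<Longrightarrow> dist y x < d \<Longrightarrow> dist (f y) (f x) < e"
    unfolding uniformly_continuous_on_def using assms(4) by metis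
  have L: "y \<in> L" if "x \<in> K" "dist x y \<le> 1" for x y
  proof -
    have "y = x + (y - x)" "y - x \<in> cball 0 1" using that by (auto simp: dist_norm norm_minus_commute)
    then show ?thesis unfolding L_def using that(1) by blast
  qed
  show thesis
  proof (rule that[of "min (d / 2) 1"])
    fix x y :: 'a assume xy: "dist x y \<le> min (d / 2) 1"
    show "dist (f x) (f y) \<le> e"
    proof (cases "x \<in> K \<or> y \<in> K")
      case True
      then have "x \<in> L" "y \<in> L" using L[of x x] L[of y y] L[of x y] L[of y x] xy by (auto simp: dist_commute)
      then show ?thesis using d(2)[of y x] xy d(1) by auto
    next
      case False
      then show ?thesis using assms(3,4) by auto
    qed
  qed (use d in auto)
qed

text \<open>The kernel has integral 1, so the error is an average of \<open>f (x - y) - f x\<close>.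
  Values in a Banach space allow the same estimate for a function and for its derivative.\<close>

lemma mollify_error:
  fixes f :: "'a::euclidean_space \<Rightarrow> 'b::banach"
  assumes "continuous_on UNIV f" "continuous_on UNIV u" "\<And>y. 0 \<le> u y" "integral (cbox a b) u = 1"
    and "\<And>y. u y \<noteq> 0 \<Longrightarrow> dist (f (x - y)) (f x) \<le> e"
  shows "norm (integral (cbox a b) (\<lambda>y. u y *\<^sub>R f (x - y)) - f x) \<le> e"
proof -
  have u: "u integrable_on cbox a b"
    by (intro integrable_continuous continuous_on_subset[OF assms(2)]) auto
  have i1: "(\<lambda>y. u y *\<^sub>R f (x - y)) integrable_on cbox a b"
    by (intro integrable_continuous continuous_on_scaleR continuous_on_subset[OF assms(2)]
        continuous_on_compose2[OF assms(1)]) (auto intro!: continuous_intros)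
  have i2: "((\<lambda>y. u y *\<^sub>R f x) has_integral 1 *\<^sub>R f x) (cbox a b)"
    using has_integral_scaleR_left[OF integrable_integral[OF u]] assms(4) by auto
  have "integral (cbox a b) (\<lambda>y. u y *\<^sub>R f (x - y)) - f x
      = integral (cbox a b) (\<lambda>y. u y *\<^sub>R f (x - y) - u y *\<^sub>R f x)"
    using i2 by (subst Henstock_Kurzweil_Integration.integral_diff[OF i1]) (auto simp: integral_unique has_integral_integrable)
  also have "norm \<dots> \<le> integral (cbox a b) (\<lambda>y. e * u y)"
  proof (rule integral_norm_bound_integral)
    show "norm (u y *\<^sub>R f (x - y) - u y *\<^sub>R f x) \<le> e * u y" for y
    proof (cases "u y = 0")
      case False
      then show ?thesis
        using mult_left_mono[OF assms(5)[OF False] assms(3)[of y]] assms(3)[of y]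
        by (simp add: scaleR_diff_right[symmetric] dist_norm mult.commute)
    qed simp
  qed (use i1 i2 u in \<open>auto intro!: integrable_diff integrable_on_mult_right simp: has_integral_integrable\<close>)
  also have "\<dots> = e" using assms(4) by simp
  finally show ?thesis .
qed

text \<open>Convolution with a bump of small radius \<open>d\<close>: uniform continuity of
  \<open>v\<close> and of its derivative, both vanishing off \<open>K\<close>, controls both errors
  at once, and the support grows by at most \<open>d\<close>, hence stays in
  \<open>V\<close>.\<close>

lemma C1_approximation:
  fixes v :: "'a::euclidean_space \<Rightarrow> real"
  assumes v: "Ck_on (Suc 0) UNIV v" and K: "compact K" "\<And>x. x \<notin> K \<Longrightarrow> v x = 0"
    and V: "open V" "K \<subseteq> V" and e: "e > 0"
  obtains w L where "\<And>k. Ck_on k UNIV w" "compact L" "L \<subseteq> V" "\<And>x. x \<notin> L \<Longrightarrow> w x = 0"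
    "\<And>x. \<bar>w x - v x\<bar> \<le> e"
    "\<And>x h. \<bar>frechet_derivative w (at x) h - frechet_derivative v (at x) h\<bar> \<le> e * norm h"
proof -
  obtain v' where v': "\<And>x. (v has_derivative blinfun_apply (v' x)) (at x)" "continuous_on UNIV v'"
    and v'eq: "\<And>x h. blinfun_apply (v' x) h = frechet_derivative v (at x) h"
    using Ck_on_Suc_blinfun[OF v] by auto
  have cv: "continuous_on UNIV v" using v Ck_on_imp_continuous_on by blast
  have v'0: "v' x = 0" if "x \<notin> K" for x
  proof -
    have "open (- K)" using K by (simp add: compact_imp_closed open_Compl)
    then have "((\<lambda>_. 0) has_derivative blinfun_apply (v' x)) (at x)"
      by (rule has_derivative_transform_within_open[OF v'(1)]) (use that K in auto)
    then have "blinfun_apply (v' x) = (\<lambda>_. 0)"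
      using has_derivative_unique has_derivative_const by blast
    then show ?thesis by (simp add: blinfun_eqI)
  qed
  obtain d1 where d1: "d1 > 0" "\<And>x y. dist x y \<le> d1 \<Longrightarrow> dist (v x) (v y) \<le> e"
    using compact_support_uniformly_continuous[OF cv K e] by blast
  obtain d2 where d2: "d2 > 0" "\<And>x y. dist x y \<le> d2 \<Longrightarrow> dist (v' x) (v' y) \<le> e"
    using compact_support_uniformly_continuous[OF v'(2) K(1) v'0 e] by blast
  obtain d3 where d3: "d3 > 0" "(\<Union>x\<in>K. ball x d3) \<subseteq> V"
    using compact_subset_open_imp_ball_epsilon_subset[OF K(1) V] by blast
  define d where "d = min (min d1 d2) (d3 / 2)"
  have d: "d > 0" "d \<le> d1" "d \<le> d2" "d < d3" using d1 d2 d3 by (auto simp: d_def)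
  define L where "L = {x + y |x y. x \<in> K \<and> y \<in> cball 0 d}"
  have L: "compact L" unfolding L_def by (intro compact_sums K) simp
  have "L \<subseteq> V"
  proof
    fix z assume "z \<in> L"
    then obtain x y where "z = x + y" "x \<in> K" "norm y \<le> d" by (auto simp: L_def)
    then have "z \<in> ball x d3" using d by (auto simp: dist_norm)
    then show "z \<in> V" using d3(2) \<open>x \<in> K\<close> by (meson UN_I subsetD)
  qed
  obtain b :: "'a \<Rightarrow> real" where b: "\<And>k. Ck_on k UNIV b" "\<And>x. 0 \<le> b x"
    "\<And>x. dist 0 x \<le> d / 2 \<Longrightarrow> b x = 1" "\<And>x. d \<le> dist 0 x \<Longrightarrow> b x = 0"
    using smooth_bump[of "d / 2" d 0] d by (metis half_gt_zero field_sum_of_halves less_add_same_cancel1)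
  have cb: "continuous_on UNIV b" using b(1) Ck_on_imp_continuous_on by blast
  obtain c :: 'a where c: "cball 0 d \<subseteq> cbox (- c) c"
    using bounded_subset_cbox_symmetric[OF bounded_cball] by blast
  obtain a :: 'a where a: "K \<subseteq> cbox (- a) a"
    using bounded_subset_cbox_symmetric[OF compact_imp_bounded[OF K(1)]] by blast
  define I where "I = integral (cbox (- c) c) b"
  have bint: "b integrable_on S" if "S = cbox p q" for S p q
    unfolding that by (intro integrable_continuous continuous_on_subset[OF cb]) auto
  have I: "I > 0"
  proof -
    have "d / (2 * sqrt DIM('a)) > 0" using d by simp
    then obtain r where r: "r = d / (2 * sqrt DIM('a))" "r > 0" by blast
    \<comment> \<open>The cube of half side d/(2n), with n the dimension: the l1 norm on it is at
      most d/2, so it lies where \<open>b\<close> is 1 and its volume bounds \<open>I\<close> from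
      below.\<close>
    define s :: 'a where "s = (\<Sum>i\<in>Basis. (r / sqrt DIM('a)) *\<^sub>R i)"
    have sub: "cbox (- s) s \<subseteq> cball 0 (d / 2)"
    proof
      fix x assume "x \<in> cbox (- s) s"
      then have xi: "\<bar>x \<bullet> i\<bar> \<le> r / sqrt DIM('a)" if "i \<in> Basis" for i
        using that by (auto simp: mem_box s_def)
      have "norm x \<le> (\<Sum>i\<in>Basis. \<bar>x \<bullet> i\<bar>)" by (rule norm_le_l1)
      also have "\<dots> \<le> (\<Sum>i\<in>(Basis::'a set). r / sqrt DIM('a))" by (rule sum_mono) (rule xi)
      also have "\<dots> = sqrt DIM('a) * r"
        by (simp add: field_simps)
      also have "\<dots> = d / 2" by (simp add: r)
      finally show "x \<in> cball 0 (d / 2)" by simp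
    qed
    have "cbox (- s) s \<subseteq> cbox (- c) c" using sub c d by fastforce
    then have "integral (cbox (- s) s) b \<le> I"
      unfolding I_def using b(2) by (intro integral_subset_le bint) auto
    moreover have "integral (cbox (- s) s) b = integral (cbox (- s) s) (\<lambda>_. 1)"
      by (rule Henstock_Kurzweil_Integration.integral_cong) (use sub b(3) in force)
    moreover have "\<dots> = measure lborel (cbox (- s) s)" by simp
    moreover have "\<dots> > 0"
      unfolding content_pos_lt_eq using r(2) by (auto simp: s_def)
    ultimately show ?thesis by linarith
  qed
  define u where "u y = (1 / I) * b y" for y
  have u: "Ck_on k UNIV u" for k unfolding u_def by (intro Ck_on_mult Ck_on_const b) auto
  have cu: "continuous_on UNIV u" using u Ck_on_imp_continuous_on by blast
  have u0: "0 \<le> u y" for y using b(2) I by (simp add: u_def)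
  have ud: "norm y < d" if "u y \<noteq> 0" for y
    using that b(4)[of y] by (force simp: u_def)
  have u1: "integral (cbox (- c) c) u = 1" using I by (simp add: u_def[abs_def] I_def)
  define w where "w x = integral (cbox (- a) a) (\<lambda>y. v y * u (x - y))" for x
  \<comment> \<open>Two readings of one convolution: with the translate on the kernel it is smooth,
    with the translate on \<open>v\<close> it can be compared with \<open>v\<close> and
    differentiated into an average of \<open>v'\<close>.\<close>
  have w: "w x = integral (cbox (- c) c) (\<lambda>y. u y * v (x - y))" for x
  proof -
    have m: "continuous_on UNIV (\<lambda>y. v y * u (x - y))"
      by (intro continuous_on_mult cv continuous_on_compose2[OF cu]) (auto intro!: continuous_intros)
    have "w x = (\<integral>z. v z * u (x - z) \<partial>lborel)"
      unfolding w_def by (rule integral_cbox_eq_lborel[OF m]) (use K a in auto)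
    also have "\<dots> = (\<integral>y. v (x - y) * u (x - (x - y)) \<partial>lborel)"
      by (rule lborel_integral_reflect[symmetric]) (rule borel_measurable_continuous_onI[OF m])
    also have "\<dots> = (\<integral>y. u y * v (x - y) \<partial>lborel)" by (simp add: mult.commute)
    also have "\<dots> = integral (cbox (- c) c) (\<lambda>y. u y * v (x - y))"
    proof (rule integral_cbox_eq_lborel[symmetric])
      show "continuous_on UNIV (\<lambda>y. u y * v (x - y))"
        by (intro continuous_on_mult cu continuous_on_compose2[OF cv]) (auto intro!: continuous_intros)
      show "u y * v (x - y) = 0" if "y \<notin> cbox (- c) c" for y
        using that c ud[of y] by (force simp: less_imp_le)
    qed
    finally show ?thesis .
  qed
  have weq: "w = (\<lambda>x. integral (cbox (- c) c) (\<lambda>y. u y * v (x - y)))" using w by blast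
  show thesis
  proof (rule that[of w L])
    show "Ck_on k UNIV w" for k
      unfolding w_def by (rule Ck_on_convolution[OF cv u])
    show "w x = 0" if x: "x \<notin> L" for x
    proof -
      have "u y * v (x - y) = 0" for y
      proof (cases "u y = 0")
        case False
        have "x - y \<notin> K"
        proof
          assume "x - y \<in> K"
          moreover have "x = (x - y) + y" "y \<in> cball 0 d" using ud[OF False] by auto
          ultimately have "x \<in> L" unfolding L_def by blast
          then show False using x by simp
        qed
        then show ?thesis using K by simp
      qed simp
      then have "(\<lambda>y. u y * v (x - y)) = (\<lambda>y. 0)" by blast
      then show ?thesis unfolding w by (simp only: Henstock_Kurzweil_Integration.integral_0)
    qed
    show "\<bar>w x - v x\<bar> \<le> e" for x
    proof -
      have "norm (integral (cbox (- c) c) (\<lambda>y. u y *\<^sub>R v (x - y)) - v x) \<le> e"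
        by (rule mollify_error[OF cv cu u0 u1]) (rule d1(2), use ud d in \<open>fastforce simp: dist_norm\<close>)
      then show ?thesis by (simp add: w)
    qed
    fix x h
    let ?W = "integral (cbox (- c) c) (\<lambda>y. u y *\<^sub>R v' (x - y))"
    have "(w has_derivative blinfun_apply ?W) (at x)"
      unfolding weq by (rule convolution_has_derivative[OF cu v'])
    then have "frechet_derivative w (at x) h = blinfun_apply ?W h"
      using frechet_derivative_at by metis
    moreover have "norm (?W - v' x) \<le> e"
      by (rule mollify_error[OF v'(2) cu u0 u1]) (rule d2(2), use ud d in \<open>fastforce simp: dist_norm\<close>)
    ultimately show "\<bar>frechet_derivative w (at x) h - frechet_derivative v (at x) h\<bar> \<le> e * norm h"
      using norm_blinfun[of "?W - v' x" h] mult_right_mono[of "norm (?W - v' x)" e "norm h"]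
      by (auto simp: blinfun.diff_left v'eq)
  qed (use L \<open>L \<subseteq> V\<close> in auto)
qed

section \<open>A Poincare type inequality on Euclidean balls\<close>

text \<open>Convexity for positive \<open>s\<close>; at \<open>s = 0\<close> the claim reduces to (1
  - p) J^p \<le> 0.\<close>

lemma powr_above_tangent:
  fixes p s J :: real
  assumes "1 \<le> p" "0 \<le> s" "0 < J"
  shows "J powr p + p * J powr (p - 1) * (s - J) \<le> s powr p"
proof (cases "s = 0")
  case True
  have "J powr (p - 1) * J = J powr p" using assms(3) by (simp add: powr_diff)
  then have "J powr p + p * J powr (p - 1) * (s - J) = (1 - p) * J powr p"
    using True by (simp add: algebra_simps)
  also have "\<dots> \<le> 0" using assms by (simp add: mult_nonpos_nonneg)
  finally show ?thesis using True assms by simp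
next
  case False
  have "p * J powr (p - 1) * (s - J) \<le> s powr p - J powr p"
    by (rule convex_on_imp_above_tangent[OF powr_convex[OF assms(1)]])
       (use False assms in \<open>auto intro!: derivative_eq_intros simp: interior_open\<close>)
  then show ?thesis by simp
qed

text \<open>Integrate the tangent inequality at the mean value over an interval of length 1: the
  linear term cancels. A zero mean is trivial because the right side is nonnegative.\<close>

lemma jensen_powr_unit_interval:
  fixes f :: "real \<Rightarrow> real"
  assumes "1 \<le> p" "continuous_on {0..1} f" "\<And>s. s \<in> {0..1} \<Longrightarrow> 0 \<le> f s"
  shows "(integral {0..1} f) powr p \<le> integral {0..1} (\<lambda>s. f s powr p)"
proof -
  let ?J = "integral {0..1} f"
  have f: "f integrable_on {0..1}" by (rule integrable_continuous_real) fact
  have "continuous_on {0..1} (\<lambda>s. f s powr p)"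
    by (rule continuous_on_powr'[OF assms(2) continuous_on_const]) (use assms in auto)
  then have fp: "(\<lambda>s. f s powr p) integrable_on {0..1}" by (rule integrable_continuous_real)
  have "?J \<ge> 0" by (rule Henstock_Kurzweil_Integration.integral_nonneg[OF f]) (use assms in auto)
  moreover have "?thesis" if "?J > 0"
  proof -
    have const: "((\<lambda>s. c) has_integral c) {0..1::real}" for c :: real
      using has_integral_const[of c "0::real" 1] by simp
    have "((\<lambda>s. ?J powr p + p * ?J powr (p - 1) * (f s - ?J)) has_integral
        ?J powr p + p * ?J powr (p - 1) * (?J - ?J)) {0..1}"
      by (intro has_integral_add has_integral_mult_right has_integral_diff integrable_integral f const)
    then have "((\<lambda>s. ?J powr p + p * ?J powr (p - 1) * (f s - ?J)) has_integral ?J powr p) {0..1}"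
      by simp
    from has_integral_le[OF this integrable_integral[OF fp]]
    show ?thesis using powr_above_tangent[OF assms(1,3) that] by blast
  qed
  moreover have "integral {0..1} (\<lambda>s. f s powr p) \<ge> 0"
    by (rule Henstock_Kurzweil_Integration.integral_nonneg[OF fp]) auto
  ultimately show ?thesis by (cases "?J = 0") auto
qed

lemma add_powr_le:
  fixes a b p :: real
  assumes "0 \<le> a" "0 \<le> b" "0 \<le> p"
  shows "(a + b) powr p \<le> 2 powr p * (a powr p + b powr p)"
proof -
  have "(a + b) powr p \<le> (2 * max a b) powr p" using assms by (intro powr_mono2) auto
  also have "\<dots> = 2 powr p * max a b powr p" using assms by (simp add: powr_mult)
  also have "\<dots> \<le> 2 powr p * (a powr p + b powr p)" by (intro mult_left_mono) (auto simp: max_def)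
  finally show ?thesis .
qed

lemma nn_integral_lborel_affine:
  fixes f :: "'a::euclidean_space \<Rightarrow> ennreal"
  assumes "f \<in> borel_measurable borel" "c \<noteq> 0"
  shows "(\<integral>\<^sup>+x. f x \<partial>lborel) = ennreal (\<bar>c\<bar> ^ DIM('a)) * (\<integral>\<^sup>+x. f (t + c *\<^sub>R x) \<partial>lborel)"
proof -
  have "(\<integral>\<^sup>+x. f x \<partial>lborel) = (\<integral>\<^sup>+x. f x \<partial>density (distr lborel borel (\<lambda>x. t + c *\<^sub>R x)) (\<lambda>_. \<bar>c\<bar> ^ DIM('a)))"
    using lborel_affine[OF assms(2), of t] by simp
  also have "\<dots> = ennreal (\<bar>c\<bar> ^ DIM('a)) * (\<integral>\<^sup>+x. f (t + c *\<^sub>R x) \<partial>lborel)"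
    using assms(1) by (simp add: nn_integral_density nn_integral_distr nn_integral_cmult)
  finally show ?thesis .
qed

text \<open>The fundamental theorem of calculus bounds the increment by \<open>r\<close> times the
  mean of the norm of the derivative along the segment; Jensen moves the power inside the
  mean.\<close>

lemma segment_increment_powr_le:
  fixes v :: "'a::euclidean_space \<Rightarrow> real" and v' :: "'a \<Rightarrow> 'a \<Rightarrow>\<^sub>L real"
  assumes "1 \<le> p" "convex B" "x \<in> B" "z \<in> B" "dist x z \<le> r"
    and der: "\<And>y. y \<in> B \<Longrightarrow> (v has_derivative blinfun_apply (v' y)) (at y)" and cont: "continuous_on B v'"
  shows "ennreal (\<bar>v z - v x\<bar> powr p)
    \<le> ennreal (r powr p) * (\<integral>\<^sup>+s. indicator {0..1} s * ennreal (norm (v' (x + s *\<^sub>R (z - x))) powr p) \<partial>lborel)"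
proof -
  define \<gamma> where "\<gamma> s = x + s *\<^sub>R (z - x)" for s :: real
  have r: "0 \<le> r" using assms(5) zero_le_dist[of x z] by linarith
  have \<gamma>: "\<gamma> s \<in> B" if "s \<in> {0..1}" for s
  proof -
    have "(1 - s) *\<^sub>R x + s *\<^sub>R z \<in> B" using that assms convexD by fastforce
    then show ?thesis by (simp add: \<gamma>_def algebra_simps)
  qed
  have cn: "continuous_on {0..1} (\<lambda>s. norm (v' (\<gamma> s)))"
    by (intro continuous_on_norm continuous_on_compose2[OF cont]) (use \<gamma> in \<open>auto simp: \<gamma>_def intro!: continuous_intros\<close>)
  have "((\<lambda>s. blinfun_apply (v' (\<gamma> s)) (z - x)) has_integral v (\<gamma> 1) - v (\<gamma> 0)) {0..1}"
  proof (rule fundamental_theorem_of_calculus)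
    fix s :: real assume s: "s \<in> {0..1}"
    have "(\<gamma> has_derivative (\<lambda>h. h *\<^sub>R (z - x))) (at s)"
      unfolding \<gamma>_def[abs_def] by (auto intro!: derivative_eq_intros)
    then have "((\<lambda>s. v (\<gamma> s)) has_derivative (\<lambda>h. blinfun_apply (v' (\<gamma> s)) (h *\<^sub>R (z - x)))) (at s)"
      by (rule has_derivative_compose) (rule der[OF \<gamma>[OF s]])
    then show "((\<lambda>s. v (\<gamma> s)) has_vector_derivative blinfun_apply (v' (\<gamma> s)) (z - x)) (at s within {0..1})"
      by (auto simp: has_vector_derivative_def blinfun.scaleR_right intro: has_derivative_at_withinI)
  qed simp
  then have eq: "v z - v x = integral {0..1} (\<lambda>s. blinfun_apply (v' (\<gamma> s)) (z - x))"
    and int: "(\<lambda>s. blinfun_apply (v' (\<gamma> s)) (z - x)) integrable_on {0..1}"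
    by (auto simp: \<gamma>_def integral_unique has_integral_integrable)
  have "\<bar>v z - v x\<bar> \<le> integral {0..1} (\<lambda>s. norm (v' (\<gamma> s)) * r)"
    unfolding eq real_norm_def[symmetric]
  proof (rule integral_norm_bound_integral[OF int])
    show "(\<lambda>s. norm (v' (\<gamma> s)) * r) integrable_on {0..1}"
      by (intro integrable_continuous_real continuous_intros cn)
    show "norm (blinfun_apply (v' (\<gamma> s)) (z - x)) \<le> norm (v' (\<gamma> s)) * r" for s
      using norm_blinfun[of "v' (\<gamma> s)" "z - x"] assms(5)
      by (smt (verit) dist_norm mult_left_mono norm_ge_zero norm_minus_commute)
  qed
  then have "\<bar>v z - v x\<bar> powr p \<le> (integral {0..1} (\<lambda>s. norm (v' (\<gamma> s)) * r)) powr p"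
    using assms(1) by (intro powr_mono2) auto
  also have "\<dots> \<le> integral {0..1} (\<lambda>s. (norm (v' (\<gamma> s)) * r) powr p)"
    by (rule jensen_powr_unit_interval[OF assms(1)]) (use r in \<open>auto intro!: continuous_intros cn\<close>)
  also have "\<dots> = r powr p * integral {0..1} (\<lambda>s. norm (v' (\<gamma> s)) powr p)"
    using r by (simp add: powr_mult mult.commute)
  finally have le: "\<bar>v z - v x\<bar> powr p \<le> r powr p * integral {0..1} (\<lambda>s. norm (v' (\<gamma> s)) powr p)" .
  have "continuous_on {0..1} (\<lambda>s. norm (v' (\<gamma> s)) powr p)"
    by (rule continuous_on_powr'[OF cn continuous_on_const]) (use assms(1) in auto)
  then have "((\<lambda>s. norm (v' (\<gamma> s)) powr p) has_integral integral {0..1} (\<lambda>s. norm (v' (\<gamma> s)) powr p)) {0..1}"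
    by (intro integrable_integral integrable_continuous_real)
  then have "ennreal (integral {0..1} (\<lambda>s. norm (v' (\<gamma> s)) powr p))
      = (\<integral>\<^sup>+s. ennreal (indicator {0..1} s * (norm (v' (\<gamma> s)) powr p)) \<partial>lborel)"
    by (intro nn_integral_has_integral_lebesgue[symmetric]) auto
  also have "\<dots> = (\<integral>\<^sup>+s. indicator {0..1} s * ennreal (norm (v' (\<gamma> s)) powr p) \<partial>lborel)"
    by (intro nn_integral_cong) (auto simp: indicator_def)
  finally show ?thesis
    using ennreal_leI[OF le] by (simp add: ennreal_mult' \<gamma>_def)
qed

text \<open>Passing through the midpoint of \<open>x\<close> and \<open>y\<close> restricts the segment parameter to \<open>s / 2 \<le> 1 / 2\<close>, where
  the substitution \<open>x \<mapsto> x + (s / 2) (y - x)\<close> has Jacobian at least \<open>2\<^sup>-\<^sup>n\<close>.\<close>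

lemma poincare_ball:
  fixes a :: "'a::euclidean_space" and p r :: real
  assumes p: "1 \<le> p" and r: "0 < r"
  shows "\<exists>C\<ge>0. \<forall>v v'. (\<forall>y\<in>ball a r. (v has_derivative blinfun_apply (v' y)) (at y)) \<longrightarrow> continuous_on (ball a r) v' \<longrightarrow>
      (\<integral>\<^sup>+x. indicator (ball a r) x * (\<integral>\<^sup>+y. indicator (ball a r) y * ennreal (\<bar>v x - v y\<bar> powr p) \<partial>lborel) \<partial>lborel)
      \<le> ennreal C * (\<integral>\<^sup>+x. indicator (ball a r) x * ennreal (norm (v' x) powr p) \<partial>lborel)"
proof -
  let ?B = "ball a r"
  \<comment> \<open>In the final constant \<open>2 * Cp * vol * 2 ^ DIM('a)\<close> the 2 counts the
    two half segments, \<open>2 powr p\<close> comes from splitting at the midpoint,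
    \<open>r powr p\<close> from the length of a half segment, \<open>vol\<close> from the free
    endpoint and \<open>2 ^ DIM('a)\<close> from the Jacobian.\<close>
  define Cp where "Cp = 2 powr p * r powr p"
  define vol where "vol = measure lborel ?B"
  have vol: "emeasure lborel ?B = ennreal vol"
    unfolding vol_def by (rule emeasure_eq_ennreal_measure) (use emeasure_bounded_finite[OF bounded_ball, of a r] in auto)
  show ?thesis
  proof (intro exI[of _ "2 * Cp * vol * 2 ^ DIM('a)"] conjI allI impI)
    fix v :: "'a \<Rightarrow> real" and v' :: "'a \<Rightarrow> 'a \<Rightarrow>\<^sub>L real"
    assume "\<forall>y\<in>?B. (v has_derivative blinfun_apply (v' y)) (at y)"
    then have der: "\<And>y. y \<in> ?B \<Longrightarrow> (v has_derivative blinfun_apply (v' y)) (at y)" by blast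
    assume cont: "continuous_on ?B v'"
    define H where "H z = indicator ?B z * ennreal (norm (v' z) powr p)" for z
    have "continuous_on ?B (\<lambda>z. norm (v' z) powr p)"
      by (rule continuous_on_powr'[OF continuous_on_norm[OF cont] continuous_on_const]) (use p in auto)
    then have "(\<lambda>z. indicator ?B z *\<^sub>R (norm (v' z) powr p)) \<in> borel_measurable borel"
      by (intro borel_measurable_continuous_on_indicator) auto
    then have "(\<lambda>z. ennreal (indicator ?B z *\<^sub>R (norm (v' z) powr p))) \<in> borel_measurable borel"
      by measurable
    moreover have "(\<lambda>z. ennreal (indicator ?B z *\<^sub>R (norm (v' z) powr p))) = H"
      by (auto simp: H_def indicator_def)
    ultimately have H[measurable]: "H \<in> borel_measurable borel" by metis
    \<comment> \<open>For \<open>x\<close> and \<open>y\<close> in the ball this is the mean of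
      \<open>norm (v' z) powr p\<close> along the half segment from \<open>x\<close> to the
      midpoint. \<open>H\<close> vanishes off the ball, so the later substitution can run over the
      whole space.\<close>
    define \<Phi> where "\<Phi> x y = (\<integral>\<^sup>+s. indicator {0..1} s * H (x + (s / 2) *\<^sub>R (y - x)) \<partial>lborel)" for x y
    have \<Phi>m: "(\<lambda>(x, y). \<Phi> x y) \<in> borel_measurable (lborel \<Otimes>\<^sub>M lborel)"
      unfolding \<Phi>_def by measurable
    have [measurable (raw)]: "(\<lambda>w. \<Phi> (f w) (g w)) \<in> borel_measurable N"
      if "f \<in> N \<rightarrow>\<^sub>M borel" "g \<in> N \<rightarrow>\<^sub>M borel" for f g :: "'w \<Rightarrow> 'a" and N :: "'w measure"
    proof -
      have "(\<lambda>w. (f w, g w)) \<in> N \<rightarrow>\<^sub>M (lborel \<Otimes>\<^sub>M lborel)"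
        using that by (intro measurable_Pair) auto
      from measurable_compose[OF this \<Phi>m] show ?thesis by simp
    qed
    have [measurable]: "?B \<in> sets borel" by simp
    have half: "ennreal (\<bar>v ((1/2) *\<^sub>R (x + y)) - v x\<bar> powr p) \<le> ennreal (r powr p) * \<Phi> x y"
      if xy: "x \<in> ?B" "y \<in> ?B" for x y
    proof -
      let ?m = "(1/2) *\<^sub>R (x + y)"
      have m: "?m \<in> ?B" using convexD[OF convex_ball xy, of "1/2" "1/2"] by (simp add: algebra_simps)
      have "dist x y \<le> dist a x + dist a y" by (metis dist_commute dist_triangle)
      moreover have "x - ?m = (1/2) *\<^sub>R (x - y)"
        by (rule euclidean_eqI) (simp add: inner_simps field_simps)
      then have "dist x ?m = dist x y / 2" by (simp add: dist_norm)
      ultimately have xm: "dist x ?m \<le> r" using xy by simp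
      have mid: "x + s *\<^sub>R (?m - x) = x + (s / 2) *\<^sub>R (y - x)" for s
        by (rule euclidean_eqI) (simp add: inner_simps field_simps)
      have inB: "x + (s / 2) *\<^sub>R (y - x) \<in> ?B" if "s \<in> {0..1}" for s
        using convexD[OF convex_ball xy, of "1 - s/2" "s/2"] that by (simp add: algebra_simps)
      have "ennreal (\<bar>v ?m - v x\<bar> powr p)
        \<le> ennreal (r powr p) * (\<integral>\<^sup>+s. indicator {0..1} s * ennreal (norm (v' (x + s *\<^sub>R (?m - x))) powr p) \<partial>lborel)"
        by (rule segment_increment_powr_le[OF p convex_ball xy(1) m xm der cont])
      also have "(\<integral>\<^sup>+s. indicator {0..1} s * ennreal (norm (v' (x + s *\<^sub>R (?m - x))) powr p) \<partial>lborel) = \<Phi> x y"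
        unfolding \<Phi>_def mid using inB by (intro nn_integral_cong) (auto simp: H_def indicator_def)
      finally show ?thesis .
    qed
    have pt: "ennreal (\<bar>v x - v y\<bar> powr p) \<le> ennreal Cp * (\<Phi> x y + \<Phi> y x)"
      if xy: "x \<in> ?B" "y \<in> ?B" for x y
    proof -
      let ?m = "(1/2) *\<^sub>R (x + y)"
      have "\<bar>v x - v y\<bar> powr p \<le> (\<bar>v ?m - v x\<bar> + \<bar>v ?m - v y\<bar>) powr p"
        using p by (intro powr_mono2) auto
      also have "\<dots> \<le> 2 powr p * (\<bar>v ?m - v x\<bar> powr p + \<bar>v ?m - v y\<bar> powr p)"
        using p by (intro add_powr_le) auto
      finally have "ennreal (\<bar>v x - v y\<bar> powr p) \<le> ennreal (2 powr p) * (ennreal (\<bar>v ?m - v x\<bar> powr p) + ennreal (\<bar>v ?m - v y\<bar> powr p))"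
        by (simp add: ennreal_leI flip: ennreal_mult' ennreal_plus)
      also have "\<dots> \<le> ennreal (2 powr p) * (ennreal (r powr p) * \<Phi> x y + ennreal (r powr p) * \<Phi> y x)"
        using half[OF xy] half[OF xy(2,1)] by (intro mult_left_mono add_mono) (auto simp: add.commute)
      also have "\<dots> = ennreal Cp * (\<Phi> x y + \<Phi> y x)"
        by (simp add: Cp_def ennreal_mult' distrib_left mult.assoc)
      finally show ?thesis .
    qed
    have aff: "(\<integral>\<^sup>+x. H (x + (s / 2) *\<^sub>R (y - x)) \<partial>lborel) \<le> 2 ^ DIM('a) * (\<integral>\<^sup>+z. H z \<partial>lborel)"
      if "s \<in> {0..1}" for s y
    proof -
      let ?X = "\<integral>\<^sup>+x. H (x + (s / 2) *\<^sub>R (y - x)) \<partial>lborel"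
      have "(\<integral>\<^sup>+z. H z \<partial>lborel) = ennreal (\<bar>1 - s/2\<bar> ^ DIM('a)) * (\<integral>\<^sup>+x. H ((s/2) *\<^sub>R y + (1 - s/2) *\<^sub>R x) \<partial>lborel)"
        by (rule nn_integral_lborel_affine[OF H]) (use that in auto)
      also have "(\<integral>\<^sup>+x. H ((s/2) *\<^sub>R y + (1 - s/2) *\<^sub>R x) \<partial>lborel) = ?X"
        by (intro nn_integral_cong arg_cong[where f = H]) (simp add: algebra_simps)
      finally have "ennreal ((1/2) ^ DIM('a)) * ?X \<le> (\<integral>\<^sup>+z. H z \<partial>lborel)"
        using that by (auto intro!: mult_right_mono ennreal_leI power_mono)
      then have "ennreal (2 ^ DIM('a)) * (ennreal ((1/2) ^ DIM('a)) * ?X) \<le> ennreal (2 ^ DIM('a)) * (\<integral>\<^sup>+z. H z \<partial>lborel)"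
        by (rule mult_left_mono) simp
      moreover have "ennreal (2 ^ DIM('a)) * (ennreal ((1/2) ^ DIM('a)) * ?X) = ?X"
        by (simp add: mult.assoc[symmetric] ennreal_mult'[symmetric] power_mult_distrib[symmetric])
      ultimately show ?thesis by (simp add: ennreal_power[symmetric])
    qed
    \<comment> \<open>Renaming the variables shows that \<open>T\<close> measures both half
      segments. Integrating first over \<open>x\<close>, the endpoint next to the half segment, is
      what keeps the substitution nondegenerate.\<close>
    define T where "T = (\<integral>\<^sup>+x. \<integral>\<^sup>+y. indicator ?B x * indicator ?B y * \<Phi> x y \<partial>lborel \<partial>lborel)"
    have T1: "T = (\<integral>\<^sup>+y. \<integral>\<^sup>+x. indicator ?B x * indicator ?B y * \<Phi> x y \<partial>lborel \<partial>lborel)"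
      unfolding T_def by (rule lborel_pair.Fubini') measurable
    note T1
    also have "(\<integral>\<^sup>+y. \<integral>\<^sup>+x. indicator ?B x * indicator ?B y * \<Phi> x y \<partial>lborel \<partial>lborel)
       \<le> (\<integral>\<^sup>+y. indicator ?B y * (2 ^ DIM('a) * (\<integral>\<^sup>+z. H z \<partial>lborel)) \<partial>lborel)"
    proof (rule nn_integral_mono)
      fix y :: 'a
      have "(\<integral>\<^sup>+x. indicator ?B x * indicator ?B y * \<Phi> x y \<partial>lborel) \<le> (\<integral>\<^sup>+x. indicator ?B y * \<Phi> x y \<partial>lborel)"
        by (intro nn_integral_mono) (auto simp: indicator_def)
      also have "\<dots> = indicator ?B y * (\<integral>\<^sup>+x. \<Phi> x y \<partial>lborel)"
        by (rule nn_integral_cmult) measurable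
      also have "(\<integral>\<^sup>+x. \<Phi> x y \<partial>lborel) = (\<integral>\<^sup>+s. \<integral>\<^sup>+x. indicator {0..1} s * H (x + (s / 2) *\<^sub>R (y - x)) \<partial>lborel \<partial>lborel)"
        unfolding \<Phi>_def by (rule lborel_pair.Fubini'[symmetric]) measurable
      also have "\<dots> \<le> (\<integral>\<^sup>+s. indicator {0..1::real} s * (2 ^ DIM('a) * (\<integral>\<^sup>+z. H z \<partial>lborel)) \<partial>lborel)"
        by (rule nn_integral_mono) (use aff in \<open>auto simp: indicator_def nn_integral_cmult\<close>)
      also have "\<dots> = 2 ^ DIM('a) * (\<integral>\<^sup>+z. H z \<partial>lborel)"
        by (subst nn_integral_multc) auto
      finally show "(\<integral>\<^sup>+x. indicator ?B x * indicator ?B y * \<Phi> x y \<partial>lborel) \<le> indicator ?B y * (2 ^ DIM('a) * (\<integral>\<^sup>+z. H z \<partial>lborel))"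
        by (auto simp: indicator_def mult_left_mono)
    qed
    also have "\<dots> = ennreal vol * (2 ^ DIM('a) * (\<integral>\<^sup>+z. H z \<partial>lborel))"
      by (subst nn_integral_multc) (auto simp: vol)
    finally have T: "T \<le> ennreal vol * (2 ^ DIM('a) * (\<integral>\<^sup>+z. H z \<partial>lborel))" .
    have T2: "T = (\<integral>\<^sup>+x. \<integral>\<^sup>+y. indicator ?B x * indicator ?B y * \<Phi> y x \<partial>lborel \<partial>lborel)"
      unfolding T1 by (simp add: mult.commute)
    have "(\<integral>\<^sup>+x. indicator ?B x * (\<integral>\<^sup>+y. indicator ?B y * ennreal (\<bar>v x - v y\<bar> powr p) \<partial>lborel) \<partial>lborel)
      \<le> (\<integral>\<^sup>+x. \<integral>\<^sup>+y. ennreal Cp * (indicator ?B x * indicator ?B y * \<Phi> x y + indicator ?B x * indicator ?B y * \<Phi> y x) \<partial>lborel \<partial>lborel)"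
    proof (rule nn_integral_mono)
      fix x :: 'a
      show "indicator ?B x * (\<integral>\<^sup>+y. indicator ?B y * ennreal (\<bar>v x - v y\<bar> powr p) \<partial>lborel) \<le>
        (\<integral>\<^sup>+y. ennreal Cp * (indicator ?B x * indicator ?B y * \<Phi> x y + indicator ?B x * indicator ?B y * \<Phi> y x) \<partial>lborel)"
      proof (cases "x \<in> ?B")
        case True
        then show ?thesis using pt[OF True] by (auto simp: indicator_def intro!: nn_integral_mono)
      qed simp
    qed
    also have "\<dots> = (\<integral>\<^sup>+x. ennreal Cp * ((\<integral>\<^sup>+y. indicator ?B x * indicator ?B y * \<Phi> x y \<partial>lborel) +
         (\<integral>\<^sup>+y. indicator ?B x * indicator ?B y * \<Phi> y x \<partial>lborel)) \<partial>lborel)"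
      by (intro nn_integral_cong) (simp add: nn_integral_cmult nn_integral_add)
    also have "\<dots> = ennreal Cp * (T + T)"
      by (subst nn_integral_cmult, measurable, subst nn_integral_add, measurable) (use T2 in \<open>simp add: T_def\<close>)
    also have "\<dots> \<le> ennreal Cp * (2 * (ennreal vol * (2 ^ DIM('a) * (\<integral>\<^sup>+z. H z \<partial>lborel))))"
      unfolding mult_2 by (intro mult_left_mono add_mono T) auto
    also have "\<dots> = ennreal (2 * Cp * vol * 2 ^ DIM('a)) * (\<integral>\<^sup>+z. H z \<partial>lborel)"
      by (simp add: ennreal_mult' ennreal_mult'' Cp_def vol_def ennreal_power[symmetric] mult_ac)
    finally show "(\<integral>\<^sup>+x. indicator ?B x * (\<integral>\<^sup>+y. indicator ?B y * ennreal (\<bar>v x - v y\<bar> powr p) \<partial>lborel) \<partial>lborel)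
      \<le> ennreal (2 * Cp * vol * 2 ^ DIM('a)) * (\<integral>\<^sup>+x. indicator ?B x * ennreal (norm (v' x) powr p) \<partial>lborel)"
      by (simp add: H_def)
  qed (auto simp: Cp_def vol_def)
qed

section \<open>Positive definite matrices\<close>

definition posdef :: "real^'n^'n \<Rightarrow> bool" where
  "posdef G \<longleftrightarrow> transpose G = G \<and> (\<forall>v. v \<noteq> 0 \<longrightarrow> v \<bullet> (G *v v) > 0)"

text \<open>The dual norm of a covector. If \<open>w\<close> is the coordinate differential of a
  function and \<open>G\<close> the metric, the gradient is the vector \<open>v\<close> with
  \<open>G *v v = w\<close>, and its length is \<open>conorm G w\<close>.\<close>

definition conorm :: "real^'n^'n \<Rightarrow> real^'n \<Rightarrow> real" where
  "conorm G w = sqrt (w \<bullet> (matrix_inv G *v w))"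

lemma posdef_invertible:
  fixes G :: "real^'n::finite^'n"
  assumes "posdef G"
  shows "invertible G"
proof -
  have "v = 0" if "G *v v = 0" for v
    using assms that unfolding posdef_def by (metis inner_zero_right less_irrefl)
  then show ?thesis
    by (metis invertible_left_inverse matrix_left_invertible_ker)
qed

lemma invertible_matrix_inv:
  fixes G :: "real^'n::finite^'n"
  assumes "invertible G"
  shows "G ** matrix_inv G = mat 1" "matrix_inv G ** G = mat 1"
  using someI_ex[OF assms[unfolded invertible_def]] unfolding matrix_inv_def by auto

lemma posdef_inv_solves:
  fixes G :: "real^'n::finite^'n"
  assumes "posdef G"
  shows "G *v (matrix_inv G *v w) = w" "matrix_inv G *v (G *v w) = w"
  using invertible_matrix_inv[OF posdef_invertible[OF assms]]
  by (simp_all add: matrix_vector_mul_assoc)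

lemma conorm_eqI:
  fixes G :: "real^'n::finite^'n"
  assumes "posdef G" "G *v v = w"
  shows "conorm G w = sqrt (v \<bullet> w)"
  using posdef_inv_solves(2)[OF assms(1)] assms(2) by (auto simp: conorm_def inner_commute)

lemma posdef_inverse_form:
  fixes G :: "real^'n::finite^'n"
  assumes "posdef G"
  shows "w \<bullet> (matrix_inv G *v w) = (matrix_inv G *v w) \<bullet> (G *v (matrix_inv G *v w))"
  by (simp add: posdef_inv_solves[OF assms] inner_commute)

lemma posdef_nonneg:
  fixes G :: "real^'n::finite^'n"
  assumes "posdef G"
  shows "0 \<le> v \<bullet> (G *v v)"
  using assms unfolding posdef_def by (cases "v = 0") (auto simp: less_imp_le)

lemma conorm_nonneg:
  fixes G :: "real^'n::finite^'n"
  assumes "posdef G"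
  shows "0 \<le> conorm G w"
  unfolding conorm_def posdef_inverse_form[OF assms] by (simp add: posdef_nonneg[OF assms])

lemma conorm_zero [simp]: "conorm G 0 = 0"
  by (simp add: conorm_def)

lemma conorm_scaleR: "conorm G (k *\<^sub>R w) = \<bar>k\<bar> * conorm G w"
proof -
  have "(k *\<^sub>R w) \<bullet> (matrix_inv G *v (k *\<^sub>R w)) = k\<^sup>2 * (w \<bullet> (matrix_inv G *v w))"
    by (simp add: matrix_vector_mult_scaleR power2_eq_square)
  then show ?thesis by (simp add: conorm_def real_sqrt_mult)
qed

text \<open>By the parallelogram law; the sharp triangle inequality is not needed.\<close>

lemma conorm_add_le:
  fixes G :: "real^'n::finite^'n"
  assumes "posdef G"
  shows "conorm G (a + b) \<le> 2 * (conorm G a + conorm G b)"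
proof -
  define q where "q w = w \<bullet> (matrix_inv G *v w)" for w
  have q0: "0 \<le> q w" for w
    unfolding q_def posdef_inverse_form[OF assms] by (rule posdef_nonneg[OF assms])
  have "q (a + b) + q (a - b) = 2 * q a + 2 * q b"
    by (simp add: q_def matrix_vector_right_distrib matrix_vector_mult_diff_distrib inner_add_left inner_diff_left
        inner_add_right inner_diff_right)
  then have "q (a + b) \<le> 2 * q a + 2 * q b" using q0[of "a - b"] by linarith
  also have "\<dots> \<le> (2 * (sqrt (q a) + sqrt (q b)))\<^sup>2"
  proof -
    define s t where "s = sqrt (q a)" and "t = sqrt (q b)"
    have "0 \<le> s" "0 \<le> t" "q a = s\<^sup>2" "q b = t\<^sup>2" using q0[of a] q0[of b] by (auto simp: s_def t_def)
    moreover from this have "0 \<le> s * t" by simp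
    ultimately show ?thesis unfolding s_def[symmetric] t_def[symmetric]
      by (simp add: power2_eq_square algebra_simps)
  qed
  finally have "sqrt (q (a + b)) \<le> 2 * (sqrt (q a) + sqrt (q b))"
    using q0 by (intro real_le_lsqrt) auto
  then show ?thesis by (simp add: conorm_def q_def)
qed

text \<open>If \<open>G *v v = w\<close>, then \<open>J *v v\<close> solves the corresponding
  equation for \<open>H\<close> and \<open>u\<close>, and both dual norms are roots of the same
  pairing. \<open>transpose J\<close> can be cancelled because invertibility of \<open>G\<close>
  makes it invertible.\<close>

lemma conorm_pullback:
  fixes G H J :: "real^'n::finite^'n"
  assumes "posdef G" "posdef H" "G = transpose J ** H ** J" "w = transpose J *v u"
  shows "conorm G w = conorm H u"
proof -
  define v where "v = matrix_inv G *v w"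
  have v: "G *v v = w" unfolding v_def by (rule posdef_inv_solves[OF assms(1)])
  obtain G' where "G ** G' = mat 1" using posdef_invertible[OF assms(1)] invertible_def by blast
  then have "transpose J ** (H ** J ** G') = mat 1"
    using assms(3) by (simp add: matrix_mul_assoc)
  then have "invertible (transpose J)" using invertible_right_inverse by blast
  then have inj: "inj ((*v) (transpose J))" by (rule inj_matrix_vector_mult)
  have "transpose J *v (H *v (J *v v)) = transpose J *v u"
    using v assms(3,4) by (simp only: matrix_vector_mul_assoc matrix_mul_assoc)
  then have "H *v (J *v v) = u" using injD[OF inj] by blast
  then have "conorm H u = sqrt ((J *v v) \<bullet> u)" by (rule conorm_eqI[OF assms(2)])
  also have "(J *v v) \<bullet> u = v \<bullet> w"
    unfolding assms(4) using dot_lmul_matrix[of u J v] by (simp add: inner_commute)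
  finally show ?thesis using conorm_eqI[OF assms(1) v] by simp
qed

text \<open>Write \<open>w = G *v v\<close>, so the squared dual norm is
  \<open>v \<bullet> w\<close>. Coercivity and \<open>norm w \<le> L * norm v\<close> give the lower
  bound; Cauchy-Schwarz and \<open>norm v \<le> norm w / l\<close> give the upper one.\<close>

lemma conorm_bounds:
  fixes G :: "real^'n::finite^'n"
  assumes "posdef G" "0 < l" "0 < L" "\<And>v. l * (norm v)\<^sup>2 \<le> v \<bullet> (G *v v)" "\<And>v. norm (G *v v) \<le> L * norm v"
  shows "sqrt l / L * norm w \<le> conorm G w" "conorm G w \<le> 1 / sqrt l * norm w"
proof -
  define v where "v = matrix_inv G *v w"
  have v: "G *v v = w" unfolding v_def by (rule posdef_inv_solves[OF assms(1)])
  have c: "conorm G w = sqrt (v \<bullet> w)" by (rule conorm_eqI[OF assms(1) v])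
  have nw: "norm w \<le> L * norm v" using assms(5)[of v] v by simp
  have lv: "l * (norm v)\<^sup>2 \<le> v \<bullet> w" using assms(4)[of v] v by simp
  have "sqrt l / L * norm w \<le> sqrt l * norm v"
    using nw assms(2,3) by (simp add: field_simps mult_left_mono)
  also have "\<dots> = sqrt (l * (norm v)\<^sup>2)" by (simp add: real_sqrt_mult)
  also have "\<dots> \<le> conorm G w" using lv by (simp add: c)
  finally show "sqrt l / L * norm w \<le> conorm G w" .
  have cs: "v \<bullet> w \<le> norm v * norm w" by (rule norm_cauchy_schwarz)
  have "l * norm v \<le> norm w"
  proof (cases "v = 0")
    case False
    have "norm v * (l * norm v) \<le> norm v * norm w" using lv cs by (simp add: power2_eq_square mult_ac)
    then show ?thesis using False by simp
  qed simp
  then have "norm v \<le> norm w / l" using assms(2) by (simp add: field_simps)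
  then have "v \<bullet> w \<le> norm w / l * norm w" using cs mult_right_mono[of "norm v" "norm w / l" "norm w"] by simp
  also have "\<dots> = (1 / sqrt l * norm w)\<^sup>2" using assms(2) by (simp add: power2_eq_square)
  finally show "conorm G w \<le> 1 / sqrt l * norm w"
    unfolding c using assms(2) by (intro real_le_lsqrt) auto
qed

lemma continuous_on_det:
  fixes A :: "'a::topological_space \<Rightarrow> real^'n::finite^'n"
  assumes "continuous_on S A"
  shows "continuous_on S (\<lambda>x. det (A x))"
  unfolding det_def
  by (intro continuous_on_sum continuous_on_mult continuous_on_const continuous_on_prod
      continuous_on_component assms)

text \<open>The segment from the identity to \<open>G\<close> consists of positive definite, hence
  invertible, matrices, so the determinant cannot leave the sign it has at the identity.\<close>

lemma posdef_det_pos: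
  fixes G :: "real^'n::finite^'n"
  assumes "posdef G"
  shows "0 < det G"
proof (rule ccontr)
  assume "\<not> 0 < det G"
  define A where "A t = (1 - t) *\<^sub>R mat 1 + t *\<^sub>R G" for t :: real
  have cont: "continuous_on {0..1} (\<lambda>t. det (A t))"
    unfolding A_def by (intro continuous_on_det continuous_intros)
  have "posdef (A t)" if "t \<in> {0..1}" for t
    unfolding posdef_def
  proof (intro conjI allI impI)
    have "transpose G = G" using assms by (simp add: posdef_def)
    moreover have "transpose G $ i $ j = G $ j $ i" for i j by (simp add: transpose_def)
    ultimately have "G $ i $ j = G $ j $ i" for i j by simp
    then show "transpose (A t) = A t"
      by (simp add: A_def transpose_def vec_eq_iff mat_def)
    fix v :: "real^'n" assume v: "v \<noteq> 0"
    have "v \<bullet> (A t *v v) = (1 - t) * (v \<bullet> v) + t * (v \<bullet> (G *v v))"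
      by (simp add: A_def matrix_vector_mult_add_rdistrib scaleR_matrix_vector_assoc[symmetric] inner_add_right)
    moreover have "v \<bullet> v > 0" "v \<bullet> (G *v v) > 0" using v assms by (auto simp: posdef_def)
    ultimately show "0 < v \<bullet> (A t *v v)" using that
      by (cases "t = 0") (auto intro!: add_nonneg_pos)
  qed
  then have nz: "det (A t) \<noteq> 0" if "t \<in> {0..1}" for t
    using posdef_invertible invertible_det_nz that by blast
  have "det (A 1) \<le> 0" "0 \<le> det (A 0)" using \<open>\<not> 0 < det G\<close> by (auto simp: A_def)
  then obtain t where "0 \<le> t" "t \<le> 1" "det (A t) = 0"
    using IVT2'[of "\<lambda>t. det (A t)" 1 0 0] cont by auto
  then show False using nz[of t] by auto
qed

text \<open>Cramer's rule writes the solution of \<open>G *v v = w\<close> as quotients of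
  determinants, which are visibly continuous in the entries.\<close>

lemma continuous_on_conorm:
  fixes G :: "'a::topological_space \<Rightarrow> real^'n::finite^'n"
  assumes "continuous_on S G" "continuous_on S w" "\<And>x. x \<in> S \<Longrightarrow> posdef (G x)"
  shows "continuous_on S (\<lambda>x. conorm (G x) (w x))"
proof -
  have det: "det (G x) \<noteq> 0" if "x \<in> S" for x
    using assms(3)[OF that] posdef_det_pos by (metis less_irrefl)
  define sol where "sol x = (\<chi> k. det (\<chi> i j. if j = k then w x $ i else G x $ i $ j) / det (G x))" for x
  have sol: "sol x = matrix_inv (G x) *v w x" if "x \<in> S" for x
    using iffD1[OF cramer[OF det[OF that]] posdef_inv_solves(1)[OF assms(3)[OF that], of "w x"]]
    unfolding sol_def by simp
  have "continuous_on S (\<lambda>x. if j = k then w x $ i else G x $ i $ j)" for i j k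
    by (cases "j = k") (auto intro!: continuous_on_component assms)
  then have cont: "continuous_on S sol"
    unfolding sol_def
    by (intro continuous_on_vec_lambda continuous_on_divide continuous_on_det assms(1)) (auto simp: det)
  have "continuous_on S (\<lambda>x. matrix_inv (G x) *v w x)"
    by (rule continuous_on_eq[OF cont sol])
  then show ?thesis unfolding conorm_def by (intro continuous_intros assms)
qed

section \<open>Change of variables for nonnegative functions\<close>

lemma nonneg_absolutely_integrable_iff:
  fixes f :: "'a::euclidean_space \<Rightarrow> real"
  assumes [measurable]: "f \<in> borel_measurable borel" "S \<in> sets borel" and nn: "\<And>x. 0 \<le> f x"
  shows "f absolutely_integrable_on S \<longleftrightarrow> (\<integral>\<^sup>+x. indicator S x * ennreal (f x) \<partial>lborel) < \<infinity>"
    and "f absolutely_integrable_on S \<Longrightarrow> (\<integral>\<^sup>+x. indicator S x * ennreal (f x) \<partial>lborel) = ennreal (integral S f)"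
proof -
  have eq: "indicator S x * ennreal (f x) = ennreal (indicator S x * f x)" for x
    by (simp add: indicator_def)
  show fin: "(\<integral>\<^sup>+x. indicator S x * ennreal (f x) \<partial>lborel) = ennreal (integral S f)"
    if "f absolutely_integrable_on S"
    unfolding eq
    by (rule nn_integral_has_integral_lebesgue)
       (use that nn in \<open>auto simp: set_lebesgue_integral_eq_integral(1) intro!: integrable_integral\<close>)
  show "f absolutely_integrable_on S \<longleftrightarrow> (\<integral>\<^sup>+x. indicator S x * ennreal (f x) \<partial>lborel) < \<infinity>"
  proof
    assume "(\<integral>\<^sup>+x. indicator S x * ennreal (f x) \<partial>lborel) < \<infinity>"
    then have "integrable lborel (\<lambda>x. indicator S x * f x)"
      by (intro integrableI_nonneg) (use nn in \<open>auto simp: eq\<close>)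
    then have "set_integrable lborel S f" by (simp add: set_integrable_def)
    then have "f integrable_on S" by (rule set_borel_integral_eq_integral(1))
    then show "f absolutely_integrable_on S" using nn by (simp add: absolutely_integrable_on_iff_nonneg)
  qed (use fin in auto)
qed

text \<open>\<open>has_absolute_integral_change_of_variables\<close> treats integrable functions;
  for nonnegative ones both sides are integrable together, so the integrals are equal reals or both
  infinite. \<open>h\<close> is a Borel function agreeing with the Jacobian expression on
  \<open>S\<close>, as that expression may misbehave elsewhere. The index sort
  \<open>wellorder\<close> comes from that theorem.\<close>

lemma nn_integral_change_of_variables:
  fixes T :: "real^'n::{finite,wellorder} \<Rightarrow> real^'n::{finite,wellorder}" and f :: "real^'n::{finite,wellorder} \<Rightarrow> real"
  assumes S: "S \<in> sets borel" and TS: "T ` S \<in> sets borel"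
    and der: "\<And>x. x \<in> S \<Longrightarrow> (T has_derivative T' x) (at x)" and inj: "inj_on T S"
    and f: "f \<in> borel_measurable borel" "\<And>x. 0 \<le> f x"
    and h: "h \<in> borel_measurable borel" "\<And>x. 0 \<le> h x" "\<And>x. x \<in> S \<Longrightarrow> h x = \<bar>det (matrix (T' x))\<bar> * f (T x)"
  shows "(\<integral>\<^sup>+y. indicator (T ` S) y * ennreal (f y) \<partial>lborel) = (\<integral>\<^sup>+x. indicator S x * ennreal (h x) \<partial>lborel)"
proof -
  have "(\<lambda>x. \<bar>det (matrix (T' x))\<bar> *\<^sub>R vec (f (T x)) :: real ^ 1) absolutely_integrable_on S \<and>
           integral S (\<lambda>x. \<bar>det (matrix (T' x))\<bar> *\<^sub>R vec (f (T x))) = (vec b :: real ^ 1)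
         \<longleftrightarrow> (\<lambda>x. vec (f x) :: real ^ 1) absolutely_integrable_on (T ` S) \<and>
           integral (T ` S) (\<lambda>x. vec (f x)) = (vec b :: real ^ 1)" for b
    by (rule has_absolute_integral_change_of_variables)
       (use S der inj in \<open>auto intro: has_derivative_at_withinI\<close>)
  then have *: "(\<lambda>x. \<bar>det (matrix (T' x))\<bar> * f (T x)) absolutely_integrable_on S \<and>
           integral S (\<lambda>x. \<bar>det (matrix (T' x))\<bar> * f (T x)) = b
         \<longleftrightarrow> f absolutely_integrable_on (T ` S) \<and> integral (T ` S) f = b" for b
    by (simp add: absolutely_integrable_on_1_iff integral_on_1_eq)
  have "h absolutely_integrable_on S \<longleftrightarrow> (\<lambda>x. \<bar>det (matrix (T' x))\<bar> * f (T x)) absolutely_integrable_on S"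
    by (rule set_integrable_cong) (auto simp: h)
  moreover have "integral S h = integral S (\<lambda>x. \<bar>det (matrix (T' x))\<bar> * f (T x))"
    by (rule Henstock_Kurzweil_Integration.integral_cong) (simp add: h)
  ultimately have iff: "h absolutely_integrable_on S \<and> integral S h = b
         \<longleftrightarrow> f absolutely_integrable_on (T ` S) \<and> integral (T ` S) f = b" for b
    using * by simp
  note 1 = nonneg_absolutely_integrable_iff[OF f(1) TS f(2)]
  note 2 = nonneg_absolutely_integrable_iff[OF h(1) S h(2)]
  show ?thesis
  proof (cases "h absolutely_integrable_on S")
    case True
    then show ?thesis using iff[of "integral S h"] 1(2) 2(2) by simp
  next
    case False
    then have "\<not> f absolutely_integrable_on (T ` S)" using iff by blast
    then show ?thesis using 1(1) 2(1) False by (simp add: less_top[symmetric])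
  qed
qed

section \<open>Charts and the Riemannian volume\<close>

abbreviation cimg :: "('m, 'n::finite) chart \<Rightarrow> (real^'n) set" where
  "cimg c \<equiv> cmap c ` cdom c"

locale riemannian =
  fixes A :: "('m::{t2_space,second_countable_topology}, 'n::{finite,wellorder}) chart set"
    and g :: "('m, 'n) metric"
  assumes riemannian_manifold: "riemannian_manifold A g"
begin

lemma chart_props:
  assumes "c \<in> A"
  shows "open (cdom c)" "open (cimg c)" "continuous_on (cdom c) (cmap c)" "continuous_on (cimg c) (cinv c)"
    and "\<And>x. x \<in> cdom c \<Longrightarrow> cinv c (cmap c x) = x" "\<And>y. y \<in> cimg c \<Longrightarrow> cmap c (cinv c y) = y"
    and "\<And>y. y \<in> cimg c \<Longrightarrow> cinv c y \<in> cdom c" "inj_on (cmap c) (cdom c)"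
proof -
  have *: "is_chart c"
    using assms riemannian_manifold by (auto simp: riemannian_manifold_def smooth_atlas_def)
  then have h: "homeomorphism (cdom c) (cimg c) (cmap c) (cinv c)" by (simp add: is_chart_def)
  show "open (cdom c)" "open (cimg c)" using * by (auto simp: is_chart_def)
  show "continuous_on (cdom c) (cmap c)" "continuous_on (cimg c) (cinv c)"
    using h by (auto simp: homeomorphism_def)
  show "\<And>x. x \<in> cdom c \<Longrightarrow> cinv c (cmap c x) = x" "\<And>y. y \<in> cimg c \<Longrightarrow> cmap c (cinv c y) = y"
    using h unfolding homeomorphism_def by blast+
  then show "inj_on (cmap c) (cdom c)" by (metis inj_onI)
  show "\<And>y. y \<in> cimg c \<Longrightarrow> cinv c y \<in> cdom c" by (rule inv_into_into)
qed

lemma charts_cover: obtains c where "c \<in> A" "x \<in> cdom c"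
  using riemannian_manifold unfolding riemannian_manifold_def smooth_atlas_def by blast

lemma chart_image_iff:
  assumes "c \<in> A" "B \<subseteq> cdom c" "y \<in> cimg c"
  shows "y \<in> cmap c ` B \<longleftrightarrow> cinv c y \<in> B"
  using chart_props(5-7)[OF assms(1)] assms(2,3) by (auto simp: subset_iff image_iff)

lemma open_chart_image:
  assumes "c \<in> A" "open U" "U \<subseteq> cdom c"
  shows "open (cmap c ` U)"
proof -
  have "cmap c ` U = cimg c \<inter> cinv c -` U"
    using assms(3) chart_image_iff[OF assms(1,3)] by blast
  then show ?thesis
    using continuous_open_preimage[OF chart_props(4)[OF assms(1)] chart_props(2)[OF assms(1)] assms(2)] by simp
qed

lemma open_chart_preimage:
  assumes "c \<in> A" "open V"  "V \<subseteq> cimg c"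
  shows "open (cinv c ` V)"
proof -
  have "cinv c ` V = cdom c \<inter> cmap c -` V"
    using assms(3) chart_props(5-7)[OF assms(1)] by (auto simp: subset_iff image_iff) metis
  then show ?thesis
    using continuous_open_preimage[OF chart_props(3)[OF assms(1)] chart_props(1)[OF assms(1)] assms(2)] by simp
qed

lemma transition_Ck:
  assumes "c \<in> A" "d \<in> A"
  shows "Ck_on k (cmap c ` (cdom c \<inter> cdom d)) (\<lambda>y. cmap d (cinv c y))"
proof -
  have "smooth_atlas A" using riemannian_manifold by (simp add: riemannian_manifold_def)
  then have "Ck_on k (cmap c ` (cdom c \<inter> cdom d)) (cmap d \<circ> cinv c)"
    using assms unfolding smooth_atlas_def smooth_on_def by blast
  then show ?thesis by (simp add: o_def)
qed

lemma open_overlap: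
  assumes "c \<in> A" "d \<in> A"
  shows "open (cmap c ` (cdom c \<inter> cdom d))"
  by (rule open_chart_image[OF assms(1) open_Int]) (use assms in \<open>auto simp: chart_props(1) simp del: split_paired_all\<close>)

definition jac :: "('m, 'n) chart \<Rightarrow> ('m, 'n) chart \<Rightarrow> (real, 'n) vec \<Rightarrow> ((real, 'n) vec, 'n) vec" where
  "jac c d y = matrix (frechet_derivative (cmap d \<circ> cinv c) (at y))"

lemma transition_derivative:
  assumes "c \<in> A" "d \<in> A" "y \<in> cmap c ` (cdom c \<inter> cdom d)"
  shows "((\<lambda>y. cmap d (cinv c y)) has_derivative (\<lambda>h. jac c d y *v h)) (at y)"
proof -
  have 1: "((\<lambda>y. cmap d (cinv c y)) has_derivative frechet_derivative (cmap d \<circ> cinv c) (at y)) (at y)"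
    using Ck_on_SucD[OF transition_Ck[OF assms(1,2), of "Suc 0"] assms(3)] by (simp add: o_def)
  then show ?thesis unfolding jac_def using has_derivative_linear[OF 1]
    by (simp add: matrix_works)
qed

lemma metric_props:
  assumes "c \<in> A"
  shows "x \<in> cdom c \<Longrightarrow> posdef (g c x)" "continuous_on (cimg c) (\<lambda>y. g c (cinv c y))"
proof -
  have m: "riemannian_metric A g" using riemannian_manifold by (simp add: riemannian_manifold_def)
  show "x \<in> cdom c \<Longrightarrow> posdef (g c x)"
    using m assms unfolding riemannian_metric_def posdef_def by blast
  have "smooth_on (cimg c) (g c \<circ> cinv c)" using m assms unfolding riemannian_metric_def by blast
  then have "Ck_on 0 (cimg c) (g c \<circ> cinv c)" unfolding smooth_on_def by blast
  then show "continuous_on (cimg c) (\<lambda>y. g c (cinv c y))" by (simp add: o_def)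
qed

lemma metric_transform:
  assumes "c \<in> A" "d \<in> A" "x \<in> cdom c" "x \<in> cdom d"
  shows "g c x = transpose (jac c d (cmap c x)) ** g d x ** jac c d (cmap c x)"
proof -
  have m: "riemannian_metric A g" using riemannian_manifold by (simp add: riemannian_manifold_def)
  then show ?thesis using assms unfolding riemannian_metric_def jac_def Let_def by blast
qed

section \<open>Volume densities and chart measures\<close>

definition rho :: "('m, 'n) chart \<Rightarrow> (real, 'n) vec \<Rightarrow> real" where
  "rho c y = sqrt (det (g c (cinv c y)))"

lemma rho_pos: "c \<in> A \<Longrightarrow> y \<in> cimg c \<Longrightarrow> 0 < rho c y"
  using posdef_det_pos[OF metric_props(1)] chart_props(7) by (simp add: rho_def)

lemma rho_continuous: "c \<in> A \<Longrightarrow> continuous_on (cimg c) (rho c)"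
  unfolding rho_def by (intro continuous_intros continuous_on_det metric_props(2))

lemma rho_transform:
  assumes "c \<in> A" "d \<in> A" "y \<in> cmap c ` (cdom c \<inter> cdom d)"
  shows "rho c y = \<bar>det (jac c d y)\<bar> * rho d (cmap d (cinv c y))"
proof -
  obtain x where x: "x \<in> cdom c" "x \<in> cdom d" "y = cmap c x" using assms(3) by auto
  have "det (g c x) = (det (jac c d y))\<^sup>2 * det (g d x)"
    unfolding metric_transform[OF assms(1,2) x(1,2)] x(3)
    by (simp add: det_mul det_transpose power2_eq_square)
  then show ?thesis
    using x chart_props(5)[OF assms(1) x(1)] chart_props(5)[OF assms(2) x(2)]
    by (simp add: rho_def real_sqrt_mult)
qed

text \<open>A total Borel measurable version of \<^term>\<open>cinv c\<close>, whose values off the chart image are uncontrolled.\<close>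

definition einv :: "('m, 'n) chart \<Rightarrow> (real, 'n) vec \<Rightarrow> 'm" where
  "einv c y = (if y \<in> cimg c then cinv c y else undefined)"

lemma einv_measurable: "c \<in> A \<Longrightarrow> einv c \<in> borel_measurable borel"
  unfolding einv_def[abs_def]
  by (subst measurable_restrict_space_iff[symmetric])
     (auto simp: chart_props(2) intro!: borel_measurable_continuous_on_restrict chart_props(4))

text \<open>Vanishes off the chart image, where \<open>einv\<close> has junk values, so that these
  contribute nothing to \<open>chart_vol\<close>.\<close>

definition drho :: "('m, 'n) chart \<Rightarrow> (real, 'n) vec \<Rightarrow> real" where
  "drho c y = indicator (cimg c) y * rho c y"

lemma drho_measurable: "c \<in> A \<Longrightarrow> drho c \<in> borel_measurable borel"
  using borel_measurable_continuous_on_indicator[OF _ rho_continuous, of c] chart_props(2)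
  by (simp add: drho_def[abs_def])

lemma drho_nonneg: "c \<in> A \<Longrightarrow> 0 \<le> drho c y"
  using rho_pos[of c y] by (auto simp: drho_def indicator_def less_imp_le)

definition chart_vol :: "('m, 'n) chart \<Rightarrow> 'm measure" where
  "chart_vol c = distr (density lborel (\<lambda>y. ennreal (drho c y))) borel (einv c)"

lemma nn_integral_chart_vol:
  assumes "c \<in> A" "f \<in> borel_measurable borel"
  shows "(\<integral>\<^sup>+x. f x \<partial>chart_vol c) = (\<integral>\<^sup>+y. ennreal (drho c y) * f (einv c y) \<partial>lborel)"
proof -
  note [measurable] = einv_measurable[OF assms(1)] drho_measurable[OF assms(1)] assms(2)
  show ?thesis unfolding chart_vol_def
    by (subst nn_integral_distr, measurable) (subst nn_integral_density, auto)
qed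

lemma chart_image_measurable:
  assumes "c \<in> A" "B \<in> sets borel" "B \<subseteq> cdom c"
  shows "cmap c ` B \<in> sets borel"
proof -
  have "cmap c ` B = einv c -` B \<inter> cimg c"
    using assms(3) chart_image_iff[OF assms(1,3)] by (intro set_eqI) (auto simp only: einv_def IntI Int_iff vimage_eq image_eqI split: if_splits)
  also have "\<dots> = (einv c -` B \<inter> space borel) \<inter> cimg c" by simp
  also have "\<dots> \<in> sets borel"
    by (intro sets.Int measurable_sets[OF einv_measurable[OF assms(1)] assms(2)]) (use chart_props(2)[OF assms(1)] in auto)
  finally show ?thesis .
qed

lemma emeasure_chart_vol:
  assumes "c \<in> A" "B \<in> sets borel" "B \<subseteq> cdom c"
  shows "emeasure (chart_vol c) B = (\<integral>\<^sup>+y. indicator (cmap c ` B) y * ennreal (drho c y) \<partial>lborel)"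
proof -
  have "emeasure (chart_vol c) B = (\<integral>\<^sup>+x. indicator B x \<partial>chart_vol c)"
    using assms(2) by (simp add: chart_vol_def)
  also have "\<dots> = (\<integral>\<^sup>+y. ennreal (drho c y) * indicator B (einv c y) \<partial>lborel)"
    by (rule nn_integral_chart_vol[OF assms(1)]) (use assms(2) in simp)
  also have "\<dots> = (\<integral>\<^sup>+y. indicator (cmap c ` B) y * ennreal (drho c y) \<partial>lborel)"
    using chart_image_iff[OF assms(1,3)]
    by (intro nn_integral_cong) (auto simp: drho_def einv_def indicator_def)
  finally show ?thesis .
qed

text \<open>The coordinate change turns one chart integral into the other, because by
  \<open>rho_transform\<close> the density picks up exactly the absolute Jacobian
  determinant.\<close>

lemma chart_vol_compatible:
  assumes "c \<in> A" "d \<in> A" "B \<in> sets borel" "B \<subseteq> cdom c" "B \<subseteq> cdom d"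
  shows "emeasure (chart_vol c) B = emeasure (chart_vol d) B"
proof -
  let ?T = "\<lambda>y. cmap d (cinv c y)" and ?S = "cmap c ` B"
  have S: "?S \<in> sets borel" by (rule chart_image_measurable) fact+
  have sub: "?S \<subseteq> cmap c ` (cdom c \<inter> cdom d)" using assms(4,5) by auto
  have TS: "?T ` ?S = cmap d ` B"
    using chart_props(5)[OF assms(1)] assms(4) by (force simp: image_image subset_iff)
  have TSm: "?T ` ?S \<in> sets borel" unfolding TS by (rule chart_image_measurable) fact+
  have inj: "inj_on ?T ?S"
  proof (rule inj_onI)
    fix y z assume "y \<in> ?S" "z \<in> ?S" and e: "?T y = ?T z"
    then obtain s t where st: "s \<in> B" "t \<in> B" "y = cmap c s" "z = cmap c t" by auto
    then have "cmap d s = cmap d t" using e chart_props(5)[OF assms(1)] assms(4) by (auto simp: subset_iff)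
    then have "s = t" using st chart_props(8)[OF assms(2)] assms(5) by (meson inj_onD subsetD)
    then show "y = z" using st by simp
  qed
  have "(\<integral>\<^sup>+y. indicator (?T ` ?S) y * ennreal (drho d y) \<partial>lborel) = (\<integral>\<^sup>+x. indicator ?S x * ennreal (drho c x) \<partial>lborel)"
  proof (rule nn_integral_change_of_variables[where T' = "\<lambda>y h. jac c d y *v h", OF S TSm _ inj])
    show "(?T has_derivative (\<lambda>h. jac c d y *v h)) (at y)" if "y \<in> ?S" for y
      by (rule transition_derivative) (use assms that sub in auto)
    show "drho c y = \<bar>det (matrix (\<lambda>h. jac c d y *v h))\<bar> * drho d (?T y)" if y: "y \<in> ?S" for y
    proof -
      have "y \<in> cimg c" "?T y \<in> cimg d" using y assms(4,5) chart_props(5)[OF assms(1)] by (auto simp: subset_iff)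
      then show ?thesis using rho_transform[of c d y] assms y sub
        by (auto simp: drho_def matrix_of_matrix_vector_mul)
    qed
  qed (use assms drho_measurable drho_nonneg in auto)
  then show ?thesis
    unfolding TS emeasure_chart_vol[OF assms(1,3,4)] emeasure_chart_vol[OF assms(2,3,5)] by simp
qed

text \<open>Second countability yields countably many chart domains that cover the space; making
  them disjoint cuts any measure into pieces each seen by one chart.\<close>

lemma countable_disjoint_cover:
  obtains e :: "nat \<Rightarrow> ('m, 'n) chart" and D :: "nat \<Rightarrow> 'm set"
  where "\<And>i. e i \<in> A" "\<And>i. D i \<in> sets borel" "\<And>i. D i \<subseteq> cdom (e i)" "disjoint_family D" "(\<Union>i. D i) = UNIV"
proof -
  have "openin (top_of_set UNIV) S" if "S \<in> cdom ` A" for S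
    using that chart_props(1) by (metis imageE open_openin subtopology_UNIV)
  from Lindelof_openin[OF this]
  obtain \<F> where \<F>: "\<F> \<subseteq> cdom ` A" "countable \<F>" "\<Union>\<F> = \<Union>(cdom ` A)"
    by blast
  have U: "\<Union>\<F> = UNIV" using \<F>(3) charts_cover by (metis UNIV_eq_I UN_I)
  then have ne: "\<F> \<noteq> {}" by auto
  have "\<exists>c\<in>A. cdom c = from_nat_into \<F> i" for i
    using from_nat_into[OF ne, of i] \<F>(1) by (auto simp: subset_iff image_iff) metis
  then obtain e where e: "\<And>i. e i \<in> A" "\<And>i. cdom (e i) = from_nat_into \<F> i" by metis
  have UN: "(\<Union>i. cdom (e i)) = UNIV"
    using U range_from_nat_into[OF ne \<F>(2)] by (simp add: e(2))
  show thesis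
  proof (rule that[of e "disjointed (\<lambda>i. cdom (e i))"])
    show "disjointed (\<lambda>i. cdom (e i)) i \<in> sets borel" for i
    proof -
      have "range (\<lambda>i. cdom (e i)) \<subseteq> sets borel" using chart_props(1)[OF e(1)] by auto
      from sets.range_disjointed_sets[OF this] show ?thesis by blast
    qed
    show "disjointed (\<lambda>i. cdom (e i)) i \<subseteq> cdom (e i)" for i
      by (rule disjointed_subset)
    show "(\<Union>i. disjointed (\<lambda>i. cdom (e i)) i) = UNIV"
      unfolding UN_disjointed_eq by (rule UN)
  qed (rule e(1) disjoint_family_disjointed)+
qed

text \<open>The description under the definite choice in \<open>riem_vol\<close>, with the chart
  integral packed into \<open>chart_vol\<close>. Existence and uniqueness below give that choice a
  meaning.\<close>

definition is_volume :: "'m measure \<Rightarrow> bool" where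
  "is_volume \<mu> \<longleftrightarrow> sets \<mu> = sets borel \<and>
    (\<forall>c\<in>A. \<forall>B\<in>sets borel. B \<subseteq> cdom c \<longrightarrow> emeasure \<mu> B = emeasure (chart_vol c) B)"

lemma is_volume_unique:
  assumes "is_volume \<mu>" "is_volume \<nu>"
  shows "\<mu> = \<nu>"
proof -
  obtain e D where D: "\<And>i::nat. e i \<in> A" "\<And>i. D i \<in> sets borel" "\<And>i. D i \<subseteq> cdom (e i)"
    "disjoint_family D" "(\<Union>i. D i) = UNIV"
    by (rule countable_disjoint_cover, rule that)
  have *: "emeasure \<mu> B = (\<Sum>i. emeasure (chart_vol (e i)) (B \<inter> D i))" if "is_volume \<mu>" "B \<in> sets borel" for \<mu> B
  proof -
    have "emeasure \<mu> B = emeasure \<mu> (\<Union>i. B \<inter> D i)" using D(5) by (simp add: Int_UN_distrib[symmetric])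
    also have "\<dots> = (\<Sum>i. emeasure \<mu> (B \<inter> D i))"
      by (rule suminf_emeasure[symmetric])
         (use that D in \<open>auto simp: is_volume_def intro!: disjoint_family_subset[OF D(4)]\<close>)
    also have "\<dots> = (\<Sum>i. emeasure (chart_vol (e i)) (B \<inter> D i))"
      using that D(1-3) unfolding is_volume_def by (intro suminf_cong) (auto simp: subset_iff)
    finally show ?thesis .
  qed
  show ?thesis
  proof (rule measure_eqI)
    show "sets \<mu> = sets \<nu>" using assms by (simp add: is_volume_def)
    fix B assume "B \<in> sets \<mu>"
    then have "B \<in> sets borel" using assms by (simp add: is_volume_def)
    then show "emeasure \<mu> B = emeasure \<nu> B" using *[OF assms(1)] *[OF assms(2)] by simp
  qed
qed

text \<open>Sum the chart measures over the disjoint pieces. The value on a set inside one chart is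
  right because \<open>chart_vol_compatible\<close> lets that chart replace those attached to the
  pieces.\<close>

lemma is_volume_exists: "\<exists>\<mu>. is_volume \<mu>"
proof -
  obtain e D where D: "\<And>i::nat. e i \<in> A" "\<And>i. D i \<in> sets borel" "\<And>i. D i \<subseteq> cdom (e i)"
    "disjoint_family D" "(\<Union>i. D i) = UNIV"
    by (rule countable_disjoint_cover, rule that)
  define m where "m B = (\<Sum>i. emeasure (chart_vol (e i)) (B \<inter> D i))" for B
  define \<mu> where "\<mu> = measure_of UNIV (sets borel) m"
  have sets: "sets (chart_vol c) = sets borel" for c by (simp add: chart_vol_def)
  have sets\<mu>: "sets \<mu> = sets borel"
    unfolding \<mu>_def using sets.sigma_sets_eq[of "borel :: 'm measure"] by simp
  have em: "emeasure \<mu> B = m B" if "B \<in> sets borel" for B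
    unfolding \<mu>_def
  proof (rule emeasure_measure_of_sigma)
    show "sigma_algebra UNIV (sets (borel :: 'm measure))"
      using sets.sigma_algebra_axioms[of "borel :: 'm measure"] by simp
    show "positive (sets borel) m" by (simp add: positive_def m_def)
    show "countably_additive (sets borel) m"
    proof (rule countably_additiveI)
      fix F :: "nat \<Rightarrow> 'm set" assume F: "range F \<subseteq> sets borel" "disjoint_family F"
      \<comment> \<open>The double series is exchanged by reading the sum over \<open>j\<close> as
        an integral against counting measure.\<close>
      have "(\<Sum>j. m (F j)) = (\<integral>\<^sup>+j. (\<Sum>i. emeasure (chart_vol (e i)) (F j \<inter> D i)) \<partial>count_space UNIV)"
        by (simp add: m_def nn_integral_count_space_nat)
      also have "\<dots> = (\<Sum>i. \<integral>\<^sup>+j. emeasure (chart_vol (e i)) (F j \<inter> D i) \<partial>count_space UNIV)"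
        by (rule nn_integral_suminf) simp
      also have "\<dots> = (\<Sum>i. emeasure (chart_vol (e i)) ((\<Union>j. F j) \<inter> D i))"
      proof (rule suminf_cong)
        fix i
        have "(\<Sum>j. emeasure (chart_vol (e i)) (F j \<inter> D i)) = emeasure (chart_vol (e i)) (\<Union>j. F j \<inter> D i)"
          by (rule suminf_emeasure) (use F D in \<open>auto simp: sets intro!: disjoint_family_subset[OF F(2)]\<close>)
        then show "(\<integral>\<^sup>+j. emeasure (chart_vol (e i)) (F j \<inter> D i) \<partial>count_space UNIV) = emeasure (chart_vol (e i)) ((\<Union>j. F j) \<inter> D i)"
          by (simp add: nn_integral_count_space_nat)
      qed
      finally show "(\<Sum>j. m (F j)) = m (\<Union>j. F j)" by (simp add: m_def)
    qed
  qed (use that in simp)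
  have "emeasure \<mu> B = emeasure (chart_vol c) B" if "c \<in> A" "B \<in> sets borel" "B \<subseteq> cdom c" for c B
  proof -
    have "emeasure \<mu> B = (\<Sum>i. emeasure (chart_vol (e i)) (B \<inter> D i))" using em that by (simp add: m_def)
    also have "\<dots> = (\<Sum>i. emeasure (chart_vol c) (B \<inter> D i))"
    proof (intro suminf_cong chart_vol_compatible)
      show "B \<inter> D i \<subseteq> cdom (e i)" for i using D(3)[of i] by blast
    qed (use that D in auto)
    also have "\<dots> = emeasure (chart_vol c) (\<Union>i. B \<inter> D i)"
      by (rule suminf_emeasure) (use that D in \<open>auto simp: sets intro!: disjoint_family_subset[OF D(4)]\<close>)
    also have "(\<Union>i. B \<inter> D i) = B" using D(5) by (simp add: Int_UN_distrib[symmetric])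
    finally show ?thesis .
  qed
  then show ?thesis using sets\<mu> unfolding is_volume_def by blast
qed

abbreviation vol :: "'m measure" where
  "vol \<equiv> riem_vol A g"

lemma is_volume_vol: "is_volume vol"
proof -
  have "emeasure (chart_vol c) B = (\<integral>\<^sup>+y \<in> cmap c ` B. ennreal (sqrt (det (g c (cinv c y)))) \<partial>lborel)"
    if "c \<in> A" "B \<in> sets borel" "B \<subseteq> cdom c" for c B
    unfolding emeasure_chart_vol[OF that]
    by (intro nn_integral_cong) (use that(3) in \<open>auto simp: indicator_def drho_def rho_def\<close>)
  then have "vol = (THE \<mu>. is_volume \<mu>)"
    unfolding riem_vol_def is_volume_def by (intro arg_cong[where f = The] ext) auto
  then show ?thesis using theI'[of is_volume] is_volume_exists is_volume_unique by metis
qed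

lemma sets_vol [simp, measurable_cong]: "sets vol = sets borel"
  using is_volume_vol by (simp add: is_volume_def)

lemma space_vol [simp]: "space vol = UNIV"
  using sets_eq_imp_space_eq[OF sets_vol] by simp

text \<open>On the chart domain \<open>vol\<close> and \<open>chart_vol c\<close> are the same
  measure, which upgrades the defining property of the volume from sets to functions.\<close>

lemma nn_integral_vol_chart:
  assumes c: "c \<in> A" and f: "f \<in> borel_measurable borel"
  shows "(\<integral>\<^sup>+x. indicator (cdom c) x * f x \<partial>vol) =
    (\<integral>\<^sup>+y. indicator (cimg c) y * (ennreal (rho c y) * f (cinv c y)) \<partial>lborel)"
proof -
  have cd: "cdom c \<in> sets borel" using chart_props(1)[OF c] by simp
  note [measurable] = einv_measurable[OF c] drho_measurable[OF c] f cd
  have "density vol (indicator (cdom c)) = chart_vol c"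
  proof (rule measure_eqI)
    show "sets (density vol (indicator (cdom c))) = sets (chart_vol c)" by (simp add: chart_vol_def)
    fix B assume "B \<in> sets (density vol (indicator (cdom c)))"
    then have B: "B \<in> sets borel" by simp
    have "emeasure (density vol (indicator (cdom c))) B = emeasure vol (cdom c \<inter> B)"
      using B cd by (subst emeasure_density) (auto simp: indicator_inter_arith[symmetric] nn_integral_indicator)
    also have "\<dots> = emeasure (chart_vol c) (cdom c \<inter> B)"
      using is_volume_vol c B cd by (auto simp: is_volume_def)
    also have "\<dots> = emeasure (chart_vol c) B"
    proof -
      have "emeasure (chart_vol c) (cdom c \<inter> B) = (\<integral>\<^sup>+x. indicator (cdom c \<inter> B) x \<partial>chart_vol c)"
        using B cd by (simp add: chart_vol_def)
      also have "\<dots> = (\<integral>\<^sup>+x. indicator B x \<partial>chart_vol c)"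
        using B chart_props(7)[OF c]
        by (subst (1 2) nn_integral_chart_vol[OF c])
           (auto intro!: nn_integral_cong simp: einv_def drho_def indicator_def)
      finally show ?thesis using B by (simp add: chart_vol_def)
    qed
    finally show "emeasure (density vol (indicator (cdom c))) B = emeasure (chart_vol c) B" .
  qed
  then have "(\<integral>\<^sup>+x. indicator (cdom c) x * f x \<partial>vol) = (\<integral>\<^sup>+x. f x \<partial>chart_vol c)"
    using f cd by (metis nn_integral_density borel_measurable_indicator measurable_cong_sets sets_vol)
  also have "\<dots> = (\<integral>\<^sup>+y. ennreal (drho c y) * f (einv c y) \<partial>lborel)"
    by (rule nn_integral_chart_vol[OF c f])
  also have "\<dots> = (\<integral>\<^sup>+y. indicator (cimg c) y * (ennreal (rho c y) * f (cinv c y)) \<partial>lborel)"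
    by (intro nn_integral_cong) (auto simp: einv_def drho_def indicator_def)
  finally show ?thesis .
qed

end

lemma linear_eq_inner_axis:
  fixes f :: "real^'n::finite \<Rightarrow> real"
  assumes "linear f"
  shows "f h = (\<chi> j. f (axis j 1)) \<bullet> h"
proof -
  have "f h = f (\<Sum>j\<in>UNIV. (h $ j) *\<^sub>R axis j 1)"
    using basis_expansion[of h] by (simp add: scalar_mult_eq_scaleR)
  also have "\<dots> = (\<Sum>j\<in>UNIV. h $ j * f (axis j 1))"
    by (simp add: linear_sum[OF assms] linear_cmul[OF assms])
  finally show ?thesis by (simp add: inner_vec_def mult.commute)
qed

context riemannian
begin

section \<open>Functions on the manifold\<close>

abbreviation mCk :: "nat \<Rightarrow> ('m \<Rightarrow> real) \<Rightarrow> bool" where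
  "mCk \<equiv> manifold_Ck A"

abbreviation gn :: "('m \<Rightarrow> real) \<Rightarrow> 'm \<Rightarrow> real" where
  "gn \<equiv> grad_norm A g"

lemma mCk_chart: "mCk k u \<Longrightarrow> c \<in> A \<Longrightarrow> Ck_on k (cimg c) (\<lambda>y. u (cinv c y))"
  by (simp add: manifold_Ck_def o_def)

lemma mCkI: "(\<And>c. c \<in> A \<Longrightarrow> Ck_on k (cimg c) (\<lambda>y. u (cinv c y))) \<Longrightarrow> mCk k u"
  by (simp add: manifold_Ck_def o_def)

lemma mCk_const: "mCk k (\<lambda>x. a)"
  by (rule mCkI) (rule Ck_on_const)

lemma mCk_add: "mCk k u \<Longrightarrow> mCk k v \<Longrightarrow> mCk k (\<lambda>x. u x + v x)"
  by (rule mCkI, rule Ck_on_add[OF chart_props(2) mCk_chart mCk_chart])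

lemma mCk_mult: "mCk k u \<Longrightarrow> mCk k v \<Longrightarrow> mCk k (\<lambda>x. u x * v x)"
  by (rule mCkI, rule Ck_on_mult[OF chart_props(2) mCk_chart mCk_chart])

lemma mCk_cmult: "mCk k u \<Longrightarrow> mCk k (\<lambda>x. a * u x)"
  by (rule mCk_mult[OF mCk_const])

lemma mCk_diff: "mCk k u \<Longrightarrow> mCk k v \<Longrightarrow> mCk k (\<lambda>x. u x - v x)"
  using mCk_add[OF _ mCk_cmult[of k v "-1"]] by simp

lemma mCk_compose: "mCk k u \<Longrightarrow> Ck_on k UNIV (h :: real \<Rightarrow> real) \<Longrightarrow> mCk k (\<lambda>x. h (u x))"
  by (rule mCkI, rule Ck_on_compose[OF chart_props(2) open_UNIV subset_UNIV mCk_chart])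

lemma mCk_continuous:
  assumes "mCk k u"
  shows "continuous_on UNIV u"
proof (rule continuous_at_imp_continuous_on, rule ballI)
  fix x
  obtain c where c: "c \<in> A" "x \<in> cdom c" by (rule charts_cover)
  have "continuous_on (cdom c) (\<lambda>x. u (cinv c (cmap c x)))"
    by (rule continuous_on_compose2[OF Ck_on_imp_continuous_on[OF mCk_chart[OF assms c(1)]] chart_props(3)[OF c(1)]]) simp
  then have "continuous_on (cdom c) u"
    by (rule continuous_on_eq) (simp add: chart_props(5)[OF c(1)])
  then show "isCont u x"
    using continuous_on_eq_continuous_at[OF chart_props(1)[OF c(1)]] c(2) by blast
qed

section \<open>Coordinate differentials and the gradient norm\<close>

definition pd :: "('m, 'n) chart \<Rightarrow> ('m \<Rightarrow> real) \<Rightarrow> (real, 'n) vec \<Rightarrow> (real, 'n) vec" where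
  "pd c u y = (\<chi> j. frechet_derivative (u \<circ> cinv c) (at y) (axis j 1))"

lemma pd_has_derivative:
  assumes "mCk (Suc 0) u" "c \<in> A" "y \<in> cimg c"
  shows "((\<lambda>y. u (cinv c y)) has_derivative (\<lambda>h. pd c u y \<bullet> h)) (at y)"
proof -
  have d: "((\<lambda>y. u (cinv c y)) has_derivative frechet_derivative (u \<circ> cinv c) (at y)) (at y)"
    using Ck_on_SucD[OF mCk_chart[OF assms(1,2)] assms(3)] by (simp add: o_def)
  have "frechet_derivative (u \<circ> cinv c) (at y) = (\<lambda>h. pd c u y \<bullet> h)"
    unfolding pd_def by (rule ext) (rule linear_eq_inner_axis[OF has_derivative_linear[OF d]])
  then show ?thesis using d by simp
qed

lemma pd_eqI:
  assumes "((\<lambda>y. u (cinv c y)) has_derivative (\<lambda>h. w \<bullet> h)) (at y)"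
  shows "pd c u y = w"
proof -
  have "frechet_derivative (u \<circ> cinv c) (at y) = (\<lambda>h. w \<bullet> h)"
    using frechet_derivative_at[OF assms] by (simp add: o_def)
  then show ?thesis by (simp add: pd_def inner_axis vec_eq_iff)
qed

lemma pd_continuous:
  assumes "mCk (Suc 0) u" "c \<in> A"
  shows "continuous_on (cimg c) (pd c u)"
  unfolding pd_def
  using mCk_chart[OF assms] by (intro continuous_on_vec_lambda) (simp add: o_def)

text \<open>By the chain rule the coordinate differential transforms with the transposed Jacobian,
  and the metric carries the Jacobian on both sides: the situation of
  \<open>conorm_pullback\<close>.\<close>

lemma chart_independent:
  assumes u: "mCk (Suc 0) u" and c: "c \<in> A" "x \<in> cdom c" and d: "d \<in> A" "x \<in> cdom d"
  shows "conorm (g c x) (pd c u (cmap c x)) = conorm (g d x) (pd d u (cmap d x))"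
proof -
  let ?y = "cmap c x" and ?J = "jac c d (cmap c x)"
  have y: "?y \<in> cmap c ` (cdom c \<inter> cdom d)" using c d by auto
  have Ty: "cmap d (cinv c ?y) = cmap d x" using chart_props(5)[OF c] by simp
  have "((\<lambda>y. u (cinv d y)) has_derivative (\<lambda>h. pd d u (cmap d x) \<bullet> h)) (at (cmap d (cinv c ?y)))"
    unfolding Ty by (rule pd_has_derivative[OF u d(1)]) (use d in auto)
  from has_derivative_compose[OF transition_derivative[OF c(1) d(1) y] this]
  have "((\<lambda>y. u (cinv d (cmap d (cinv c y)))) has_derivative (\<lambda>h. pd d u (cmap d x) \<bullet> (?J *v h))) (at ?y)" .
  then have "((\<lambda>y. u (cinv c y)) has_derivative (\<lambda>h. pd d u (cmap d x) \<bullet> (?J *v h))) (at ?y)"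
    by (rule has_derivative_transform_within_open[OF _ open_overlap[OF c(1) d(1)] y])
       (auto simp: chart_props(5)[OF c(1)] chart_props(5)[OF d(1)])
  moreover have "(\<lambda>h. pd d u (cmap d x) \<bullet> (?J *v h)) = (\<lambda>h. (transpose ?J *v pd d u (cmap d x)) \<bullet> h)"
    by (simp add: dot_lmul_matrix)
  ultimately have "pd c u ?y = transpose ?J *v pd d u (cmap d x)"
    by (intro pd_eqI) simp
  from conorm_pullback[OF metric_props(1)[OF c] metric_props(1)[OF d] metric_transform[OF c(1) d(1) c(2) d(2)] this]
  show ?thesis .
qed

text \<open>Frees \<open>grad_norm\<close> from the chart selected by \<open>SOME\<close> and
  rewrites the length of the gradient as the dual norm of the differential.\<close>

lemma gn_chart:
  assumes "mCk (Suc 0) u" "c \<in> A" "x \<in> cdom c"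
  shows "gn u x = conorm (g c x) (pd c u (cmap c x))"
proof -
  define c0 where "c0 = (SOME c. c \<in> A \<and> x \<in> cdom c)"
  have c0: "c0 \<in> A" "x \<in> cdom c0"
    using someI[of "\<lambda>c. c \<in> A \<and> x \<in> cdom c" c] assms(2,3) by (auto simp: c0_def)
  have "gn u x = conorm (g c0 x) (pd c0 u (cmap c0 x))"
    unfolding grad_norm_def Let_def c0_def[symmetric] conorm_def grad_in_def pd_def[symmetric]
    by (simp add: posdef_inverse_form[OF metric_props(1)[OF c0]])
  then show ?thesis using chart_independent[OF assms(1) c0 assms(2,3)] by simp
qed

lemma gn_nonneg: "mCk (Suc 0) u \<Longrightarrow> 0 \<le> gn u x"
  using charts_cover[of x] gn_chart conorm_nonneg metric_props(1) by metis

lemma gn_continuous: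
  assumes "mCk (Suc 0) u"
  shows "continuous_on UNIV (gn u)"
proof (rule continuous_at_imp_continuous_on, rule ballI)
  fix x
  obtain c where c: "c \<in> A" "x \<in> cdom c" by (rule charts_cover)
  have "continuous_on (cimg c) (\<lambda>y. conorm (g c (cinv c y)) (pd c u y))"
    by (intro continuous_on_conorm metric_props pd_continuous assms c chart_props(7)[OF c(1)])
  then have "continuous_on (cdom c) (\<lambda>x. conorm (g c (cinv c (cmap c x))) (pd c u (cmap c x)))"
    by (rule continuous_on_compose2[OF _ chart_props(3)[OF c(1)]]) simp
  then have "continuous_on (cdom c) (gn u)"
    by (rule continuous_on_eq) (simp add: chart_props(5)[OF c(1)] gn_chart[OF assms c(1)])
  then show "isCont (gn u) x"
    using continuous_on_eq_continuous_at[OF chart_props(1)[OF c(1)]] c(2) by blast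
qed

lemma gn_measurable: "mCk (Suc 0) u \<Longrightarrow> gn u \<in> borel_measurable borel"
  by (rule borel_measurable_continuous_onI) (rule gn_continuous)

lemma mCk_measurable: "mCk k u \<Longrightarrow> u \<in> borel_measurable borel"
  by (rule borel_measurable_continuous_onI) (rule mCk_continuous)

lemma gn_add_le:
  assumes u: "mCk (Suc 0) u" and v: "mCk (Suc 0) v"
  shows "gn (\<lambda>x. u x + v x) x \<le> 2 * (gn u x + gn v x)"
proof -
  obtain c where c: "c \<in> A" "x \<in> cdom c" by (rule charts_cover)
  have y: "cmap c x \<in> cimg c" using c by simp
  have "pd c (\<lambda>x. u x + v x) (cmap c x) = pd c u (cmap c x) + pd c v (cmap c x)"
    by (rule pd_eqI) (auto intro!: derivative_eq_intros pd_has_derivative[OF u c(1) y]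
        pd_has_derivative[OF v c(1) y] simp: inner_add_left)
  then show ?thesis
    using conorm_add_le[OF metric_props(1)[OF c]]
    unfolding gn_chart[OF u c] gn_chart[OF v c] gn_chart[OF mCk_add[OF u v] c] by simp
qed

lemma gn_mult_le:
  assumes u: "mCk (Suc 0) u" and v: "mCk (Suc 0) v"
  shows "gn (\<lambda>x. u x * v x) x \<le> 2 * (\<bar>u x\<bar> * gn v x + \<bar>v x\<bar> * gn u x)"
proof -
  obtain c where c: "c \<in> A" "x \<in> cdom c" by (rule charts_cover)
  have y: "cmap c x \<in> cimg c" using c by simp
  have "pd c (\<lambda>x. u x * v x) (cmap c x) = u x *\<^sub>R pd c v (cmap c x) + v x *\<^sub>R pd c u (cmap c x)"
    using chart_props(5)[OF c]
    by (intro pd_eqI) (auto intro!: derivative_eq_intros pd_has_derivative[OF u c(1) y]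
        pd_has_derivative[OF v c(1) y] simp: inner_add_left)
  then show ?thesis
    using conorm_add_le[OF metric_props(1)[OF c], of "u x *\<^sub>R pd c v (cmap c x)" "v x *\<^sub>R pd c u (cmap c x)"]
    unfolding conorm_scaleR gn_chart[OF u c] gn_chart[OF v c] gn_chart[OF mCk_mult[OF u v] c] by simp
qed

lemma gn_compose:
  assumes u: "mCk (Suc 0) u" and h: "Ck_on (Suc 0) UNIV h" "(h has_real_derivative D) (at (u x))"
  shows "gn (\<lambda>x. h (u x)) x = \<bar>D\<bar> * gn u x"
proof -
  obtain c where c: "c \<in> A" "x \<in> cdom c" by (rule charts_cover)
  have y: "cmap c x \<in> cimg c" using c by simp
  have "(h has_derivative (*) D) (at (u (cinv c (cmap c x))))"
    using h(2) chart_props(5)[OF c] by (simp add: has_field_derivative_def)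
  from has_derivative_compose[OF pd_has_derivative[OF u c(1) y] this]
  have "pd c (\<lambda>x. h (u x)) (cmap c x) = D *\<^sub>R pd c u (cmap c x)"
    by (intro pd_eqI) simp
  then show ?thesis unfolding gn_chart[OF u c] gn_chart[OF mCk_compose[OF u h(1)] c] by (simp add: conorm_scaleR)
qed

lemma gn_affine:
  assumes u: "mCk (Suc 0) u"
  shows "gn (\<lambda>x. c + a * u x) x = \<bar>a\<bar> * gn u x"
proof -
  have "Ck_on (Suc 0) UNIV (\<lambda>t::real. c + a * t)"
    by (intro Ck_on_add Ck_on_mult Ck_on_const Ck_on_ident) simp_all
  then show ?thesis by (rule gn_compose[OF u]) (auto intro!: derivative_eq_intros)
qed

lemma gn_cmult: "mCk (Suc 0) u \<Longrightarrow> gn (\<lambda>x. a * u x) x = \<bar>a\<bar> * gn u x"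
  using gn_affine[of u 0 a] by simp

lemma gn_cong_open:
  assumes u: "mCk (Suc 0) u" and v: "mCk (Suc 0) v" and W: "open W" "x \<in> W" "\<And>z. z \<in> W \<Longrightarrow> u z = v z"
  shows "gn u x = gn v x"
proof -
  obtain c where c: "c \<in> A" "x \<in> cdom c" by (rule charts_cover)
  have y: "cmap c x \<in> cmap c ` (cdom c \<inter> W)" using c W by auto
  have "open (cmap c ` (cdom c \<inter> W))"
    by (rule open_chart_image[OF c(1)]) (use chart_props(1)[OF c(1)] W in auto)
  moreover have "u (cinv c z) = v (cinv c z)" if "z \<in> cmap c ` (cdom c \<inter> W)" for z
    using that chart_props(5)[OF c(1)] W by auto
  ultimately have "((\<lambda>y. v (cinv c y)) has_derivative (\<lambda>h. pd c u (cmap c x) \<bullet> h)) (at (cmap c x))"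
    by (rule has_derivative_transform_within_open[OF pd_has_derivative[OF u c(1)] _ y, rotated]) (use c in auto)
  then have "pd c v (cmap c x) = pd c u (cmap c x)" by (rule pd_eqI)
  then show ?thesis unfolding gn_chart[OF u c] gn_chart[OF v c] by simp
qed

lemma gn_const: "gn (\<lambda>x. a) x = 0"
proof -
  obtain c where c: "c \<in> A" "x \<in> cdom c" by (rule charts_cover)
  have "pd c (\<lambda>x. a) (cmap c x) = 0" by (rule pd_eqI) simp
  then show ?thesis using gn_chart[OF mCk_const c] by simp
qed

lemma gn_eq_0:
  assumes "mCk (Suc 0) u" "open W" "x \<in> W" "\<And>z. z \<in> W \<Longrightarrow> u z = a"
  shows "gn u x = 0"
  using gn_cong_open[OF assms(1) mCk_const[of _ a] assms(2,3)] assms(4) gn_const by simp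

text \<open>Constructions provide some compact set outside which a function vanishes. In a Hausdorff
  space that set is closed, so it contains the closure of the nonzero set, which is then
  compact.\<close>

lemma Cc_k_iff: "u \<in> Cc_k A k U \<longleftrightarrow> mCk k u \<and> (\<exists>K. compact K \<and> K \<subseteq> U \<and> (\<forall>x. x \<notin> K \<longrightarrow> u x = 0))"
proof
  assume "u \<in> Cc_k A k U"
  then show "mCk k u \<and> (\<exists>K. compact K \<and> K \<subseteq> U \<and> (\<forall>x. x \<notin> K \<longrightarrow> u x = 0))"
    using closure_subset[of "{x. u x \<noteq> 0}"] by (auto simp: Cc_k_def intro!: exI[of _ "closure {x. u x \<noteq> 0}"])
next
  assume "mCk k u \<and> (\<exists>K. compact K \<and> K \<subseteq> U \<and> (\<forall>x. x \<notin> K \<longrightarrow> u x = 0))"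
  then obtain K where K: "mCk k u" "compact K" "K \<subseteq> U" "\<And>x. x \<notin> K \<Longrightarrow> u x = 0" by blast
  have "closure {x. u x \<noteq> 0} \<subseteq> K"
    by (rule closure_minimal) (use K compact_imp_closed in auto)
  then show "u \<in> Cc_k A k U"
    using K compact_Int_closed[OF K(2) closed_closure, of "{x. u x \<noteq> 0}"]
    by (auto simp: Cc_k_def inf.absorb2)
qed

lemma Cc_inf_iff: "u \<in> Cc_inf A U \<longleftrightarrow> (\<forall>k. mCk k u) \<and> (\<exists>K. compact K \<and> K \<subseteq> U \<and> (\<forall>x. x \<notin> K \<longrightarrow> u x = 0))"
  unfolding Cc_inf_def by (auto simp: Cc_k_iff)

section \<open>Transport of functions through a chart\<close>

lemma compact_chart_image: "c \<in> A \<Longrightarrow> compact K \<Longrightarrow> K \<subseteq> cdom c \<Longrightarrow> compact (cmap c ` K)"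
  by (rule compact_continuous_image) (auto intro: continuous_on_subset[OF chart_props(3)])

lemma compact_chart_preimage: "c \<in> A \<Longrightarrow> compact L \<Longrightarrow> L \<subseteq> cimg c \<Longrightarrow> compact (cinv c ` L)"
  by (rule compact_continuous_image[OF continuous_on_subset[OF chart_props(4)]])

definition push :: "('m, 'n) chart \<Rightarrow> ((real, 'n) vec \<Rightarrow> real) \<Rightarrow> 'm \<Rightarrow> real" where
  "push c v x = (if x \<in> cdom c then v (cmap c x) else 0)"

definition pull :: "('m, 'n) chart \<Rightarrow> ('m \<Rightarrow> real) \<Rightarrow> (real, 'n) vec \<Rightarrow> real" where
  "pull c u y = (if y \<in> cimg c then u (cinv c y) else 0)"

lemma push_outside:
  assumes "c \<in> A" "L \<subseteq> cimg c" "\<And>y. y \<notin> L \<Longrightarrow> v y = 0" "x \<notin> cinv c ` L"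
  shows "push c v x = 0"
  using assms chart_props(5)[OF assms(1)] by (auto simp: push_def image_iff) metis

text \<open>Seen from another chart, the function is a composite with the transition map on the
  overlap. At a point outside the domain of \<open>c\<close> it vanishes nearby, since the image of
  the compact \<open>L\<close> is closed and lies inside that domain.\<close>

lemma push_mCk:
  assumes c: "c \<in> A" and L: "compact L" "L \<subseteq> cimg c" "\<And>y. y \<notin> L \<Longrightarrow> v y = 0" and v: "Ck_on k UNIV v"
  shows "mCk k (push c v)"
proof (rule mCkI, rule Ck_on_locally)
  fix d y assume d: "d \<in> A" and y: "y \<in> cimg d"
  show "\<exists>T. open T \<and> y \<in> T \<and> Ck_on k T (\<lambda>y. push c v (cinv d y))"
  proof (cases "cinv d y \<in> cdom c")
    case True
    let ?T = "cmap d ` (cdom d \<inter> cdom c)"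
    have o: "open ?T" by (rule open_overlap[OF d c])
    have "cmap d (cinv d y) \<in> ?T" using True chart_props(7)[OF d y] by (intro imageI) blast
    then have "y \<in> ?T" by (simp only: chart_props(6)[OF d y])
    moreover have "Ck_on k ?T (\<lambda>y. v (cmap c (cinv d y)))"
      by (rule Ck_on_compose[OF o open_UNIV _ transition_Ck[OF d c] v]) simp
    then have "Ck_on k ?T (\<lambda>y. push c v (cinv d y))"
      by (rule Ck_on_cong[OF o, rotated]) (auto simp: push_def chart_props(5)[OF d])
    ultimately show ?thesis using o by blast
  next
    case False
    let ?K = "cinv c ` L"
    let ?T = "cmap d ` (cdom d - ?K)"
    have "closed ?K" by (rule compact_imp_closed[OF compact_chart_preimage[OF c L(1,2)]])
    then have o: "open ?T"
      by (intro open_chart_image[OF d] open_Diff chart_props(1)[OF d]) auto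
    have "?K \<subseteq> cdom c" using L(2) chart_props(7)[OF c] by auto
    then have "cinv d y \<in> cdom d - ?K" using False chart_props(7)[OF d y] by blast
    then have "cmap d (cinv d y) \<in> ?T" by (rule imageI)
    then have "y \<in> ?T" by (simp only: chart_props(6)[OF d y])
    moreover have "Ck_on k ?T (\<lambda>y. push c v (cinv d y))"
      by (rule Ck_on_cong[OF o _ Ck_on_const[of _ _ 0]])
         (auto simp: chart_props(5)[OF d] push_outside[OF c L(2,3)])
    ultimately show ?thesis using o by blast
  qed
qed

lemma pull_Ck:
  assumes c: "c \<in> A" and K: "compact K" "K \<subseteq> cdom c" "\<And>x. x \<notin> K \<Longrightarrow> u x = 0" and u: "mCk k u"
  shows "Ck_on k UNIV (pull c u)" "y \<notin> cmap c ` K \<Longrightarrow> pull c u y = 0"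
proof -
  show 0: "pull c u y = 0" if "y \<notin> cmap c ` K" for y
    using that K(2,3) chart_props(6)[OF c] by (auto simp: pull_def image_iff) metis
  show "Ck_on k UNIV (pull c u)"
  proof (rule Ck_on_locally)
    fix y
    show "\<exists>T. open T \<and> y \<in> T \<and> Ck_on k T (pull c u)"
    proof (cases "y \<in> cimg c")
      case True
      have "Ck_on k (cimg c) (pull c u)"
        by (rule Ck_on_cong[OF chart_props(2)[OF c] _ mCk_chart[OF u c]]) (simp add: pull_def)
      then show ?thesis using True chart_props(2)[OF c] by blast
    next
      case False
      have o: "open (- cmap c ` K)"
        using compact_imp_closed[OF compact_chart_image[OF c K(1,2)]] by (simp add: open_Compl)
      then have "Ck_on k (- cmap c ` K) (pull c u)"
        by (rule Ck_on_cong[OF _ _ Ck_on_const[of _ _ 0]]) (simp add: 0)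
      then show ?thesis using o False K(2) by blast
    qed
  qed
qed

section \<open>Coordinate balls on which the metric is comparable to the Euclidean one\<close>

text \<open>One pair \<open>l\<close>, \<open>L\<close> bounds both the volume density and the dual
  norm. On the closed ball such bounds are a matter of compactness; integrals are later taken over
  the open ball.\<close>

definition good_ball :: "('m, 'n) chart \<Rightarrow> (real, 'n) vec \<Rightarrow> real \<Rightarrow> real \<Rightarrow> real \<Rightarrow> bool" where
  "good_ball c a r l L \<longleftrightarrow> c \<in> A \<and> 0 < r \<and> cball a r \<subseteq> cimg c \<and> 0 < l \<and> 0 < L \<and>
    (\<forall>y\<in>cball a r. l \<le> rho c y \<and> rho c y \<le> L \<and>
      (\<forall>w. l * norm w \<le> conorm (g c (cinv c y)) w \<and> conorm (g c (cinv c y)) w \<le> L * norm w))"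

lemma good_ball_shrink: "good_ball c a r l L \<Longrightarrow> 0 < s \<Longrightarrow> s \<le> r \<Longrightarrow> good_ball c a s l L"
  using subset_cball[of s r a] unfolding good_ball_def by (meson subsetD subset_trans)

text \<open>Extreme values over the compact product of \<open>K\<close> with the unit sphere,
  extended to all vectors by homogeneity.\<close>

lemma elliptic_on_compact:
  fixes G :: "'x::euclidean_space \<Rightarrow> real^'k::finite^'k"
  assumes "compact K" "K \<noteq> {}" "continuous_on K G" "\<And>y. y \<in> K \<Longrightarrow> posdef (G y)"
  obtains l L where "0 < l" "0 < L" "\<And>y v. y \<in> K \<Longrightarrow> l * (norm v)\<^sup>2 \<le> v \<bullet> (G y *v v)"
    "\<And>y v. y \<in> K \<Longrightarrow> norm (G y *v v) \<le> L * norm v"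
proof -
  let ?S = "K \<times> sphere (0::real^'k) 1"
  have "compact ?S" by (intro compact_Times assms(1)) simp
  \<comment> \<open>The vector with equal entries has length 1, so the sphere, and with it
    \<open>?S\<close>, is nonempty and the extrema exist.\<close>
  have "(\<chi> i. 1 / sqrt (real CARD('k))) \<in> sphere (0::real^'k) 1"
    by (simp add: norm_vec_def L2_set_def power_divide)
  then have ne: "?S \<noteq> {}" using assms(2) by blast
  have G: "continuous_on ?S (\<lambda>p. G (fst p))"
    by (rule continuous_on_compose2[OF assms(3)]) (auto intro!: continuous_intros)
  have Gv: "continuous_on ?S (\<lambda>p. G (fst p) *v snd p)"
    unfolding matrix_vector_mult_def by (intro continuous_intros G)
  have c1: "continuous_on ?S (\<lambda>p. snd p \<bullet> (G (fst p) *v snd p))" by (intro continuous_intros Gv)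
  obtain p where p: "p \<in> ?S" "\<And>q. q \<in> ?S \<Longrightarrow> snd p \<bullet> (G (fst p) *v snd p) \<le> snd q \<bullet> (G (fst q) *v snd q)"
    using continuous_attains_inf[OF \<open>compact ?S\<close> ne c1] by blast
  obtain p' where p': "p' \<in> ?S" "\<And>q. q \<in> ?S \<Longrightarrow> norm (G (fst q) *v snd q) \<le> norm (G (fst p') *v snd p')"
    using continuous_attains_sup[OF \<open>compact ?S\<close> ne continuous_on_norm[OF Gv]] by blast
  define l where "l = snd p \<bullet> (G (fst p) *v snd p)"
  define L where "L = norm (G (fst p') *v snd p') + 1"
  have "fst p \<in> K" "snd p \<noteq> 0" using p(1) by (auto simp: mem_Times_iff)
  then have "0 < l" using assms(4)[of "fst p"] unfolding l_def posdef_def by blast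
  have u: "(y, v /\<^sub>R norm v) \<in> ?S" if "y \<in> K" "v \<noteq> 0" for y v using that by simp
  show thesis
  proof (rule that[of l L])
    show "l * (norm v)\<^sup>2 \<le> v \<bullet> (G y *v v)" if "y \<in> K" for y v
    proof (cases "v = 0")
      case False
      have "l \<le> (v \<bullet> (G y *v v)) / (norm v)\<^sup>2"
        using p(2)[OF u[OF that False]] False
        by (simp add: l_def matrix_vector_mult_scaleR power2_eq_square divide_inverse mult_ac)
      then show ?thesis using False by (simp add: field_simps)
    qed simp
    show "norm (G y *v v) \<le> L * norm v" if "y \<in> K" for y v
    proof (cases "v = 0")
      case False
      have "norm (G y *v v) / norm v \<le> L"
        using p'(2)[OF u[OF that False]] False
        by (simp add: L_def matrix_vector_mult_scaleR divide_inverse mult_ac)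
      then show ?thesis using False by (simp add: field_simps)
    qed simp
  qed (use \<open>0 < l\<close> in \<open>auto simp: L_def add_nonneg_pos\<close>)
qed

lemma good_ball_exists:
  assumes c: "c \<in> A" "x \<in> cdom c" and W: "open W" "x \<in> W"
  obtains r l L where "good_ball c (cmap c x) r l L" "cinv c ` cball (cmap c x) r \<subseteq> W"
proof -
  let ?a = "cmap c x"
  have o: "open (cmap c ` (cdom c \<inter> W))"
    by (rule open_chart_image[OF c(1)]) (use chart_props(1)[OF c(1)] W in auto)
  have "?a \<in> cmap c ` (cdom c \<inter> W)" using c W by auto
  then obtain r where r: "0 < r" "cball ?a r \<subseteq> cmap c ` (cdom c \<inter> W)"
    using o open_contains_cball by blast
  then have sub: "cball ?a r \<subseteq> cimg c" by blast
  have inW: "cinv c ` cball ?a r \<subseteq> W"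
    using r(2) chart_props(5)[OF c(1)] by fastforce
  have pos: "posdef (g c (cinv c y))" if "y \<in> cball ?a r" for y
    by (rule metric_props(1)[OF c(1) chart_props(7)[OF c(1)]]) (use sub that in auto)
  obtain l L where lL: "0 < l" "0 < L" "\<And>y v. y \<in> cball ?a r \<Longrightarrow> l * (norm v)\<^sup>2 \<le> v \<bullet> (g c (cinv c y) *v v)"
    "\<And>y v. y \<in> cball ?a r \<Longrightarrow> norm (g c (cinv c y) *v v) \<le> L * norm v"
    by (rule elliptic_on_compact[of "cball ?a r" "\<lambda>y. g c (cinv c y)"])
       (use r pos continuous_on_subset[OF metric_props(2)[OF c(1)] sub] in auto)
  have cr: "continuous_on (cball ?a r) (rho c)" by (rule continuous_on_subset[OF rho_continuous[OF c(1)] sub])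
  have ne: "cball ?a r \<noteq> {}" using r by simp
  obtain y1 where y1: "y1 \<in> cball ?a r" "\<And>y. y \<in> cball ?a r \<Longrightarrow> rho c y1 \<le> rho c y"
    using continuous_attains_inf[OF compact_cball ne cr] by blast
  obtain y2 where y2: "y2 \<in> cball ?a r" "\<And>y. y \<in> cball ?a r \<Longrightarrow> rho c y \<le> rho c y2"
    using continuous_attains_sup[OF compact_cball ne cr] by blast
  have p1: "0 < rho c y1" "0 < rho c y2" using y1(1) y2(1) sub rho_pos[OF c(1)] by blast+
  let ?l = "min (rho c y1) (sqrt l / L)" and ?L = "max (rho c y2) (1 / sqrt l)"
  \<comment> \<open>\<open>sqrt l / L\<close> and \<open>1 / sqrt l\<close> are the constants of
    \<open>conorm_bounds\<close>; minimum and maximum merge them with the extreme values of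
    \<open>rho\<close>.\<close>
  have "good_ball c ?a r ?l ?L"
    unfolding good_ball_def
  proof (intro conjI ballI allI)
    fix y assume y: "y \<in> cball ?a r"
    show "?l \<le> rho c y" "rho c y \<le> ?L" using y1(2)[OF y] y2(2)[OF y] by auto
    fix w :: "(real, 'n) vec"
    note b = conorm_bounds[OF pos[OF y] lL(1,2) lL(3)[OF y] lL(4)[OF y], of w]
    have "?l * norm w \<le> sqrt l / L * norm w" by (rule mult_right_mono) auto
    then show "?l * norm w \<le> conorm (g c (cinv c y)) w" using b(1) by linarith
    have "1 / sqrt l * norm w \<le> ?L * norm w" by (rule mult_right_mono) auto
    then show "conorm (g c (cinv c y)) w \<le> ?L * norm w" using b(2) by linarith
  qed (use c r sub lL p1 in \<open>auto simp: less_max_iff_disj\<close>)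
  then show thesis using that inW by blast
qed

lemma chart_preimage_measurable:
  assumes "c \<in> A" "B \<in> sets borel" "B \<subseteq> cimg c"
  shows "cinv c ` B \<in> sets borel"
proof -
  define h where "h x = (if x \<in> cdom c then cmap c x else undefined)" for x
  have h: "h \<in> borel_measurable borel"
    unfolding h_def[abs_def]
    by (subst measurable_restrict_space_iff[symmetric])
       (auto simp: chart_props(1)[OF assms(1)] intro!: borel_measurable_continuous_on_restrict chart_props(3)[OF assms(1)])
  have "x \<in> cinv c ` B \<longleftrightarrow> x \<in> (h -` B \<inter> space borel) \<inter> cdom c" for x
  proof
    assume "x \<in> cinv c ` B"
    then obtain y where y: "y \<in> B" "x = cinv c y" by auto
    then have "y \<in> cimg c" using assms(3) by blast
    then show "x \<in> (h -` B \<inter> space borel) \<inter> cdom c"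
      using y chart_props(6,7)[OF assms(1)] by (simp add: h_def)
  next
    assume "x \<in> (h -` B \<inter> space borel) \<inter> cdom c"
    then have "x \<in> cdom c" "cmap c x \<in> B" by (auto simp: h_def)
    then show "x \<in> cinv c ` B" using chart_props(5)[OF assms(1)] by (metis imageI)
  qed
  then have "cinv c ` B = (h -` B \<inter> space borel) \<inter> cdom c" by blast
  also have "\<dots> \<in> sets borel"
    by (intro sets.Int measurable_sets[OF h assms(2)]) (use chart_props(1)[OF assms(1)] in auto)
  finally show ?thesis .
qed

lemma nn_integral_good_ball:
  assumes gb: "good_ball c a r l L" and B: "B \<in> sets borel" "B \<subseteq> cball a r" and f: "f \<in> borel_measurable borel"
  shows "ennreal l * (\<integral>\<^sup>+y. indicator B y * f (cinv c y) \<partial>lborel) \<le> (\<integral>\<^sup>+x. indicator (cinv c ` B) x * f x \<partial>vol)" (is ?low)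
    and "(\<integral>\<^sup>+x. indicator (cinv c ` B) x * f x \<partial>vol) \<le> ennreal L * (\<integral>\<^sup>+y. indicator B y * f (cinv c y) \<partial>lborel)" (is ?up)
proof -
  have c: "c \<in> A" and sub: "B \<subseteq> cimg c" using gb B(2) by (auto simp: good_ball_def)
  have m1: "cinv c ` B \<in> sets borel" by (rule chart_preimage_measurable[OF c B(1) sub])
  \<comment> \<open>\<open>cinv c\<close> is uncontrolled off the chart image; on \<open>B\<close>
    it agrees with the Borel function \<open>einv c\<close>.\<close>
  have m: "(\<lambda>y. indicator B y * f (cinv c y)) \<in> borel_measurable borel"
  proof -
    have "(\<lambda>y. indicator B y * f (einv c y)) \<in> borel_measurable borel"
      using einv_measurable[OF c] B(1) f by measurable
    moreover have "(\<lambda>y. indicator B y * f (einv c y)) = (\<lambda>y. indicator B y * f (cinv c y))"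
      using sub by (intro ext) (auto simp: einv_def indicator_def)
    ultimately show ?thesis by metis
  qed
  have cd: "cinv c ` B \<subseteq> cdom c" using sub chart_props(7)[OF c] by blast
  have ind: "indicator (cinv c ` B) (cinv c y) = (indicator B y :: ennreal)" if "y \<in> cimg c" for y
  proof -
    have "cinv c y \<in> cinv c ` B \<longleftrightarrow> y \<in> B"
    proof
      assume "cinv c y \<in> cinv c ` B"
      then obtain z where z: "z \<in> B" "cinv c y = cinv c z" by blast
      then have "z \<in> cimg c" using sub by blast
      have "y = cmap c (cinv c y)" by (simp only: chart_props(6)[OF c that])
      also have "\<dots> = z" unfolding z(2) by (rule chart_props(6)[OF c \<open>z \<in> cimg c\<close>])
      finally show "y \<in> B" using z by simp
    qed (rule imageI)
    then show ?thesis by (simp add: indicator_def)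
  qed
  have "(\<integral>\<^sup>+x. indicator (cinv c ` B) x * f x \<partial>vol) = (\<integral>\<^sup>+x. indicator (cdom c) x * (indicator (cinv c ` B) x * f x) \<partial>vol)"
    using cd by (intro nn_integral_cong) (auto simp: indicator_def)
  also have "\<dots> = (\<integral>\<^sup>+y. indicator (cimg c) y * (ennreal (rho c y) * (indicator (cinv c ` B) (cinv c y) * f (cinv c y))) \<partial>lborel)"
    by (rule nn_integral_vol_chart[OF c]) (use m1 f in measurable)
  also have "\<dots> = (\<integral>\<^sup>+y. ennreal (rho c y) * (indicator B y * f (cinv c y)) \<partial>lborel)"
  proof (rule nn_integral_cong)
    show "indicator (cimg c) y * (ennreal (rho c y) * (indicator (cinv c ` B) (cinv c y) * f (cinv c y)))
        = ennreal (rho c y) * (indicator B y * f (cinv c y))" for y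
    proof (cases "y \<in> cimg c")
      case True
      then show ?thesis by (simp only: ind[OF True] indicator_simps mult_1)
    next
      case False
      then have "y \<notin> B" using sub by blast
      show ?thesis unfolding indicator_simps(2)[OF False] indicator_simps(2)[OF \<open>y \<notin> B\<close>]
        by (simp only: mult_zero_left mult_zero_right)
    qed
  qed
  finally have eq: "(\<integral>\<^sup>+x. indicator (cinv c ` B) x * f x \<partial>vol) = (\<integral>\<^sup>+y. ennreal (rho c y) * (indicator B y * f (cinv c y)) \<partial>lborel)" .
  have bd: "l \<le> rho c y" "rho c y \<le> L" if "y \<in> B" for y using gb that B(2) by (auto simp: good_ball_def)
  have "ennreal l * (\<integral>\<^sup>+y. indicator B y * f (cinv c y) \<partial>lborel) = (\<integral>\<^sup>+y. ennreal l * (indicator B y * f (cinv c y)) \<partial>lborel)"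
    by (rule nn_integral_cmult[symmetric]) (use m in simp)
  also have "\<dots> \<le> (\<integral>\<^sup>+y. ennreal (rho c y) * (indicator B y * f (cinv c y)) \<partial>lborel)"
    using bd by (intro nn_integral_mono) (auto simp: indicator_def intro!: mult_right_mono ennreal_leI)
  finally show ?low unfolding eq .
  have "(\<integral>\<^sup>+y. ennreal (rho c y) * (indicator B y * f (cinv c y)) \<partial>lborel) \<le> (\<integral>\<^sup>+y. ennreal L * (indicator B y * f (cinv c y)) \<partial>lborel)"
    using bd by (intro nn_integral_mono) (auto simp: indicator_def intro!: mult_right_mono ennreal_leI)
  also have "\<dots> = ennreal L * (\<integral>\<^sup>+y. indicator B y * f (cinv c y) \<partial>lborel)"
    by (rule nn_integral_cmult) (use m in simp)
  finally show ?up unfolding eq .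
qed

section \<open>Energies\<close>

text \<open>\<open>energy\<close> and \<open>mass\<close> are powers of norms as extended integrals,
  so that estimates can be written before finiteness is known.\<close>

definition energy :: "real \<Rightarrow> ('m \<Rightarrow> real) \<Rightarrow> ennreal" where
  "energy p u = (\<integral>\<^sup>+x. ennreal (gn u x powr p) \<partial>vol)"

definition mass :: "real \<Rightarrow> 'm set \<Rightarrow> ('m \<Rightarrow> real) \<Rightarrow> ennreal" where
  "mass q K u = (\<integral>\<^sup>+x. indicator K x * ennreal (\<bar>u x\<bar> powr q) \<partial>vol)"

lemma mass_mono: "K \<subseteq> L \<Longrightarrow> mass q K u \<le> mass q L u"
  unfolding mass_def by (intro nn_integral_mono) (auto simp: indicator_def)

lemma mass_add_le:
  assumes "0 \<le> q" and [measurable]: "u \<in> borel_measurable borel" "v \<in> borel_measurable borel" "K \<in> sets borel"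
  shows "mass q K (\<lambda>x. u x + v x) \<le> ennreal (2 powr q) * (mass q K u + mass q K v)"
proof -
  have "mass q K (\<lambda>x. u x + v x)
      \<le> (\<integral>\<^sup>+x. ennreal (2 powr q) * (indicator K x * ennreal (\<bar>u x\<bar> powr q) + indicator K x * ennreal (\<bar>v x\<bar> powr q)) \<partial>vol)"
    unfolding mass_def
  proof (rule nn_integral_mono)
    fix x
    have "\<bar>u x + v x\<bar> powr q \<le> (\<bar>u x\<bar> + \<bar>v x\<bar>) powr q" using assms(1) by (intro powr_mono2) auto
    also have "\<dots> \<le> 2 powr q * (\<bar>u x\<bar> powr q + \<bar>v x\<bar> powr q)" using assms(1) by (intro add_powr_le) auto
    finally have "ennreal (\<bar>u x + v x\<bar> powr q) \<le> ennreal (2 powr q) * (ennreal (\<bar>u x\<bar> powr q) + ennreal (\<bar>v x\<bar> powr q))"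
      by (simp add: ennreal_leI flip: ennreal_mult' ennreal_plus)
    then show "indicator K x * ennreal (\<bar>u x + v x\<bar> powr q)
      \<le> ennreal (2 powr q) * (indicator K x * ennreal (\<bar>u x\<bar> powr q) + indicator K x * ennreal (\<bar>v x\<bar> powr q))"
      by (simp add: indicator_def)
  qed
  also have "\<dots> = ennreal (2 powr q) * (mass q K u + mass q K v)"
    unfolding mass_def by (subst nn_integral_cmult, measurable) (subst nn_integral_add, auto)
  finally show ?thesis .
qed

lemma energy_add_le:
  assumes p: "0 \<le> p" and u: "mCk (Suc 0) u" and v: "mCk (Suc 0) v"
  shows "energy p (\<lambda>x. u x + v x) \<le> ennreal (4 powr p) * (energy p u + energy p v)"
proof -
  note [measurable] = gn_measurable[OF u] gn_measurable[OF v]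
  have "energy p (\<lambda>x. u x + v x)
      \<le> (\<integral>\<^sup>+x. ennreal (4 powr p) * (ennreal (gn u x powr p) + ennreal (gn v x powr p)) \<partial>vol)"
    unfolding energy_def
  proof (rule nn_integral_mono)
    fix x
    have n: "0 \<le> gn u x" "0 \<le> gn v x" using gn_nonneg u v by auto
    have "gn (\<lambda>x. u x + v x) x powr p \<le> (2 * (gn u x + gn v x)) powr p"
      using p gn_add_le[OF u v] gn_nonneg[OF mCk_add[OF u v]] by (intro powr_mono2) auto
    also have "\<dots> = 2 powr p * (gn u x + gn v x) powr p" by (rule powr_mult)
    also have "\<dots> \<le> 2 powr p * (2 powr p * (gn u x powr p + gn v x powr p))"
      using p n by (intro mult_left_mono add_powr_le) auto
    also have "\<dots> = 4 powr p * (gn u x powr p + gn v x powr p)"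
      using powr_mult[of 2 2 p] by simp
    finally show "ennreal (gn (\<lambda>x. u x + v x) x powr p)
        \<le> ennreal (4 powr p) * (ennreal (gn u x powr p) + ennreal (gn v x powr p))"
      by (simp add: ennreal_leI flip: ennreal_mult' ennreal_plus)
  qed
  also have "\<dots> = ennreal (4 powr p) * (energy p u + energy p v)"
    unfolding energy_def by (subst nn_integral_cmult, measurable) (subst nn_integral_add, auto)
  finally show ?thesis .
qed

lemma energy_cmult:
  assumes "mCk (Suc 0) u"
  shows "energy p (\<lambda>x. a * u x) = ennreal (\<bar>a\<bar> powr p) * energy p u"
proof -
  note [measurable] = gn_measurable[OF assms]
  have "ennreal (gn (\<lambda>x. a * u x) x powr p) = ennreal (\<bar>a\<bar> powr p) * ennreal (gn u x powr p)" for x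
    using gn_nonneg[OF assms] by (simp add: gn_cmult[OF assms] powr_mult flip: ennreal_mult')
  then have "energy p (\<lambda>x. a * u x) = (\<integral>\<^sup>+x. ennreal (\<bar>a\<bar> powr p) * ennreal (gn u x powr p) \<partial>vol)"
    by (simp add: energy_def)
  also have "\<dots> = ennreal (\<bar>a\<bar> powr p) * energy p u"
    unfolding energy_def by (rule nn_integral_cmult) measurable
  finally show ?thesis .
qed

lemma mass_cmult:
  assumes [measurable]: "u \<in> borel_measurable borel" "K \<in> sets borel"
  shows "mass q K (\<lambda>x. a * u x) = ennreal (\<bar>a\<bar> powr q) * mass q K u"
proof -
  have "indicator K x * ennreal (\<bar>a * u x\<bar> powr q) = ennreal (\<bar>a\<bar> powr q) * (indicator K x * ennreal (\<bar>u x\<bar> powr q))" for x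
    by (simp add: abs_mult powr_mult ennreal_mult' mult_ac)
  then show ?thesis unfolding mass_def by (simp add: nn_integral_cmult)
qed

text \<open>In the product rule the gradient of \<open>b\<close> lives in \<open>L\<close>, so a
  cutoff costs the L^p norm over \<open>L\<close> only. Of the constant 4^p, one 2^p comes from the
  factor in \<open>gn_mult_le\<close> and one from \<open>add_powr_le\<close>.\<close>

lemma energy_cutoff_le:
  assumes p: "1 \<le> p" and b: "mCk (Suc 0) b" "\<And>x. \<bar>b x\<bar> \<le> 1" "\<And>x. gn b x \<le> G * indicator L x"
    and G: "0 \<le> G" and L: "L \<in> sets borel" and u: "mCk (Suc 0) u"
  shows "energy p (\<lambda>x. b x * u x) \<le> ennreal (4 powr p) * (ennreal (G powr p) * mass p L u + energy p u)"
proof -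
  note [measurable] = gn_measurable[OF u] L mCk_measurable[OF u]
  have "energy p (\<lambda>x. b x * u x)
      \<le> (\<integral>\<^sup>+x. ennreal (4 powr p) * (ennreal (G powr p) * (indicator L x * ennreal (\<bar>u x\<bar> powr p)) + ennreal (gn u x powr p)) \<partial>vol)"
    unfolding energy_def
  proof (rule nn_integral_mono)
    fix x
    have n: "0 \<le> gn u x" "0 \<le> gn b x" using gn_nonneg u b by auto
    have "\<bar>b x\<bar> * gn u x + \<bar>u x\<bar> * gn b x \<le> 1 * gn u x + \<bar>u x\<bar> * (G * indicator L x)"
      using b(2,3) n by (intro add_mono mult_mono) auto
    then have "2 * (\<bar>b x\<bar> * gn u x + \<bar>u x\<bar> * gn b x) \<le> 2 * (gn u x + \<bar>u x\<bar> * (G * indicator L x))"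
      by simp
    with gn_mult_le[OF b(1) u, of x] have "gn (\<lambda>x. b x * u x) x \<le> 2 * (gn u x + \<bar>u x\<bar> * (G * indicator L x))"
      by (rule order_trans)
    then have "gn (\<lambda>x. b x * u x) x powr p \<le> (2 * (gn u x + \<bar>u x\<bar> * (G * indicator L x))) powr p"
      using p gn_nonneg[OF mCk_mult[OF b(1) u]] by (intro powr_mono2) auto
    also have "\<dots> = 2 powr p * (gn u x + \<bar>u x\<bar> * (G * indicator L x)) powr p"
      by (rule powr_mult)
    also have "\<dots> \<le> 2 powr p * (2 powr p * (gn u x powr p + (\<bar>u x\<bar> * (G * indicator L x)) powr p))"
      using p n G by (intro mult_left_mono add_powr_le) auto
    also have "\<dots> = 4 powr p * ((\<bar>u x\<bar> * (G * indicator L x)) powr p + gn u x powr p)"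
      using powr_mult[of 2 2 p] by simp
    also have "(\<bar>u x\<bar> * (G * indicator L x)) powr p = G powr p * (indicator L x * \<bar>u x\<bar> powr p)"
      using p G by (auto simp: indicator_def powr_mult)
    finally have "ennreal (gn (\<lambda>x. b x * u x) x powr p)
        \<le> ennreal (4 powr p * (G powr p * (indicator L x * \<bar>u x\<bar> powr p) + gn u x powr p))"
      by (rule ennreal_leI)
    also have "\<dots> = ennreal (4 powr p) * (ennreal (G powr p) * (indicator L x * ennreal (\<bar>u x\<bar> powr p)) + ennreal (gn u x powr p))"
    proof -
      have "ennreal (a * (b * c + d)) = ennreal a * (ennreal b * ennreal c + ennreal d)"
        if "0 \<le> a" "0 \<le> b" "0 \<le> c" "0 \<le> d" for a b c d :: real
        using that by (simp add: ennreal_mult ennreal_plus)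
      moreover have "ennreal (indicator L x * \<bar>u x\<bar> powr p) = indicator L x * ennreal (\<bar>u x\<bar> powr p)"
        by (cases "x \<in> L") simp_all
      ultimately show ?thesis by simp
    qed
    finally show "ennreal (gn (\<lambda>x. b x * u x) x powr p)
        \<le> ennreal (4 powr p) * (ennreal (G powr p) * (indicator L x * ennreal (\<bar>u x\<bar> powr p)) + ennreal (gn u x powr p))" .
  qed
  also have "\<dots> = ennreal (4 powr p) * (ennreal (G powr p) * mass p L u + energy p u)"
    unfolding energy_def mass_def
    by (subst nn_integral_cmult, measurable) (subst nn_integral_add, auto simp: nn_integral_cmult)
  finally show ?thesis .
qed

section \<open>Covering arguments and cutoff functions\<close>

text \<open>Induction along a finite subcover, in the form used for all compactness arguments below:
  a property that can annex some neighbourhood of each point of \<open>K\<close> spreads from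
  \<open>W0\<close> to an open set containing \<open>W0\<close> and \<open>K\<close>.\<close>

lemma compact_absorb:
  assumes "compact K" and loc: "\<And>x. x \<in> K \<Longrightarrow> \<exists>V. open V \<and> x \<in> V \<and> (\<forall>W. open W \<longrightarrow> P W \<longrightarrow> P (W \<union> V))"
    and "open W0" "P W0"
  obtains W :: "'m set" where "open W" "W0 \<union> K \<subseteq> W" "P W"
proof -
  obtain V where V: "\<And>x. x \<in> K \<Longrightarrow> open (V x)" "\<And>x. x \<in> K \<Longrightarrow> x \<in> V x"
    "\<And>x W. x \<in> K \<Longrightarrow> open W \<Longrightarrow> P W \<Longrightarrow> P (W \<union> V x)"
    using loc by metis
  obtain I where I: "finite I" "I \<subseteq> K" "K \<subseteq> (\<Union>x\<in>I. V x)"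
    using compactE_image[OF assms(1), of K V] V(1,2) by (metis UN_iff subsetI)
  have "open (W0 \<union> (\<Union>x\<in>I. V x)) \<and> P (W0 \<union> (\<Union>x\<in>I. V x))"
    using I(1,2)
  proof (induction I rule: finite_induct)
    case empty
    then show ?case using assms by simp
  next
    case (insert x I)
    then have "P (W0 \<union> (\<Union>x\<in>I. V x) \<union> V x)" "open (W0 \<union> (\<Union>x\<in>I. V x) \<union> V x)"
      using V by auto
    moreover have "W0 \<union> (\<Union>x\<in>I. V x) \<union> V x = W0 \<union> (\<Union>x\<in>insert x I. V x)" by auto
    ultimately show ?case by simp
  qed
  then show thesis using that[of "W0 \<union> (\<Union>x\<in>I. V x)"] I(3) by blast
qed

section \<open>Algebra of compactly supported functions and cutoffs\<close>

lemma Cc_infI: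
  "(\<And>k. mCk k u) \<Longrightarrow> compact K \<Longrightarrow> K \<subseteq> U \<Longrightarrow> (\<And>x. x \<notin> K \<Longrightarrow> u x = 0) \<Longrightarrow> u \<in> Cc_inf A U"
  using Cc_inf_iff by blast

lemma Cc_inf_imp_Cc_k: "u \<in> Cc_inf A U \<Longrightarrow> u \<in> Cc_k A k U"
  unfolding Cc_inf_def by blast

lemma Cc_inf_mono: "u \<in> Cc_inf A U \<Longrightarrow> U \<subseteq> V \<Longrightarrow> u \<in> Cc_inf A V"
  unfolding Cc_inf_iff by blast

lemma Cc_k_add:
  assumes "u \<in> Cc_k A k U" "v \<in> Cc_k A k U"
  shows "(\<lambda>x. u x + v x) \<in> Cc_k A k U"
proof -
  obtain K L where K: "mCk k u" "compact K" "K \<subseteq> U" "\<And>x. x \<notin> K \<Longrightarrow> u x = 0"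
    and L: "mCk k v" "compact L" "L \<subseteq> U" "\<And>x. x \<notin> L \<Longrightarrow> v x = 0"
    using assms unfolding Cc_k_iff by blast
  show ?thesis unfolding Cc_k_iff
    by (intro conjI mCk_add K L exI[of _ "K \<union> L"] compact_Un) (use K L in auto)
qed

lemma Cc_k_mult:
  assumes "u \<in> Cc_k A k U" "mCk k v"
  shows "(\<lambda>x. v x * u x) \<in> Cc_k A k U"
proof -
  obtain K where K: "mCk k u" "compact K" "K \<subseteq> U" "\<And>x. x \<notin> K \<Longrightarrow> u x = 0"
    using assms unfolding Cc_k_iff by blast
  show ?thesis unfolding Cc_k_iff
    by (intro conjI mCk_mult assms K exI[of _ K]) (use K in auto)
qed

lemma Cc_inf_add: "u \<in> Cc_inf A U \<Longrightarrow> v \<in> Cc_inf A U \<Longrightarrow> (\<lambda>x. u x + v x) \<in> Cc_inf A U"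
  by (auto simp: Cc_inf_def intro: Cc_k_add)

lemma Cc_inf_mult: "u \<in> Cc_inf A U \<Longrightarrow> (\<And>k. mCk k v) \<Longrightarrow> (\<lambda>x. v x * u x) \<in> Cc_inf A U"
  by (auto simp: Cc_inf_def intro: Cc_k_mult)

lemma Cc_k_mult_cutoff:
  assumes "u \<in> Cc_k A k W" "b \<in> Cc_k A k U"
  shows "(\<lambda>x. b x * u x) \<in> Cc_k A k U"
  using Cc_k_mult[OF assms(2), of u] assms(1) unfolding Cc_k_iff by (simp add: mult.commute)

text \<open>Multiplying by \<open>1 - b\<close> removes from the support the open set on which \<open>b = 1\<close>.\<close>

lemma Cc_k_mult_compl:
  assumes u: "u \<in> Cc_k A k (U \<inter> (W \<union> V))" and b: "mCk k b" "\<And>x. x \<in> V \<Longrightarrow> b x = 1" and V: "open V"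
  shows "(\<lambda>x. (1 - b x) * u x) \<in> Cc_k A k (U \<inter> W)"
proof -
  obtain K where K: "mCk k u" "compact K" "K \<subseteq> U \<inter> (W \<union> V)" "\<And>x. x \<notin> K \<Longrightarrow> u x = 0"
    using u unfolding Cc_k_iff by blast
  show ?thesis unfolding Cc_k_iff
    by (intro conjI mCk_mult mCk_diff mCk_const b K exI[of _ "K - V"] compact_diff V)
       (use K b in auto)
qed

lemma local_cutoff:
  assumes "open U" "x \<in> U"
  obtains b V where "b \<in> Cc_inf A U" "\<And>x. 0 \<le> b x" "\<And>x. b x \<le> 1" "open V" "x \<in> V" "\<And>x. x \<in> V \<Longrightarrow> b x = 1"
proof -
  obtain c where c: "c \<in> A" "x \<in> cdom c" by (rule charts_cover)
  let ?a = "cmap c x"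
  obtain r l L where gb: "good_ball c ?a r l L" and sub: "cinv c ` cball ?a r \<subseteq> U"
    using good_ball_exists[OF c assms] by blast
  have r: "0 < r" "cball ?a r \<subseteq> cimg c" using gb by (auto simp: good_ball_def)
  obtain b :: "(real, 'n) vec \<Rightarrow> real" where b: "\<And>k. Ck_on k UNIV b" "\<And>x. 0 \<le> b x" "\<And>x. b x \<le> 1"
    "\<And>x. dist ?a x \<le> r / 2 \<Longrightarrow> b x = 1" "\<And>x. r \<le> dist ?a x \<Longrightarrow> b x = 0"
    using smooth_bump[of "r / 2" r ?a] r(1) by (metis half_gt_zero field_sum_of_halves less_add_same_cancel1)
  have 0: "b y = 0" if "y \<notin> cball ?a r" for y using that b(5)[of y] by auto
  let ?V = "cinv c ` ball ?a (r / 2)"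
  have sub2: "ball ?a (r / 2) \<subseteq> cimg c" using r(1) by (intro subset_trans[OF _ r(2)]) auto
  show thesis
  proof (rule that[of "push c b" ?V])
    show "push c b \<in> Cc_inf A U"
      by (rule Cc_infI[OF push_mCk[OF c(1) compact_cball r(2) 0 b(1)] compact_chart_preimage[OF c(1) compact_cball r(2)] sub])
         (assumption | rule push_outside[OF c(1) r(2) 0])+
    show "open ?V" by (rule open_chart_preimage[OF c(1) open_ball sub2])
    show "x \<in> ?V" using r(1) chart_props(5)[OF c] by (intro image_eqI[of _ _ ?a]) auto
    show "push c b z = 1" if z: "z \<in> ?V" for z
    proof -
      obtain y where y: "y \<in> ball ?a (r / 2)" "z = cinv c y" using z by blast
      then have "y \<in> cimg c" using sub2 by blast
      then show ?thesis using y b(4)[of y] chart_props(6,7)[OF c(1)] by (simp add: push_def)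
    qed
  qed (auto simp: push_def b)
qed

lemma compact_cutoff:
  assumes "compact K"
  obtains b W where "b \<in> Cc_inf A UNIV" "\<And>x. 0 \<le> b x" "\<And>x. b x \<le> 1" "open W" "K \<subseteq> W" "\<And>x. x \<in> W \<Longrightarrow> b x = 1"
proof -
  define P where "P W \<longleftrightarrow> (\<exists>b\<in>Cc_inf A UNIV. (\<forall>x. 0 \<le> b x \<and> b x \<le> 1) \<and> (\<forall>x\<in>W. b x = 1))" for W :: "'m set"
  have step: "\<exists>V. open V \<and> x \<in> V \<and> (\<forall>W. open W \<longrightarrow> P W \<longrightarrow> P (W \<union> V))" for x
  proof -
    obtain b V where b: "b \<in> Cc_inf A UNIV" "\<And>x. 0 \<le> b x" "\<And>x. b x \<le> 1" and V: "open V" "x \<in> V" "\<And>x. x \<in> V \<Longrightarrow> b x = 1"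
      using local_cutoff[of UNIV x] by blast
    have "P (W \<union> V)" if "P W" for W
    proof -
      obtain h where h: "h \<in> Cc_inf A UNIV" "\<And>x. 0 \<le> h x" "\<And>x. h x \<le> 1" "\<And>x. x \<in> W \<Longrightarrow> h x = 1"
        using \<open>P W\<close> unfolding P_def by blast
      have bk: "\<And>k. mCk k b" using b(1) Cc_inf_iff by blast
      \<comment> \<open>This is \<open>1 - (1 - b x) * (1 - h x)\<close>: it equals 1 wherever one
        of the two cutoffs does, and stays in the unit interval.\<close>
      have "(\<lambda>x. b x + (1 - b x) * h x) \<in> Cc_inf A UNIV"
        by (intro Cc_inf_add b(1) Cc_inf_mult h(1) mCk_diff mCk_const bk)
      moreover have "0 \<le> b x + (1 - b x) * h x" "b x + (1 - b x) * h x \<le> 1" for x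
        using b(2,3)[of x] h(2,3)[of x] mult_left_mono[of "h x" 1 "1 - b x"] by auto
      ultimately show ?thesis unfolding P_def using V(3) h(4) by (intro bexI[of _ "\<lambda>x. b x + (1 - b x) * h x"]) auto
    qed
    then show ?thesis using V by blast
  qed
  have "P {}" unfolding P_def
    by (intro bexI[of _ "\<lambda>_. 0"] Cc_infI[OF mCk_const compact_empty]) auto
  then obtain W where "open W" "{} \<union> K \<subseteq> W" "P W"
    using compact_absorb[OF assms step open_empty] by metis
  then show thesis unfolding P_def using that by auto
qed

lemma gn_support:
  assumes "u \<in> Cc_k A (Suc 0) U"
  obtains G L where "0 \<le> G" "compact L" "L \<subseteq> U" "\<And>x. x \<notin> L \<Longrightarrow> u x = 0" "\<And>x. gn u x \<le> G * indicator L x"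
    "\<And>x. \<bar>u x\<bar> \<le> G * indicator L x"
proof -
  obtain K where K: "mCk (Suc 0) u" "compact K" "K \<subseteq> U" "\<And>x. x \<notin> K \<Longrightarrow> u x = 0"
    using assms unfolding Cc_k_iff by blast
  have "bounded (gn u ` K)" "bounded (u ` K)"
    by (intro compact_imp_bounded compact_continuous_image K(2) continuous_on_subset[OF gn_continuous[OF K(1)]]
        continuous_on_subset[OF mCk_continuous[OF K(1)]] subset_UNIV)+
  then obtain G1 G2 where G: "\<And>x. x \<in> K \<Longrightarrow> \<bar>gn u x\<bar> \<le> G1" "\<And>x. x \<in> K \<Longrightarrow> \<bar>u x\<bar> \<le> G2"
    unfolding bounded_real by blast
  have o: "open (- K)" using K(2) by (simp add: compact_imp_closed open_Compl)
  have 0: "gn u x = 0" if "x \<notin> K" for x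
    by (rule gn_eq_0[OF K(1) o]) (use that K in auto)
  show thesis
  proof (rule that[of "max (max G1 G2) 0" K])
    show "gn u x \<le> max (max G1 G2) 0 * indicator K x" for x
      using G(1)[of x] 0[of x] by (cases "x \<in> K") (auto simp: le_max_iff_disj)
    show "\<bar>u x\<bar> \<le> max (max G1 G2) 0 * indicator K x" for x
      using G(2)[of x] K(4)[of x] by (cases "x \<in> K") (auto simp: le_max_iff_disj)
  qed (use K in auto)
qed

section \<open>Finiteness and positivity of the volume\<close>

lemma good_patch_finite_volume:
  assumes "good_ball c a r l L"
  shows "emeasure vol (cinv c ` ball a r) < \<infinity>"
proof -
  have m: "cinv c ` ball a r \<in> sets borel"
    by (rule chart_preimage_measurable) (use assms in \<open>auto simp: good_ball_def\<close>)
  have "emeasure vol (cinv c ` ball a r) = (\<integral>\<^sup>+x. indicator (cinv c ` ball a r) x * 1 \<partial>vol)"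
    using m by simp
  also have "\<dots> \<le> ennreal L * (\<integral>\<^sup>+y. indicator (ball a r) y * 1 \<partial>lborel)"
    by (rule nn_integral_good_ball(2)[OF assms]) auto
  also have "\<dots> < \<infinity>"
    using emeasure_bounded_finite[OF bounded_ball, of a r] by (simp add: ennreal_mult_less_top)
  finally show ?thesis .
qed

lemma good_patch_exists:
  assumes "open W" "x \<in> W"
  obtains c a r l L where "good_ball c a r l L" "cinv c ` cball a r \<subseteq> W" "x \<in> cinv c ` ball a r" "open (cinv c ` ball a r)"
proof -
  obtain c where c: "c \<in> A" "x \<in> cdom c" by (rule charts_cover)
  obtain r l L where gb: "good_ball c (cmap c x) r l L" and sub: "cinv c ` cball (cmap c x) r \<subseteq> W"
    using good_ball_exists[OF c assms] by blast
  have "x = cinv c (cmap c x)" "cmap c x \<in> ball (cmap c x) r"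
    using gb chart_props(5)[OF c] by (auto simp: good_ball_def)
  then have "x \<in> cinv c ` ball (cmap c x) r" by (rule image_eqI)
  moreover have "open (cinv c ` ball (cmap c x) r)"
    by (rule open_chart_preimage[OF c(1) open_ball]) (use gb ball_subset_cball in \<open>force simp: good_ball_def\<close>)
  ultimately show thesis using that gb sub by blast
qed

lemma finite_volume_nhd: obtains V where "open V" "x \<in> V" "emeasure vol V < \<infinity>"
  using good_patch_exists[of UNIV x] good_patch_finite_volume by (metis UNIV_I open_UNIV)

lemma compact_finite_volume:
  assumes "compact K"
  shows "emeasure vol K < \<infinity>"
proof -
  have step: "\<exists>V. open V \<and> x \<in> V \<and> (\<forall>W. open W \<longrightarrow> emeasure vol W < \<infinity> \<longrightarrow> emeasure vol (W \<union> V) < \<infinity>)" for x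
  proof -
    obtain V where V: "open V" "x \<in> V" "emeasure vol V < \<infinity>" by (rule finite_volume_nhd)
    have "emeasure vol (W \<union> V) < \<infinity>" if "open W" "emeasure vol W < \<infinity>" for W
    proof -
      have "emeasure vol (W \<union> V) \<le> emeasure vol W + emeasure vol V"
        by (rule emeasure_subadditive) (use that V in auto)
      also have "\<dots> < \<infinity>" using that V by (simp add: ennreal_add_less_top)
      finally show ?thesis .
    qed
    then show ?thesis using V by blast
  qed
  have "emeasure vol {} < \<infinity>" by simp
  from compact_absorb[where P = "\<lambda>W. emeasure vol W < \<infinity>", OF assms step open_empty this]
  obtain W where W: "open W" "{} \<union> K \<subseteq> W" "emeasure vol W < \<infinity>"
    by metis
  have "emeasure vol K \<le> emeasure vol W" using W by (intro emeasure_mono) auto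
  then show ?thesis using W(3) by (rule le_less_trans)
qed

text \<open>Countably many open sets of finite volume cover the space by the Lindelof property. This
  makes the inner integral in \<open>osc\<close> a measurable function of the outer
  variable.\<close>

lemma sigma_finite_vol: "sigma_finite_measure vol"
proof
  let ?\<F> = "{V. open V \<and> emeasure vol V < \<infinity>}"
  have "openin (top_of_set UNIV) S" if "S \<in> ?\<F>" for S using that by simp
  from Lindelof_openin[OF this]
  obtain \<F> where \<F>: "\<F> \<subseteq> ?\<F>" "countable \<F>" "\<Union>\<F> = \<Union>?\<F>" by blast
  have "x \<in> \<Union>?\<F>" for x using finite_volume_nhd[of x] by blast
  then have "\<Union>\<F> = UNIV" unfolding \<F>(3) by blast
  then show "\<exists>A. countable A \<and> A \<subseteq> sets vol \<and> \<Union> A = space vol \<and> (\<forall>a\<in>A. emeasure vol a \<noteq> \<infinity>)"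
  proof (intro exI[of _ \<F>] conjI ballI)
    show "\<F> \<subseteq> sets vol" using \<F>(1) by auto
    show "emeasure vol a \<noteq> \<infinity>" if "a \<in> \<F>" for a using that \<F>(1) by auto
  qed (use \<F>(2) in simp_all)
qed

lemma open_positive_volume:
  assumes "open U" "x \<in> U"
  shows "0 < emeasure vol U"
proof -
  obtain c a r l L where gb: "good_ball c a r l L" and sub: "cinv c ` cball a r \<subseteq> U"
    using good_patch_exists[OF assms] by metis
  have gb': "0 < l" "0 < r" "ball a r \<subseteq> cimg c" "c \<in> A"
    using gb ball_subset_cball[of a r] unfolding good_ball_def by auto
  have m: "cinv c ` ball a r \<in> sets borel"
    by (rule chart_preimage_measurable[OF gb'(4) _ gb'(3)]) simp
  have "0 < emeasure lborel (ball a r)"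
    using content_ball_pos[OF gb'(2), of a] emeasure_eq_measure2 by (auto simp: measure_def enn2real_positive_iff)
  then have "0 < ennreal l * (\<integral>\<^sup>+y. indicator (ball a r) y * 1 \<partial>lborel)"
    using gb'(1) by (simp add: ennreal_zero_less_mult_iff)
  also have "\<dots> \<le> (\<integral>\<^sup>+x. indicator (cinv c ` ball a r) x * 1 \<partial>vol)"
    by (rule nn_integral_good_ball(1)[OF gb]) auto
  also have "\<dots> = emeasure vol (cinv c ` ball a r)" using m by simp
  also have "\<dots> \<le> emeasure vol U"
    by (rule emeasure_mono) (use sub ball_subset_cball[of a r] assms in auto)
  finally show ?thesis .
qed

lemma nn_integral_powr_finite:
  assumes "0 \<le> p" "0 \<le> G" "compact L" "\<And>x. 0 \<le> f x" "\<And>x. f x \<le> G * indicator L x"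
    and "\<And>x. x \<notin> L \<Longrightarrow> f x powr p = 0"
  shows "(\<integral>\<^sup>+x. ennreal (f x powr p) \<partial>vol) < \<infinity>"
proof -
  have L: "L \<in> sets borel" using assms(3) by (rule borel_compact)
  have "(\<integral>\<^sup>+x. ennreal (f x powr p) \<partial>vol) \<le> (\<integral>\<^sup>+x. ennreal (G powr p) * indicator L x \<partial>vol)"
  proof (rule nn_integral_mono)
    fix x
    show "ennreal (f x powr p) \<le> ennreal (G powr p) * indicator L x"
    proof (cases "x \<in> L")
      case True
      then have "f x powr p \<le> G powr p" using assms(1,4) assms(5)[of x] by (intro powr_mono2) auto
      then show ?thesis using True by (simp add: ennreal_leI)
    qed (simp add: assms(6))
  qed
  also have "\<dots> = ennreal (G powr p) * emeasure vol L" using L by (simp add: nn_integral_cmult_indicator)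
  also have "\<dots> < \<infinity>" using compact_finite_volume[OF assms(3)] by (simp add: ennreal_mult_less_top)
  finally show ?thesis .
qed

lemma energy_finite:
  assumes "1 \<le> p" "u \<in> Cc_k A (Suc 0) U"
  shows "energy p u < \<infinity>"
proof -
  obtain G L where G: "0 \<le> G" "compact L" "\<And>x. gn u x \<le> G * indicator L x"
    using gn_support[OF assms(2)] by metis
  have u: "mCk (Suc 0) u" using assms(2) Cc_k_iff by blast
  have "gn u x = 0" if "x \<notin> L" for x using G(3)[of x] gn_nonneg[OF u, of x] that by simp
  then show ?thesis unfolding energy_def
    using assms(1) G gn_nonneg[OF u] by (intro nn_integral_powr_finite[of p G L]) auto
qed

lemma mass_finite:
  assumes "1 \<le> p" "u \<in> Cc_k A (Suc 0) U"
  shows "mass p UNIV u < \<infinity>"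
proof -
  obtain G L where G: "0 \<le> G" "compact L" "\<And>x. \<bar>u x\<bar> \<le> G * indicator L x"
    using gn_support[OF assms(2)] by metis
  have "u x = 0" if "x \<notin> L" for x using G(3)[of x] that by simp
  then have "(\<integral>\<^sup>+x. ennreal (\<bar>u x\<bar> powr p) \<partial>vol) < \<infinity>"
    using assms(1) G by (intro nn_integral_powr_finite[of p G L]) auto
  then show ?thesis by (simp add: mass_def)
qed

end

lemma ennreal_le_divideI:
  assumes "0 < c" "ennreal c * x \<le> ennreal k"
  shows "x \<le> ennreal (k / c)"
proof -
  have "x = ennreal (1 / c * c) * x" using assms(1) by simp
  also have "\<dots> = ennreal (1 / c) * (ennreal c * x)"
    using assms(1) ennreal_mult'[of "1 / c" c] by (simp only: mult.assoc less_imp_le divide_nonneg_nonneg zero_le_one)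
  also have "\<dots> \<le> ennreal (1 / c) * ennreal k" by (rule mult_left_mono[OF assms(2)]) simp
  also have "\<dots> = ennreal (k / c)" using assms(1) by (simp flip: ennreal_mult')
  finally show ?thesis .
qed

context riemannian
begin

section \<open>Comparison with Euclidean integrals on coordinate balls\<close>

lemma good_ballD:
  assumes "good_ball c a r l L"
  shows "c \<in> A" "0 < r" "0 < l" "0 < L" "cball a r \<subseteq> cimg c" "ball a r \<subseteq> cimg c"
    "cinv c ` ball a r \<subseteq> cdom c" "cinv c ` ball a r \<in> sets borel" "open (cinv c ` ball a r)"
proof -
  show *: "c \<in> A" "0 < r" "0 < l" "0 < L" "cball a r \<subseteq> cimg c" using assms by (auto simp: good_ball_def)
  then show b: "ball a r \<subseteq> cimg c" using ball_subset_cball by blast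
  then show "cinv c ` ball a r \<subseteq> cdom c" using chart_props(7)[OF *(1)] by blast
  show "cinv c ` ball a r \<in> sets borel" by (rule chart_preimage_measurable[OF *(1) _ b]) simp
  show "open (cinv c ` ball a r)" by (rule open_chart_preimage[OF *(1) open_ball b])
qed

lemma good_ball_image:
  assumes gb: "good_ball c a r l L" and K: "K \<subseteq> cinv c ` ball a r"
  shows "cmap c ` K \<subseteq> ball a r"
proof
  fix y assume "y \<in> cmap c ` K"
  then obtain z where z: "z \<in> ball a r" "y = cmap c (cinv c z)" using K by blast
  then have "z \<in> cimg c" using good_ballD(6)[OF gb] by blast
  then show "y \<in> ball a r" using z chart_props(6)[OF good_ballD(1)[OF gb]] by simp
qed

lemma good_ball_gn:
  assumes gb: "good_ball c a r l L" and u: "mCk (Suc 0) u" and y: "y \<in> ball a r"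
  shows "l * norm (pd c u y) \<le> gn u (cinv c y)" "gn u (cinv c y) \<le> L * norm (pd c u y)"
proof -
  have yc: "y \<in> cimg c" using good_ballD(6)[OF gb] y by blast
  note c = good_ballD(1)[OF gb]
  have "gn u (cinv c y) = conorm (g c (cinv c y)) (pd c u y)"
    using gn_chart[OF u c chart_props(7)[OF c yc]] by (simp only: chart_props(6)[OF c yc])
  then show "l * norm (pd c u y) \<le> gn u (cinv c y)" "gn u (cinv c y) \<le> L * norm (pd c u y)"
    using gb y ball_subset_cball[of a r] by (auto simp: good_ball_def)
qed

text \<open>The energy for the flat metric of the coordinates. It mediates between the manifold and
  Euclidean estimates, and between two patches.\<close>

definition eucl_energy :: "real \<Rightarrow> ('m, 'n) chart \<Rightarrow> (real, 'n) vec \<Rightarrow> real \<Rightarrow> ('m \<Rightarrow> real) \<Rightarrow> ennreal" where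
  "eucl_energy p c a r u = (\<integral>\<^sup>+y. indicator (ball a r) y * ennreal (norm (pd c u y) powr p) \<partial>lborel)"

lemma pd_norm_measurable:
  assumes "1 \<le> p" "good_ball c a r l L" "mCk (Suc 0) u"
  shows "(\<lambda>y. indicator (ball a r) y * ennreal (norm (pd c u y) powr p)) \<in> borel_measurable borel"
proof -
  have "continuous_on (ball a r) (\<lambda>y. norm (pd c u y) powr p)"
    by (rule continuous_on_powr'[OF continuous_on_norm[OF continuous_on_subset[OF
        pd_continuous[OF assms(3) good_ballD(1)[OF assms(2)]] good_ballD(6)[OF assms(2)]]] continuous_on_const])
       (use assms(1) in auto)
  then have "(\<lambda>y. indicator (ball a r) y *\<^sub>R (norm (pd c u y) powr p)) \<in> borel_measurable borel"
    by (intro borel_measurable_continuous_on_indicator) auto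
  then have "(\<lambda>y. ennreal (indicator (ball a r) y *\<^sub>R (norm (pd c u y) powr p))) \<in> borel_measurable borel"
    by measurable
  moreover have "(\<lambda>y. ennreal (indicator (ball a r) y *\<^sub>R (norm (pd c u y) powr p)))
      = (\<lambda>y. indicator (ball a r) y * ennreal (norm (pd c u y) powr p))"
    by (auto simp: indicator_def)
  ultimately show ?thesis by metis
qed

text \<open>One factor \<open>l\<close> comes from the volume density, \<open>l powr p\<close> from
  the gradient norm.\<close>

lemma eucl_energy_le:
  assumes p: "1 \<le> p" and gb: "good_ball c a r l L" and u: "mCk (Suc 0) u"
  shows "ennreal (l * l powr p) * eucl_energy p c a r u \<le> energy p u"
proof -
  note gD = good_ballD[OF gb]
  have "ennreal (l powr p) * eucl_energy p c a r u
    = (\<integral>\<^sup>+y. ennreal (l powr p) * (indicator (ball a r) y * ennreal (norm (pd c u y) powr p)) \<partial>lborel)"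
    unfolding eucl_energy_def using pd_norm_measurable[OF p gb u] by (intro nn_integral_cmult[symmetric]) simp
  also have "\<dots> \<le> (\<integral>\<^sup>+y. indicator (ball a r) y * ennreal (gn u (cinv c y) powr p) \<partial>lborel)"
  proof (rule nn_integral_mono)
    fix y
    show "ennreal (l powr p) * (indicator (ball a r) y * ennreal (norm (pd c u y) powr p))
        \<le> indicator (ball a r) y * ennreal (gn u (cinv c y) powr p)"
    proof (cases "y \<in> ball a r")
      case True
      have "l powr p * norm (pd c u y) powr p = (l * norm (pd c u y)) powr p" by (rule powr_mult[symmetric])
      also have "\<dots> \<le> gn u (cinv c y) powr p"
        using p gD(3) good_ball_gn(1)[OF gb u True] by (intro powr_mono2) auto
      finally show ?thesis using True by (simp add: ennreal_leI flip: ennreal_mult')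
    qed simp
  qed
  finally have "ennreal l * (ennreal (l powr p) * eucl_energy p c a r u)
      \<le> ennreal l * (\<integral>\<^sup>+y. indicator (ball a r) y * ennreal (gn u (cinv c y) powr p) \<partial>lborel)"
    by (rule mult_left_mono) simp
  also have "\<dots> \<le> (\<integral>\<^sup>+x. indicator (cinv c ` ball a r) x * ennreal (gn u x powr p) \<partial>vol)"
    by (rule nn_integral_good_ball(1)[OF gb]) (use gn_measurable[OF u] in auto)
  also have "\<dots> \<le> energy p u"
    unfolding energy_def by (intro nn_integral_mono) (auto simp: indicator_def)
  finally show ?thesis using gD(3) by (simp add: ennreal_mult' mult.assoc)
qed

lemma energy_le_eucl:
  assumes p: "1 \<le> p" and gb: "good_ball c a r l L" and u: "mCk (Suc 0) u"
    and 0: "\<And>x. x \<notin> cinv c ` ball a r \<Longrightarrow> gn u x = 0"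
  shows "energy p u \<le> ennreal (L * L powr p) * eucl_energy p c a r u"
proof -
  note gD = good_ballD[OF gb]
  have "energy p u = (\<integral>\<^sup>+x. indicator (cinv c ` ball a r) x * ennreal (gn u x powr p) \<partial>vol)"
    unfolding energy_def using 0 by (intro nn_integral_cong) (auto simp: indicator_def)
  also have "\<dots> \<le> ennreal L * (\<integral>\<^sup>+y. indicator (ball a r) y * ennreal (gn u (cinv c y) powr p) \<partial>lborel)"
    by (rule nn_integral_good_ball(2)[OF gb]) (use gn_measurable[OF u] in auto)
  also have "(\<integral>\<^sup>+y. indicator (ball a r) y * ennreal (gn u (cinv c y) powr p) \<partial>lborel)
    \<le> (\<integral>\<^sup>+y. ennreal (L powr p) * (indicator (ball a r) y * ennreal (norm (pd c u y) powr p)) \<partial>lborel)"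
  proof (rule nn_integral_mono)
    fix y
    show "indicator (ball a r) y * ennreal (gn u (cinv c y) powr p)
      \<le> ennreal (L powr p) * (indicator (ball a r) y * ennreal (norm (pd c u y) powr p))"
    proof (cases "y \<in> ball a r")
      case True
      have "gn u (cinv c y) powr p \<le> (L * norm (pd c u y)) powr p"
        using p gn_nonneg[OF u] good_ball_gn(2)[OF gb u True] by (intro powr_mono2) auto
      also have "\<dots> = L powr p * norm (pd c u y) powr p" by (rule powr_mult)
      finally show ?thesis using True by (simp add: ennreal_leI flip: ennreal_mult')
    qed simp
  qed
  also have "\<dots> = ennreal (L powr p) * eucl_energy p c a r u"
    unfolding eucl_energy_def using pd_norm_measurable[OF p gb u] by (intro nn_integral_cmult) simp
  finally show ?thesis using gD(4) by (simp add: ennreal_mult' mult.assoc mult_left_mono)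
qed

section \<open>Density of smooth functions\<close>

text \<open>Uniform smallness of values and first derivatives in coordinates turns into small
  \<open>mass\<close> and \<open>energy\<close>, because the ball has finite measure and the metric
  is bounded there.\<close>

lemma chart_approximation:
  assumes p: "1 \<le> p" and q: "1 \<le> q" and gb: "good_ball c a r l L"
    and u: "u \<in> Cc_k A (Suc 0) (cinv c ` ball a r)" and \<epsilon>: "0 < \<epsilon>"
  shows "\<exists>w\<in>Cc_inf A (cinv c ` ball a r). mass q UNIV (\<lambda>x. u x - w x) \<le> ennreal \<epsilon> \<and>
    energy p (\<lambda>x. u x - w x) \<le> ennreal \<epsilon>"
proof -
  note gD = good_ballD[OF gb]
  note c = gD(1)
  let ?B = "ball a r"
  obtain K where K: "mCk (Suc 0) u" "compact K" "K \<subseteq> cinv c ` ?B" "\<And>x. x \<notin> K \<Longrightarrow> u x = 0"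
    using u unfolding Cc_k_iff by blast
  have Kd: "K \<subseteq> cdom c" using K(3) gD(7) by blast
  have KB: "cmap c ` K \<subseteq> ?B" by (rule good_ball_image[OF gb K(3)])
  note v = pull_Ck[OF c K(2) Kd K(4,1)]
  define \<beta> where "\<beta> = measure lborel ?B"
  have \<beta>: "emeasure lborel ?B = ennreal \<beta>"
    unfolding \<beta>_def by (rule emeasure_eq_ennreal_measure) (use emeasure_bounded_finite[OF bounded_ball, of a r] in auto)
  have \<beta>0: "0 \<le> \<beta>" by (simp add: \<beta>_def)
  \<comment> \<open>\<open>Q\<close> collects the factors with which \<open>e\<close> enters both
    estimates, and the summand 1 makes it positive. As \<open>e\<close> is at most 1 and the
    exponents are at least 1, the powers of \<open>e\<close> are at most \<open>e\<close>.\<close>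
  define Q where "Q = (L + L * L powr p) * \<beta> + 1"
  have Q: "0 < Q" using gD(4) \<beta>0 by (auto simp: Q_def intro!: add_nonneg_pos)
  define e where "e = min 1 (\<epsilon> / Q)"
  have e: "0 < e" "e \<le> 1" "e * Q \<le> \<epsilon>" using \<epsilon> Q by (auto simp: e_def min_def field_simps)
  have eQ: "e * ((L + L * L powr p) * \<beta>) \<le> \<epsilon>" using e by (simp add: Q_def algebra_simps)
  have n1: "0 \<le> e * (L * \<beta>)" "0 \<le> e * (L * L powr p * \<beta>)" using e gD(4) \<beta>0 by auto
  have eb: "L * (e powr q * \<beta>) \<le> \<epsilon>" "L * L powr p * (e powr p * \<beta>) \<le> \<epsilon>"
  proof -
    have "e powr q \<le> e powr 1" "e powr p \<le> e powr 1" using e p q by (intro powr_mono'; simp)+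
    then have "e powr q \<le> e" "e powr p \<le> e" using e by auto
    then have "L * (e powr q * \<beta>) \<le> L * (e * \<beta>)" "L * L powr p * (e powr p * \<beta>) \<le> L * L powr p * (e * \<beta>)"
      using gD(4) \<beta>0 by (auto intro!: mult_left_mono mult_right_mono)
    then show "L * (e powr q * \<beta>) \<le> \<epsilon>" "L * L powr p * (e powr p * \<beta>) \<le> \<epsilon>"
      using eQ n1 by (auto simp: algebra_simps)
  qed
  obtain w0 L0 where w0: "\<And>k. Ck_on k UNIV w0" and L0: "compact L0" "L0 \<subseteq> ?B" "\<And>y. y \<notin> L0 \<Longrightarrow> w0 y = 0"
    and ap: "\<And>y. \<bar>w0 y - pull c u y\<bar> \<le> e"
    "\<And>y h. \<bar>frechet_derivative w0 (at y) h - frechet_derivative (pull c u) (at y) h\<bar> \<le> e * norm h"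
    using C1_approximation[OF v(1) compact_chart_image[OF c K(2) Kd] v(2) open_ball KB e(1)] by blast
  have L0c: "L0 \<subseteq> cimg c" using L0(2) gD(6) by blast
  define w where "w = push c w0"
  have wk: "mCk k w" for k unfolding w_def by (rule push_mCk[OF c L0(1) L0c L0(3) w0])
  have w0': "w x = 0" if "x \<notin> cinv c ` L0" for x
    unfolding w_def by (rule push_outside[OF c L0c L0(3) that])
  have cL0: "compact (cinv c ` L0)" by (rule compact_chart_preimage[OF c L0(1) L0c])
  have wC: "w \<in> Cc_inf A (cinv c ` ?B)"
    by (rule Cc_infI[OF wk cL0]) (use L0 w0' in auto)
  define d where "d x = u x - w x" for x
  have dk: "mCk (Suc 0) d" unfolding d_def[abs_def] by (intro mCk_diff K wk)
  let ?K = "K \<union> cinv c ` L0"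
  have "closed ?K" by (intro compact_imp_closed compact_Un K cL0)
  then have o: "open (- ?K)" by (rule open_Compl)
  have KU: "?K \<subseteq> cinv c ` ?B" using K(3) L0(2) by auto
  have d0: "d x = 0" if "x \<notin> ?K" for x using that K(4) w0' by (simp add: d_def)
  have gd0: "gn d x = 0" if "x \<notin> cinv c ` ?B" for x
    by (rule gn_eq_0[OF dk o]) (use that KU d0 in auto)
  have dy: "d (cinv c y) = pull c u y - w0 y" if "y \<in> cimg c" for y
    using chart_props(6,7)[OF c that] that by (simp add: d_def w_def push_def pull_def)
  have pdle: "norm (pd c d y) \<le> e" if y: "y \<in> ?B" for y
  proof -
    have yc: "y \<in> cimg c" using y gD(6) by blast
    have "((\<lambda>y. pull c u y - w0 y) has_derivative
        (\<lambda>h. frechet_derivative (pull c u) (at y) h - frechet_derivative w0 (at y) h)) (at y)"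
      by (intro has_derivative_diff Ck_on_SucD[OF v(1)] Ck_on_SucD[OF w0]) auto
    then have "((\<lambda>y. d (cinv c y)) has_derivative
        (\<lambda>h. frechet_derivative (pull c u) (at y) h - frechet_derivative w0 (at y) h)) (at y)"
      by (rule has_derivative_transform_within_open[OF _ chart_props(2)[OF c] yc]) (simp add: dy)
    from has_derivative_unique[OF pd_has_derivative[OF dk c yc] this]
    have ph: "pd c d y \<bullet> h = frechet_derivative (pull c u) (at y) h - frechet_derivative w0 (at y) h" for h
      by meson
    \<comment> \<open>The bound on directional derivatives is tested in the direction of the
      covector itself, which gives its norm.\<close>
    have "pd c d y \<bullet> pd c d y \<le> e * norm (pd c d y)"
      using ap(2)[of y "pd c d y"] unfolding ph[of "pd c d y"] by linarith
    then have "norm (pd c d y) * norm (pd c d y) \<le> e * norm (pd c d y)"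
      by (simp add: dot_square_norm power2_eq_square)
    then show ?thesis using e(1) by (cases "pd c d y = 0") auto
  qed
  have "energy p d \<le> ennreal (L * L powr p) * eucl_energy p c a r d"
    by (rule energy_le_eucl[OF p gb dk gd0])
  also have "eucl_energy p c a r d \<le> (\<integral>\<^sup>+y. ennreal (e powr p) * indicator ?B y \<partial>lborel)"
    unfolding eucl_energy_def
  proof (rule nn_integral_mono)
    fix y
    show "indicator ?B y * ennreal (norm (pd c d y) powr p) \<le> ennreal (e powr p) * indicator ?B y"
    proof (cases "y \<in> ?B")
      case True
      have "norm (pd c d y) powr p \<le> e powr p" using pdle[OF True] p by (intro powr_mono2) auto
      then show ?thesis using True by (simp add: ennreal_leI)
    qed simp
  qed
  also have "\<dots> = ennreal (e powr p * \<beta>)"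
    by (simp add: nn_integral_cmult_indicator \<beta> ennreal_mult')
  finally have "energy p d \<le> ennreal (L * L powr p) * ennreal (e powr p * \<beta>)"
    by (simp add: mult_left_mono)
  also have "\<dots> = ennreal (L * L powr p * (e powr p * \<beta>))"
    using gD(4) by (intro ennreal_mult'[symmetric]) simp
  also have "\<dots> \<le> ennreal \<epsilon>" by (rule ennreal_leI[OF eb(2)])
  finally have E: "energy p d \<le> ennreal \<epsilon>" .
  have "mass q UNIV d = (\<integral>\<^sup>+x. indicator (cinv c ` ?B) x * ennreal (\<bar>d x\<bar> powr q) \<partial>vol)"
    unfolding mass_def
  proof (rule nn_integral_cong)
    fix x show "indicator UNIV x * ennreal (\<bar>d x\<bar> powr q) = indicator (cinv c ` ?B) x * ennreal (\<bar>d x\<bar> powr q)"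
    proof (cases "x \<in> cinv c ` ?B")
      case False
      then have "d x = 0" using KU d0 by blast
      then show ?thesis by simp
    qed simp
  qed
  also have "\<dots> \<le> ennreal L * (\<integral>\<^sup>+y. indicator ?B y * ennreal (\<bar>d (cinv c y)\<bar> powr q) \<partial>lborel)"
    by (rule nn_integral_good_ball(2)[OF gb]) (use mCk_measurable[OF dk] in auto)
  also have "(\<integral>\<^sup>+y. indicator ?B y * ennreal (\<bar>d (cinv c y)\<bar> powr q) \<partial>lborel) \<le> (\<integral>\<^sup>+y. ennreal (e powr q) * indicator ?B y \<partial>lborel)"
  proof (rule nn_integral_mono)
    fix y
    show "indicator ?B y * ennreal (\<bar>d (cinv c y)\<bar> powr q) \<le> ennreal (e powr q) * indicator ?B y"
    proof (cases "y \<in> ?B")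
      case True
      then have "\<bar>d (cinv c y)\<bar> \<le> e" using dy[of y] ap(1)[of y] gD(6) by auto
      then have "\<bar>d (cinv c y)\<bar> powr q \<le> e powr q" using q by (intro powr_mono2) auto
      then show ?thesis using True by (simp add: ennreal_leI)
    qed simp
  qed
  also have "\<dots> = ennreal (e powr q * \<beta>)"
    by (simp add: nn_integral_cmult_indicator \<beta> ennreal_mult')
  finally have "mass q UNIV d \<le> ennreal L * ennreal (e powr q * \<beta>)"
    by (simp add: mult_left_mono)
  also have "\<dots> = ennreal (L * (e powr q * \<beta>))"
    using gD(4) by (intro ennreal_mult'[symmetric]) simp
  also have "\<dots> \<le> ennreal \<epsilon>" by (rule ennreal_leI[OF eb(1)])
  finally have "mass q UNIV d \<le> ennreal \<epsilon>" .
  then show ?thesis using E wC unfolding d_def[abs_def] by blast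
qed

text \<open>Patches are annexed one at a time: \<open>b * u\<close> is approximated in the patch,
  and \<open>(1 - b) * u\<close> is supported where approximation is already known. \<open>P\<close>
  quantifies over all functions and all errors so that the induction applies to these
  products.\<close>

lemma C1_density:
  assumes p: "1 \<le> p" and q: "1 \<le> q" and U: "open U" and u: "u \<in> Cc_k A (Suc 0) U" and \<epsilon>: "0 < \<epsilon>"
  shows "\<exists>w\<in>Cc_inf A U. mass q UNIV (\<lambda>x. u x - w x) \<le> ennreal \<epsilon> \<and> energy p (\<lambda>x. u x - w x) \<le> ennreal \<epsilon>"
proof -
  define P where "P W \<longleftrightarrow> (\<forall>\<epsilon>>0. \<forall>u\<in>Cc_k A (Suc 0) (U \<inter> W). \<exists>w\<in>Cc_inf A U.
     mass q UNIV (\<lambda>x. u x - w x) \<le> ennreal \<epsilon> \<and> energy p (\<lambda>x. u x - w x) \<le> ennreal \<epsilon>)" for W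
  obtain K where K: "mCk (Suc 0) u" "compact K" "K \<subseteq> U" "\<And>x. x \<notin> K \<Longrightarrow> u x = 0"
    using u unfolding Cc_k_iff by blast
  have step: "\<exists>V. open V \<and> x \<in> V \<and> (\<forall>W. open W \<longrightarrow> P W \<longrightarrow> P (W \<union> V))" if "x \<in> K" for x
  proof -
    have "x \<in> U" using \<open>x \<in> K\<close> K(3) by blast
    then obtain c a r l L where gb: "good_ball c a r l L" "cinv c ` cball a r \<subseteq> U" "x \<in> cinv c ` ball a r" "open (cinv c ` ball a r)"
      using good_patch_exists[OF U] by metis
    obtain b V where b: "b \<in> Cc_inf A (cinv c ` ball a r)" "open V" "x \<in> V" "\<And>x. x \<in> V \<Longrightarrow> b x = 1"
      using local_cutoff[OF gb(4,3)] by metis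
    have bk: "mCk k b" for k using b(1) Cc_inf_iff by blast
    have subU: "cinv c ` ball a r \<subseteq> U" using gb(2) ball_subset_cball[of a r] by blast
    have "P (W \<union> V)" if W: "P W" for W
      unfolding P_def
    proof (intro allI impI ballI)
      fix \<epsilon> :: real and u assume \<epsilon>: "0 < \<epsilon>" and u: "u \<in> Cc_k A (Suc 0) (U \<inter> (W \<union> V))"
      \<comment> \<open>\<open>2 powr q\<close> and \<open>4 powr p\<close> are the constants of
        \<open>mass_add_le\<close> and \<open>energy_add_le\<close>; the 2 is for the two
        summands.\<close>
      define e where "e = \<epsilon> / (2 * max (2 powr q) (4 powr p))"
      have e: "0 < e" "2 powr q * (e + e) \<le> \<epsilon>" "4 powr p * (e + e) \<le> \<epsilon>"
        using \<epsilon> by (auto simp: e_def field_simps max_def)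
      have uk: "mCk (Suc 0) u" using u Cc_k_iff by blast
      have "(\<lambda>x. b x * u x) \<in> Cc_k A (Suc 0) (cinv c ` ball a r)"
        by (rule Cc_k_mult_cutoff[OF u Cc_inf_imp_Cc_k[OF b(1)]])
      from chart_approximation[OF p q gb(1) this e(1)]
      obtain w1 where w1: "w1 \<in> Cc_inf A (cinv c ` ball a r)" "mass q UNIV (\<lambda>x. b x * u x - w1 x) \<le> ennreal e"
        "energy p (\<lambda>x. b x * u x - w1 x) \<le> ennreal e" by blast
      have "(\<lambda>x. (1 - b x) * u x) \<in> Cc_k A (Suc 0) (U \<inter> W)"
        by (rule Cc_k_mult_compl[OF u bk b(4) b(2)])
      from W[unfolded P_def, rule_format, OF e(1) this]
      obtain w2 where w2: "w2 \<in> Cc_inf A U" "mass q UNIV (\<lambda>x. (1 - b x) * u x - w2 x) \<le> ennreal e"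
        "energy p (\<lambda>x. (1 - b x) * u x - w2 x) \<le> ennreal e" by blast
      have wk: "mCk (Suc 0) w1" "mCk (Suc 0) w2" using w1(1) w2(1) Cc_inf_iff by blast+
      have d1: "mCk (Suc 0) (\<lambda>x. b x * u x - w1 x)" by (intro mCk_diff mCk_mult bk uk wk)
      have d2: "mCk (Suc 0) (\<lambda>x. (1 - b x) * u x - w2 x)" by (intro mCk_diff mCk_mult mCk_const bk uk wk)
      have eq: "(\<lambda>x. u x - (w1 x + w2 x)) = (\<lambda>x. (b x * u x - w1 x) + ((1 - b x) * u x - w2 x))"
        by (auto simp: algebra_simps)
      have "mass q UNIV (\<lambda>x. u x - (w1 x + w2 x)) \<le> ennreal (2 powr q) *
          (mass q UNIV (\<lambda>x. b x * u x - w1 x) + mass q UNIV (\<lambda>x. (1 - b x) * u x - w2 x))"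
        unfolding eq by (rule mass_add_le[OF _ mCk_measurable[OF d1] mCk_measurable[OF d2]]) (use q in simp_all)
      also have "\<dots> \<le> ennreal (2 powr q) * (ennreal e + ennreal e)"
        by (intro mult_left_mono add_mono w1(2) w2(2)) simp
      also have "\<dots> = ennreal (2 powr q * (e + e))" using e(1) by (simp flip: ennreal_mult' ennreal_plus)
      also have "\<dots> \<le> ennreal \<epsilon>" by (rule ennreal_leI[OF e(2)])
      finally have 1: "mass q UNIV (\<lambda>x. u x - (w1 x + w2 x)) \<le> ennreal \<epsilon>" .
      have "energy p (\<lambda>x. u x - (w1 x + w2 x)) \<le> ennreal (4 powr p) *
          (energy p (\<lambda>x. b x * u x - w1 x) + energy p (\<lambda>x. (1 - b x) * u x - w2 x))"
        unfolding eq by (rule energy_add_le[OF _ d1 d2]) (use p in simp)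
      also have "\<dots> \<le> ennreal (4 powr p) * (ennreal e + ennreal e)"
        by (intro mult_left_mono add_mono w1(3) w2(3)) simp
      also have "\<dots> = ennreal (4 powr p * (e + e))" using e(1) by (simp flip: ennreal_mult' ennreal_plus)
      also have "\<dots> \<le> ennreal \<epsilon>" by (rule ennreal_leI[OF e(3)])
      finally have 2: "energy p (\<lambda>x. u x - (w1 x + w2 x)) \<le> ennreal \<epsilon>" .
      show "\<exists>w\<in>Cc_inf A U. mass q UNIV (\<lambda>x. u x - w x) \<le> ennreal \<epsilon> \<and> energy p (\<lambda>x. u x - w x) \<le> ennreal \<epsilon>"
        by (rule bexI[of _ "\<lambda>x. w1 x + w2 x"], intro conjI 1 2)
           (rule Cc_inf_add[OF Cc_inf_mono[OF w1(1) subU] w2(1)])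
    qed
    then show ?thesis using b by blast
  qed
  have "P {}"
    unfolding P_def
  proof (intro allI impI ballI)
    fix \<epsilon> :: real and u assume "0 < \<epsilon>" "u \<in> Cc_k A (Suc 0) (U \<inter> {})"
    then have "u = (\<lambda>x. 0)" unfolding Cc_k_iff by auto
    moreover have "(\<lambda>x. 0) \<in> Cc_inf A U" by (rule Cc_infI[OF mCk_const compact_empty]) auto
    ultimately show "\<exists>w\<in>Cc_inf A U. mass q UNIV (\<lambda>x. u x - w x) \<le> ennreal \<epsilon> \<and> energy p (\<lambda>x. u x - w x) \<le> ennreal \<epsilon>"
      using p q by (intro bexI[of _ "\<lambda>x. 0"]) (simp_all add: mass_def energy_def gn_const)
  qed
  from compact_absorb[where P = P, OF K(2) step open_empty this]
  obtain W where W: "K \<subseteq> W" "P W" by (metis Un_subset_iff)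
  have "u \<in> Cc_k A (Suc 0) (U \<inter> W)" unfolding Cc_k_iff using K W by blast
  from W(2)[unfolded P_def, rule_format, OF \<epsilon> this] show ?thesis .
qed

section \<open>Sobolev bounds\<close>

text \<open>By homogeneity this is equivalent to the Sobolev inequality, and it needs no bookkeeping of exponents
  when a function is split by a cutoff.\<close>

definition sobolev_bound :: "real \<Rightarrow> real \<Rightarrow> 'm set \<Rightarrow> bool" where
  "sobolev_bound p q U \<longleftrightarrow> (\<forall>k. \<exists>C. \<forall>u\<in>Cc_inf A U. energy p u \<le> ennreal k \<longrightarrow> mass q UNIV u \<le> ennreal C)"

text \<open>Only boundedness is claimed, so a smooth \<open>w\<close> with error 1 is close enough:
  \<open>w = u - (u - w)\<close> has bounded energy, hence bounded mass, and then so has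
  \<open>u = (u - w) + w\<close>.\<close>

lemma sobolev_bound_C1:
  assumes p: "1 \<le> p" and q: "1 \<le> q" and U: "open U" and s: "sobolev_bound p q U"
  shows "\<exists>C. \<forall>u\<in>Cc_k A (Suc 0) U. energy p u \<le> ennreal k \<longrightarrow> mass q UNIV u \<le> ennreal C"
proof -
  let ?k = "4 powr p * (1 + max k 0)"
  obtain C where C: "\<And>u. u \<in> Cc_inf A U \<Longrightarrow> energy p u \<le> ennreal ?k \<Longrightarrow> mass q UNIV u \<le> ennreal C"
    using s unfolding sobolev_bound_def by blast
  show ?thesis
  proof (intro exI[of _ "2 powr q * (1 + max C 0)"] ballI impI)
    fix u assume u: "u \<in> Cc_k A (Suc 0) U" and Eu: "energy p u \<le> ennreal k"
    obtain w where w: "w \<in> Cc_inf A U" "mass q UNIV (\<lambda>x. u x - w x) \<le> ennreal 1" "energy p (\<lambda>x. u x - w x) \<le> ennreal 1"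
      using C1_density[OF p q U u, of 1] by auto
    have uk: "mCk (Suc 0) u" using u Cc_k_iff by blast
    have wk: "mCk (Suc 0) w" using w(1) Cc_inf_iff by blast
    have d: "mCk (Suc 0) (\<lambda>x. u x - w x)" by (intro mCk_diff uk wk)
    have dm: "mCk (Suc 0) (\<lambda>x. -1 * (u x - w x))" by (rule mCk_cmult[OF d])
    have Ed: "energy p (\<lambda>x. -1 * (u x - w x)) \<le> ennreal 1" unfolding energy_cmult[OF d] using w(3) by simp
    have "ennreal k \<le> ennreal (max k 0)" by (intro ennreal_leI) simp
    then have Eu': "energy p u \<le> ennreal (max k 0)" using Eu by (rule order_trans[rotated])
    have "energy p (\<lambda>x. -1 * (u x - w x) + u x) \<le> ennreal (4 powr p) * (energy p (\<lambda>x. -1 * (u x - w x)) + energy p u)"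
      by (rule energy_add_le[OF _ dm uk]) (use p in simp)
    also have "\<dots> \<le> ennreal (4 powr p) * (ennreal 1 + ennreal (max k 0))"
      by (intro mult_left_mono add_mono Ed Eu') simp
    also have "\<dots> = ennreal ?k" by (simp flip: ennreal_mult' ennreal_plus del: ennreal_1)
    finally have "energy p w \<le> ennreal ?k" by simp
    then have "mass q UNIV w \<le> ennreal C" by (rule C[OF w(1)])
    also have "\<dots> \<le> ennreal (max C 0)" by (intro ennreal_leI) simp
    finally have Mw: "mass q UNIV w \<le> ennreal (max C 0)" .
    have "mass q UNIV (\<lambda>x. (u x - w x) + w x) \<le> ennreal (2 powr q) * (mass q UNIV (\<lambda>x. u x - w x) + mass q UNIV w)"
      by (rule mass_add_le[OF _ mCk_measurable[OF d] mCk_measurable[OF wk]]) (use q in simp_all)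
    also have "\<dots> \<le> ennreal (2 powr q) * (ennreal 1 + ennreal (max C 0))"
      by (intro mult_left_mono add_mono w(2) Mw) simp
    also have "\<dots> = ennreal (2 powr q * (1 + max C 0))" by (simp flip: ennreal_mult' ennreal_plus del: ennreal_1)
    finally show "mass q UNIV u \<le> ennreal (2 powr q * (1 + max C 0))" by simp
  qed
qed

text \<open>A Sobolev bound on one coordinate ball is carried to any other point: both metrics are
  comparable to the Euclidean one, and Euclidean balls of equal radius are translates of each other.\<close>

lemma sobolev_bound_transfer:
  assumes p: "1 \<le> p" and q: "1 \<le> q" and U: "open U" "x1 \<in> U" and s: "sobolev_bound p q U"
  obtains V where "open V" "x \<in> V" "sobolev_bound p q V"
proof -
  obtain c1 a1 r1 l1 L1 where gb1': "good_ball c1 a1 r1 l1 L1" and sub1: "cinv c1 ` cball a1 r1 \<subseteq> U"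
    using good_patch_exists[OF U] by metis
  obtain c where c: "c \<in> A" "x \<in> cdom c" by (rule charts_cover)
  obtain r l L where gb': "good_ball c (cmap c x) r l L"
    using good_ball_exists[OF c open_UNIV UNIV_I] by metis
  define a where "a = cmap c x"
  \<comment> \<open>A common radius, so that the two coordinate balls are translates of each
    other.\<close>
  define \<sigma> where "\<sigma> = min r r1"
  have \<sigma>: "0 < \<sigma>" "\<sigma> \<le> r" "\<sigma> \<le> r1" using good_ballD(2)[OF gb'] good_ballD(2)[OF gb1'] by (auto simp: \<sigma>_def)
  have gb: "good_ball c a \<sigma> l L" unfolding a_def by (rule good_ball_shrink[OF gb' \<sigma>(1,2)])
  have gb1: "good_ball c1 a1 \<sigma> l1 L1" by (rule good_ball_shrink[OF gb1' \<sigma>(1,3)])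
  note D = good_ballD[OF gb] and D1 = good_ballD[OF gb1]
  let ?B = "ball a \<sigma>" and ?B1 = "ball a1 \<sigma>"
  have sub: "cinv c1 ` ?B1 \<subseteq> U"
    using sub1 \<sigma>(3) subset_cball[of \<sigma> r1 a1] ball_subset_cball[of a1 \<sigma>] by blast
  define t where "t = a - a1"
  have tB: "t + y \<in> ?B \<longleftrightarrow> y \<in> ?B1" for y by (simp add: t_def dist_norm algebra_simps)
  have xV: "x \<in> cinv c ` ?B"
    using \<sigma>(1) chart_props(5)[OF c] by (intro image_eqI[of _ _ a]) (auto simp: a_def)
  have "sobolev_bound p q (cinv c ` ?B)"
    unfolding sobolev_bound_def
  proof
    fix k
    \<comment> \<open>Energy at most \<open>k\<close> near \<open>x\<close> means Euclidean energy
      at most \<open>k / (l * l powr p)\<close>, hence energy at most \<open>?k\<close> after the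
      transplant. On the way back the mass is divided by \<open>l1\<close> and multiplied by
      \<open>L\<close>.\<close>
    let ?k = "L1 * L1 powr p * (k / (l * l powr p))"
    obtain C where C: "\<And>w. w \<in> Cc_inf A U \<Longrightarrow> energy p w \<le> ennreal ?k \<Longrightarrow> mass q UNIV w \<le> ennreal C"
      using s unfolding sobolev_bound_def by blast
    show "\<exists>C. \<forall>u\<in>Cc_inf A (cinv c ` ?B). energy p u \<le> ennreal k \<longrightarrow> mass q UNIV u \<le> ennreal C"
    proof (intro exI[of _ "L * (C / l1)"] ballI impI)
      fix u assume u: "u \<in> Cc_inf A (cinv c ` ?B)" and Eu: "energy p u \<le> ennreal k"
      obtain K where K: "\<And>k. mCk k u" "compact K" "K \<subseteq> cinv c ` ?B" "\<And>x. x \<notin> K \<Longrightarrow> u x = 0"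
        using u unfolding Cc_inf_iff by blast
      have Kd: "K \<subseteq> cdom c" using K(3) D(7) by blast
      have KB: "cmap c ` K \<subseteq> ?B" by (rule good_ball_image[OF gb K(3)])
      define v where "v = pull c u"
      have vk: "Ck_on k UNIV v" and v0: "\<And>y. y \<notin> cmap c ` K \<Longrightarrow> v y = 0" for k
        unfolding v_def using pull_Ck[OF c(1) K(2) Kd K(4,1)] by blast+
      define v1 where "v1 y = v (t + y)" for y
      have v1k: "Ck_on k UNIV v1" for k
        unfolding v1_def[abs_def]
        by (rule Ck_on_compose[OF open_UNIV open_UNIV subset_UNIV _ vk]) (intro Ck_on_add Ck_on_const Ck_on_ident open_UNIV)
      define L' where "L' = (\<lambda>z. z - t) ` (cmap c ` K)"
      have L': "compact L'" unfolding L'_def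
        by (intro compact_continuous_image compact_chart_image[OF c(1) K(2) Kd] continuous_intros)
      have v10: "v1 y = 0" if "y \<notin> L'" for y
      proof -
        have "t + y \<notin> cmap c ` K" using that unfolding L'_def by (metis add_diff_cancel_left' imageI)
        then show ?thesis unfolding v1_def by (rule v0)
      qed
      have L'B: "L' \<subseteq> ?B1"
      proof
        fix y assume "y \<in> L'"
        then have "t + y \<in> cmap c ` K" by (auto simp: L'_def)
        then show "y \<in> ?B1" using KB tB by blast
      qed
      have L'c: "L' \<subseteq> cimg c1" using L'B D1(6) by blast
      \<comment> \<open>The transplant of \<open>u\<close>: read in the chart \<open>c\<close>,
        translated by \<open>t\<close>, and placed in the chart \<open>c1\<close>, where its support
        lies in \<open>U\<close>.\<close>
      define w where "w = push c1 v1"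
      have wk: "mCk k w" for k unfolding w_def by (rule push_mCk[OF D1(1) L' L'c v10 v1k])
      have w0: "w x = 0" if "x \<notin> cinv c1 ` L'" for x
        unfolding w_def by (rule push_outside[OF D1(1) L'c v10 that])
      have cL': "compact (cinv c1 ` L')" by (rule compact_chart_preimage[OF D1(1) L' L'c])
      have LB: "cinv c1 ` L' \<subseteq> cinv c1 ` ?B1" using L'B by blast
      have wC: "w \<in> Cc_inf A U"
        by (rule Cc_infI[OF wk cL' _ w0]) (use LB sub in auto)
      have o: "open (- (cinv c1 ` L'))" using compact_imp_closed[OF cL'] by (simp add: open_Compl)
      have gw0: "gn w z = 0" if "z \<notin> cinv c1 ` ?B1" for z
        by (rule gn_eq_0[OF wk o]) (use that LB w0 in auto)
      have wy: "w (cinv c1 y) = u (cinv c (t + y))" if y: "y \<in> ?B1" for y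
      proof -
        have yc: "y \<in> cimg c1" "t + y \<in> cimg c" using y D1(6) D(6) tB by blast+
        then show ?thesis using chart_props(6,7)[OF D1(1) yc(1)] by (simp add: w_def push_def v1_def v_def pull_def)
      qed
      have pdw: "pd c1 w y = pd c u (t + y)" if y: "y \<in> ?B1" for y
      proof (rule pd_eqI)
        have tyc: "t + y \<in> cimg c" using y D(6) tB by blast
        have "((\<lambda>y. t + y) has_derivative (\<lambda>h. h)) (at y)" by (auto intro!: derivative_eq_intros)
        from has_derivative_compose[OF this pd_has_derivative[OF K(1) c(1) tyc]]
        have "((\<lambda>y. u (cinv c (t + y))) has_derivative (\<lambda>h. pd c u (t + y) \<bullet> h)) (at y)" .
        then show "((\<lambda>y. w (cinv c1 y)) has_derivative (\<lambda>h. pd c u (t + y) \<bullet> h)) (at y)"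
          by (rule has_derivative_transform_within_open[OF _ open_ball y]) (simp add: wy)
      qed
      \<comment> \<open>The factor \<open>1\<close> brings the integrands into the form of
        \<open>nn_integral_lborel_affine\<close> with scale 1.\<close>
      have ind: "indicator ?B1 y = (indicator ?B (t + 1 *\<^sub>R y) :: ennreal)" for y
        using tB[of y] by (simp only: indicator_def scaleR_one)
      have "eucl_energy p c1 a1 \<sigma> w = (\<integral>\<^sup>+y. indicator ?B (t + 1 *\<^sub>R y) * ennreal (norm (pd c u (t + 1 *\<^sub>R y)) powr p) \<partial>lborel)"
        unfolding eucl_energy_def
      proof (rule nn_integral_cong)
        fix y show "indicator ?B1 y * ennreal (norm (pd c1 w y) powr p)
          = indicator ?B (t + 1 *\<^sub>R y) * ennreal (norm (pd c u (t + 1 *\<^sub>R y)) powr p)"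
        proof (cases "y \<in> ?B1")
          case True
          then show ?thesis unfolding ind[symmetric] by (simp only: pdw[OF True] scaleR_one)
        next
          case False
          then show ?thesis unfolding ind[symmetric] by (simp only: indicator_simps mult_zero_left not_False_eq_True)
        qed
      qed
      also have "\<dots> = eucl_energy p c a \<sigma> u"
        unfolding eucl_energy_def
        by (subst nn_integral_lborel_affine[OF pd_norm_measurable[OF p gb K(1)], of 1 t]) auto
      finally have ee: "eucl_energy p c1 a1 \<sigma> w = eucl_energy p c a \<sigma> u" .
      have "ennreal (l * l powr p) * eucl_energy p c a \<sigma> u \<le> ennreal k"
        by (rule order_trans[OF eucl_energy_le[OF p gb K(1)] Eu])
      then have "eucl_energy p c a \<sigma> u \<le> ennreal (k / (l * l powr p))"
        by (rule ennreal_le_divideI[rotated]) (use D(3) in simp)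
      then have "ennreal (L1 * L1 powr p) * eucl_energy p c1 a1 \<sigma> w \<le> ennreal (L1 * L1 powr p) * ennreal (k / (l * l powr p))"
        unfolding ee by (rule mult_left_mono) simp
      also have "\<dots> = ennreal ?k" using D1(4) by (intro ennreal_mult'[symmetric]) simp
      finally have "ennreal (L1 * L1 powr p) * eucl_energy p c1 a1 \<sigma> w \<le> ennreal ?k" .
      with energy_le_eucl[OF p gb1 wk gw0] have "energy p w \<le> ennreal ?k" by (rule order_trans)
      then have Mw: "mass q UNIV w \<le> ennreal C" by (rule C[OF wC])
      let ?I = "\<integral>\<^sup>+y. indicator ?B y * ennreal (\<bar>v y\<bar> powr q) \<partial>lborel"
      have vm: "v \<in> borel_measurable borel"
        by (rule borel_measurable_continuous_onI[OF Ck_on_imp_continuous_on[OF vk]])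
      have uv: "u (cinv c y) = v y" if "y \<in> ?B" for y
      proof -
        have "y \<in> cimg c" using D(6) that by blast
        then show ?thesis by (simp add: v_def pull_def)
      qed
      have "ennreal l1 * (\<integral>\<^sup>+y. indicator ?B1 y * ennreal (\<bar>w (cinv c1 y)\<bar> powr q) \<partial>lborel)
          \<le> (\<integral>\<^sup>+z. indicator (cinv c1 ` ?B1) z * ennreal (\<bar>w z\<bar> powr q) \<partial>vol)"
        by (rule nn_integral_good_ball(1)[OF gb1]) (use mCk_measurable[OF wk] in auto)
      also have "\<dots> \<le> mass q UNIV w" unfolding mass_def by (intro nn_integral_mono) (auto simp: indicator_def)
      finally have "ennreal l1 * (\<integral>\<^sup>+y. indicator ?B1 y * ennreal (\<bar>w (cinv c1 y)\<bar> powr q) \<partial>lborel) \<le> ennreal C"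
        using Mw by (rule order_trans)
      moreover have "(\<integral>\<^sup>+y. indicator ?B1 y * ennreal (\<bar>w (cinv c1 y)\<bar> powr q) \<partial>lborel)
          = (\<integral>\<^sup>+y. indicator ?B (t + 1 *\<^sub>R y) * ennreal (\<bar>v (t + 1 *\<^sub>R y)\<bar> powr q) \<partial>lborel)"
      proof (rule nn_integral_cong)
        fix y show "indicator ?B1 y * ennreal (\<bar>w (cinv c1 y)\<bar> powr q)
          = indicator ?B (t + 1 *\<^sub>R y) * ennreal (\<bar>v (t + 1 *\<^sub>R y)\<bar> powr q)"
        proof (cases "y \<in> ?B1")
          case True
          then have "t + y \<in> ?B" using tB by blast
          then show ?thesis using True wy[OF True] uv[OF \<open>t + y \<in> ?B\<close>] by simp
        next
          case False
          then show ?thesis unfolding ind[symmetric] by (simp only: indicator_simps mult_zero_left not_False_eq_True)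
        qed
      qed
      moreover have "\<dots> = ?I"
      proof -
        note [measurable] = vm borel_open[OF open_ball]
        have "(\<lambda>y. indicator ?B y * ennreal (\<bar>v y\<bar> powr q)) \<in> borel_measurable borel" by measurable
        from nn_integral_lborel_affine[OF this, of 1 t] show ?thesis by simp
      qed
      ultimately have "ennreal l1 * ?I \<le> ennreal C" by simp
      then have I: "?I \<le> ennreal (C / l1)" by (rule ennreal_le_divideI[OF D1(3)])
      have "mass q UNIV u = (\<integral>\<^sup>+z. indicator (cinv c ` ?B) z * ennreal (\<bar>u z\<bar> powr q) \<partial>vol)"
        unfolding mass_def
      proof (rule nn_integral_cong)
        fix z show "indicator UNIV z * ennreal (\<bar>u z\<bar> powr q) = indicator (cinv c ` ?B) z * ennreal (\<bar>u z\<bar> powr q)"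
        proof (cases "z \<in> cinv c ` ?B")
          case False
          then have "u z = 0" using K(3,4) by blast
          then show ?thesis by simp
        qed simp
      qed
      also have "\<dots> \<le> ennreal L * (\<integral>\<^sup>+y. indicator ?B y * ennreal (\<bar>u (cinv c y)\<bar> powr q) \<partial>lborel)"
        by (rule nn_integral_good_ball(2)[OF gb]) (use mCk_measurable[OF K(1)] in auto)
      also have "(\<integral>\<^sup>+y. indicator ?B y * ennreal (\<bar>u (cinv c y)\<bar> powr q) \<partial>lborel) = ?I"
        by (intro nn_integral_cong) (auto simp: indicator_def uv simp del: mem_ball)
      also have "ennreal L * ?I \<le> ennreal L * ennreal (C / l1)" by (rule mult_left_mono[OF I]) simp
      also have "\<dots> = ennreal (L * (C / l1))" using D(4) by (intro ennreal_mult'[symmetric]) simp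
      finally show "mass q UNIV u \<le> ennreal (L * (C / l1))" .
    qed
  qed
  then show thesis using that[OF D(9) xV] by blast
qed

section \<open>A Poincare inequality on compact sets\<close>

definition osc :: "real \<Rightarrow> 'm set \<Rightarrow> 'm set \<Rightarrow> ('m \<Rightarrow> real) \<Rightarrow> ennreal" where
  "osc p K L u = (\<integral>\<^sup>+x. indicator K x * (\<integral>\<^sup>+y. indicator L y * ennreal (\<bar>u x - u y\<bar> powr p) \<partial>vol) \<partial>vol)"

lemma osc_inner_measurable:
  assumes [measurable]: "u \<in> borel_measurable borel" "L \<in> sets borel"
  shows "(\<lambda>x. \<integral>\<^sup>+y. indicator L y * ennreal (\<bar>u x - u y\<bar> powr p) \<partial>vol) \<in> borel_measurable borel"
proof -
  interpret V: sigma_finite_measure vol by (rule sigma_finite_vol)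
  show ?thesis by measurable
qed

lemma osc_mono: "K \<subseteq> K' \<Longrightarrow> L \<subseteq> L' \<Longrightarrow> osc p K L u \<le> osc p K' L' u"
  unfolding osc_def by (intro nn_integral_mono mult_mono) (auto simp: indicator_def)

lemma osc_Un_le:
  assumes u: "u \<in> borel_measurable borel" and m: "K \<in> sets borel" "L \<in> sets borel" "L' \<in> sets borel"
  shows "osc p K (L \<union> L') u \<le> osc p K L u + osc p K L' u"
proof -
  note [measurable] = osc_inner_measurable[OF u m(2)] osc_inner_measurable[OF u m(3)] u m
  have "osc p K (L \<union> L') u \<le> (\<integral>\<^sup>+x. indicator K x * (\<integral>\<^sup>+y. indicator L y * ennreal (\<bar>u x - u y\<bar> powr p) \<partial>vol)
      + indicator K x * (\<integral>\<^sup>+y. indicator L' y * ennreal (\<bar>u x - u y\<bar> powr p) \<partial>vol) \<partial>vol)"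
    unfolding osc_def
  proof (rule nn_integral_mono)
    fix x
    have "(\<integral>\<^sup>+y. indicator (L \<union> L') y * ennreal (\<bar>u x - u y\<bar> powr p) \<partial>vol)
      \<le> (\<integral>\<^sup>+y. indicator L y * ennreal (\<bar>u x - u y\<bar> powr p) + indicator L' y * ennreal (\<bar>u x - u y\<bar> powr p) \<partial>vol)"
      by (intro nn_integral_mono) (auto simp: indicator_def)
    also have "\<dots> = (\<integral>\<^sup>+y. indicator L y * ennreal (\<bar>u x - u y\<bar> powr p) \<partial>vol)
        + (\<integral>\<^sup>+y. indicator L' y * ennreal (\<bar>u x - u y\<bar> powr p) \<partial>vol)"
      by (rule nn_integral_add) measurable
    finally show "indicator K x * (\<integral>\<^sup>+y. indicator (L \<union> L') y * ennreal (\<bar>u x - u y\<bar> powr p) \<partial>vol)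
      \<le> indicator K x * (\<integral>\<^sup>+y. indicator L y * ennreal (\<bar>u x - u y\<bar> powr p) \<partial>vol)
      + indicator K x * (\<integral>\<^sup>+y. indicator L' y * ennreal (\<bar>u x - u y\<bar> powr p) \<partial>vol)"
      by (simp add: distrib_left[symmetric] mult_left_mono)
  qed
  also have "\<dots> = osc p K L u + osc p K L' u"
    unfolding osc_def by (rule nn_integral_add) measurable
  finally show ?thesis .
qed

text \<open>Insert \<open>z\<close> into the difference and integrate over \<open>z\<close> in
  \<open>Z\<close>. Each resulting term involves two of the three variables, and the missing one
  contributes a volume.\<close>

lemma osc_triangle:
  assumes p: "1 \<le> p" and u: "u \<in> borel_measurable borel"
    and m: "K \<in> sets borel" "Z \<in> sets borel" "L \<in> sets borel"
  shows "emeasure vol Z * osc p K L u \<le> ennreal (2 powr p) * (emeasure vol L * osc p K Z u + emeasure vol K * osc p Z L u)"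
proof -
  note [measurable] = osc_inner_measurable[OF u m(2)] osc_inner_measurable[OF u m(3)] u m
  define I where "I S x = (\<integral>\<^sup>+y. indicator S y * ennreal (\<bar>u x - u y\<bar> powr p) \<partial>vol)" for S x
  have Im[measurable]: "I Z \<in> borel_measurable borel" "I L \<in> borel_measurable borel"
    unfolding I_def[abs_def] by measurable
  have pt: "emeasure vol Z * I L x \<le> ennreal (2 powr p) * (emeasure vol L * I Z x + osc p Z L u)" for x
  proof -
    have z: "I L x \<le> ennreal (2 powr p) * (ennreal (\<bar>u x - u z\<bar> powr p) * emeasure vol L + I L z)" for z
    proof -
      have "I L x \<le> (\<integral>\<^sup>+y. ennreal (2 powr p) * (ennreal (\<bar>u x - u z\<bar> powr p) * indicator L y + indicator L y * ennreal (\<bar>u z - u y\<bar> powr p)) \<partial>vol)"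
        unfolding I_def
      proof (rule nn_integral_mono)
        fix y
        have "\<bar>u x - u y\<bar> powr p \<le> (\<bar>u x - u z\<bar> + \<bar>u z - u y\<bar>) powr p" using p by (intro powr_mono2) auto
        also have "\<dots> \<le> 2 powr p * (\<bar>u x - u z\<bar> powr p + \<bar>u z - u y\<bar> powr p)" using p by (intro add_powr_le) auto
        finally have "ennreal (\<bar>u x - u y\<bar> powr p) \<le> ennreal (2 powr p) * (ennreal (\<bar>u x - u z\<bar> powr p) + ennreal (\<bar>u z - u y\<bar> powr p))"
          by (simp add: ennreal_leI flip: ennreal_mult' ennreal_plus)
        then show "indicator L y * ennreal (\<bar>u x - u y\<bar> powr p)
          \<le> ennreal (2 powr p) * (ennreal (\<bar>u x - u z\<bar> powr p) * indicator L y + indicator L y * ennreal (\<bar>u z - u y\<bar> powr p))"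
          by (cases "y \<in> L") simp_all
      qed
      also have "\<dots> = ennreal (2 powr p) * (ennreal (\<bar>u x - u z\<bar> powr p) * emeasure vol L + I L z)"
        unfolding I_def
        by (subst nn_integral_cmult, measurable, subst nn_integral_add, measurable) (simp add: nn_integral_cmult_indicator)
      finally show ?thesis .
    qed
    have "emeasure vol Z * I L x = (\<integral>\<^sup>+z. I L x * indicator Z z \<partial>vol)"
      by (simp add: nn_integral_cmult_indicator mult.commute)
    also have "\<dots> \<le> (\<integral>\<^sup>+z. ennreal (2 powr p) * (emeasure vol L * (indicator Z z * ennreal (\<bar>u x - u z\<bar> powr p)) + indicator Z z * I L z) \<partial>vol)"
    proof (rule nn_integral_mono)
      show "I L x * indicator Z z \<le> ennreal (2 powr p) * (emeasure vol L * (indicator Z z * ennreal (\<bar>u x - u z\<bar> powr p)) + indicator Z z * I L z)" for z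
        using z[of z] by (cases "z \<in> Z") (simp_all add: mult.commute)
    qed
    also have "\<dots> = ennreal (2 powr p) * (emeasure vol L * I Z x + osc p Z L u)"
      by (subst nn_integral_cmult, measurable, subst nn_integral_add, measurable, subst nn_integral_cmult, measurable)
         (simp add: I_def osc_def)
    finally show ?thesis .
  qed
  have "emeasure vol Z * osc p K L u = (\<integral>\<^sup>+x. indicator K x * (emeasure vol Z * I L x) \<partial>vol)"
    unfolding osc_def I_def[symmetric] by (subst nn_integral_cmult[symmetric], measurable) (simp add: mult_ac)
  also have "\<dots> \<le> (\<integral>\<^sup>+x. ennreal (2 powr p) * (emeasure vol L * (indicator K x * I Z x) + osc p Z L u * indicator K x) \<partial>vol)"
  proof (rule nn_integral_mono)
    show "indicator K x * (emeasure vol Z * I L x)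
      \<le> ennreal (2 powr p) * (emeasure vol L * (indicator K x * I Z x) + osc p Z L u * indicator K x)" for x
      using pt[of x] by (cases "x \<in> K") simp_all
  qed
  also have "\<dots> = ennreal (2 powr p) * (emeasure vol L * osc p K Z u + emeasure vol K * osc p Z L u)"
  proof -
    have e1: "(\<integral>\<^sup>+x. indicator K x * I Z x \<partial>vol) = osc p K Z u" by (simp add: I_def osc_def)
    have e2: "(\<integral>\<^sup>+x. osc p Z L u * indicator K x \<partial>vol) = osc p Z L u * emeasure vol K"
      by (rule nn_integral_cmult_indicator) (use m in simp)
    show ?thesis
      by (subst nn_integral_cmult, measurable, subst nn_integral_add, measurable, subst nn_integral_cmult, measurable)
         (simp only: e1 e2, simp only: mult.commute)
  qed
  finally show ?thesis .
qed

text \<open>Two-point integrals replace mean values: they satisfy a triangle inequality through any set of positive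
  measure, so local estimates chain along the connected manifold.\<close>

definition osc_bounded :: "real \<Rightarrow> 'm set \<Rightarrow> 'm set \<Rightarrow> bool" where
  "osc_bounded p K L \<longleftrightarrow> (\<exists>C\<ge>0. \<forall>u. mCk (Suc 0) u \<longrightarrow> osc p K L u \<le> ennreal C * energy p u)"

lemma osc_bounded_subset: "osc_bounded p K L \<Longrightarrow> K' \<subseteq> K \<Longrightarrow> L' \<subseteq> L \<Longrightarrow> osc_bounded p K' L'"
  unfolding osc_bounded_def using osc_mono[of K' K L' L p] by (meson order_trans)

lemma osc_bounded_Un:
  assumes "osc_bounded p K L" "osc_bounded p K L'" "K \<in> sets borel" "L \<in> sets borel" "L' \<in> sets borel"
  shows "osc_bounded p K (L \<union> L')"
proof -
  obtain C C' where C: "0 \<le> C" "\<And>u. mCk (Suc 0) u \<Longrightarrow> osc p K L u \<le> ennreal C * energy p u"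
    and C': "0 \<le> C'" "\<And>u. mCk (Suc 0) u \<Longrightarrow> osc p K L' u \<le> ennreal C' * energy p u"
    using assms(1,2) unfolding osc_bounded_def by blast
  have "osc p K (L \<union> L') u \<le> ennreal (C + C') * energy p u" if u: "mCk (Suc 0) u" for u
  proof -
    have "osc p K (L \<union> L') u \<le> osc p K L u + osc p K L' u"
      by (rule osc_Un_le[OF mCk_measurable[OF u] assms(3-5)])
    also have "\<dots> \<le> ennreal C * energy p u + ennreal C' * energy p u" by (intro add_mono C C' u)
    also have "\<dots> = ennreal (C + C') * energy p u" using C(1) C'(1) by (simp add: distrib_right)
    finally show ?thesis .
  qed
  then show ?thesis unfolding osc_bounded_def using C(1) C'(1) by (intro exI[of _ "C + C'"]) auto
qed

text \<open>\<open>osc_triangle\<close> divided by the volume of \<open>Z\<close>, which is why that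
  volume has to be positive; the volumes of \<open>K\<close> and \<open>L\<close> enter the
  constant.\<close>

lemma osc_bounded_trans:
  assumes p: "1 \<le> p" and "osc_bounded p K Z" "osc_bounded p Z L"
    and m: "K \<in> sets borel" "Z \<in> sets borel" "L \<in> sets borel"
    and fin: "emeasure vol K < \<infinity>" "emeasure vol Z < \<infinity>" "emeasure vol L < \<infinity>" and pos: "0 < emeasure vol Z"
  shows "osc_bounded p K L"
proof -
  obtain C C' where C: "0 \<le> C" "\<And>u. mCk (Suc 0) u \<Longrightarrow> osc p K Z u \<le> ennreal C * energy p u"
    and C': "0 \<le> C'" "\<And>u. mCk (Suc 0) u \<Longrightarrow> osc p Z L u \<le> ennreal C' * energy p u"
    using assms(2,3) unfolding osc_bounded_def by blast
  obtain k z l where k: "emeasure vol K = ennreal k" "0 \<le> k" and z: "emeasure vol Z = ennreal z" "0 \<le> z"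
    and l: "emeasure vol L = ennreal l" "0 \<le> l"
    using fin by (metis ennreal_cases infinity_ennreal_def less_irrefl)
  have z0: "0 < z" using pos z by simp
  let ?C = "2 powr p * (l * C + k * C')"
  have C0: "0 \<le> ?C" using C(1) C'(1) k l by simp
  have "osc p K L u \<le> ennreal (?C / z) * energy p u" if u: "mCk (Suc 0) u" for u
  proof -
    have "ennreal z * osc p K L u \<le> ennreal (2 powr p) * (ennreal l * osc p K Z u + ennreal k * osc p Z L u)"
      using osc_triangle[OF p mCk_measurable[OF u] m] k z l by simp
    also have "\<dots> \<le> ennreal (2 powr p) * (ennreal l * (ennreal C * energy p u) + ennreal k * (ennreal C' * energy p u))"
      by (intro mult_left_mono add_mono C C' u) auto
    also have "\<dots> = ennreal ?C * energy p u"
      using C(1) C'(1) k l by (simp add: ennreal_mult ennreal_plus distrib_right distrib_left mult_ac)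
    finally have "ennreal (1 / z) * (ennreal z * osc p K L u) \<le> ennreal (1 / z) * (ennreal ?C * energy p u)"
      by (rule mult_left_mono) simp
    moreover have "ennreal (1 / z) * (ennreal z * osc p K L u) = osc p K L u"
      using z0 by (simp add: mult.assoc[symmetric] flip: ennreal_mult')
    moreover have "ennreal (1 / z) * (ennreal ?C * energy p u) = ennreal (?C / z) * energy p u"
      using z0 C0 by (simp add: mult.assoc[symmetric] flip: ennreal_mult')
    ultimately show ?thesis by simp
  qed
  moreover have "0 \<le> ?C / z" using C0 z0 by simp
  ultimately show ?thesis unfolding osc_bounded_def by blast
qed

lemma osc_bounded_patch:
  assumes p: "1 \<le> p" and gb: "good_ball c a r l L"
  shows "osc_bounded p (cinv c ` ball a r) (cinv c ` ball a r)"
proof -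
  note D = good_ballD[OF gb]
  let ?B = "ball a r" and ?V = "cinv c ` ball a r"
  obtain C where C: "0 \<le> C"
    "\<And>v v'. (\<forall>y\<in>?B. (v has_derivative blinfun_apply (v' y)) (at y)) \<Longrightarrow> continuous_on ?B v' \<Longrightarrow>
      (\<integral>\<^sup>+x. indicator ?B x * (\<integral>\<^sup>+y. indicator ?B y * ennreal (\<bar>v x - v y\<bar> powr p) \<partial>lborel) \<partial>lborel)
      \<le> ennreal C * (\<integral>\<^sup>+x. indicator ?B x * ennreal (norm (v' x) powr p) \<partial>lborel)"
    using poincare_ball[OF p D(2), of a] by blast
  \<comment> \<open>\<open>L\<close> appears once for each of the two integrations passed from the
    volume to Lebesgue measure, \<open>C\<close> is the Euclidean constant, and the divisor is that
    of \<open>eucl_energy_le\<close>.\<close>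
  let ?K = "L * (L * (C / (l * l powr p)))"
  have "osc p ?V ?V u \<le> ennreal ?K * energy p u" if u: "mCk (Suc 0) u" for u
  proof -
    note um = mCk_measurable[OF u]
    note [measurable] = borel_open[OF open_ball[of a r]]
    \<comment> \<open>\<open>einv\<close> in place of \<open>cinv\<close> makes \<open>v\<close>
      Borel on the whole space; on the ball the two agree.\<close>
    define v where "v y = u (einv c y)" for y
    have vm[measurable]: "v \<in> borel_measurable borel"
      unfolding v_def[abs_def] by (rule measurable_compose[OF einv_measurable[OF D(1)] um])
    have veq: "v y = u (cinv c y)" if "y \<in> ?B" for y
      using that D(6) by (auto simp: v_def einv_def)
    define v' where "v' y = blinfun_inner_right (pd c u y)" for y
    have "\<forall>y\<in>?B. (v has_derivative blinfun_apply (v' y)) (at y)"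
    proof
      fix y assume y: "y \<in> ?B"
      have yc: "y \<in> cimg c" using D(6) y by blast
      have "(v has_derivative (\<lambda>h. pd c u y \<bullet> h)) (at y)"
        by (rule has_derivative_transform_within_open[OF pd_has_derivative[OF u D(1) yc] open_ball y]) (simp add: veq)
      then show "(v has_derivative blinfun_apply (v' y)) (at y)" by (simp add: v'_def blinfun_inner_right.rep_eq)
    qed
    moreover have "continuous_on ?B v'"
      unfolding v'_def[abs_def]
      by (rule bounded_linear.continuous_on[OF bounded_linear_blinfun_inner_right
            continuous_on_subset[OF pd_continuous[OF u D(1)] D(6)]])
    ultimately have P: "(\<integral>\<^sup>+x. indicator ?B x * (\<integral>\<^sup>+y. indicator ?B y * ennreal (\<bar>v x - v y\<bar> powr p) \<partial>lborel) \<partial>lborel)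
      \<le> ennreal C * (\<integral>\<^sup>+x. indicator ?B x * ennreal (norm (v' x) powr p) \<partial>lborel)"
      by (rule C(2))
    have nv: "norm (v' x) \<le> norm (pd c u x)" for x
      unfolding v'_def by (rule norm_blinfun_bound) (auto simp: blinfun_inner_right.rep_eq Cauchy_Schwarz_ineq2)
    have "(\<integral>\<^sup>+x. indicator ?B x * ennreal (norm (v' x) powr p) \<partial>lborel) \<le> eucl_energy p c a r u"
      unfolding eucl_energy_def using p nv by (intro nn_integral_mono mult_left_mono ennreal_leI powr_mono2) auto
    moreover have "eucl_energy p c a r u \<le> ennreal (1 / (l * l powr p)) * energy p u"
    proof -
      have ll: "0 < l * l powr p" using D(3) by simp
      have "ennreal (1 / (l * l powr p)) * (ennreal (l * l powr p) * eucl_energy p c a r u) \<le> ennreal (1 / (l * l powr p)) * energy p u"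
        by (rule mult_left_mono[OF eucl_energy_le[OF p gb u]]) simp
      moreover have "ennreal (1 / (l * l powr p)) * (ennreal (l * l powr p) * eucl_energy p c a r u) = ennreal (1 / (l * l powr p) * (l * l powr p)) * eucl_energy p c a r u"
        using ll by (simp only: mult.assoc ennreal_mult'[of "1 / (l * l powr p)" "l * l powr p"] less_imp_le divide_nonneg_nonneg zero_le_one)
      ultimately show ?thesis using ll D(3) by simp
    qed
    ultimately have Iv: "(\<integral>\<^sup>+x. indicator ?B x * ennreal (norm (v' x) powr p) \<partial>lborel) \<le> ennreal (1 / (l * l powr p)) * energy p u"
      by (rule order_trans)
    have inner: "(\<integral>\<^sup>+z. indicator ?V z * ennreal (\<bar>u (cinv c x) - u z\<bar> powr p) \<partial>vol)
      \<le> ennreal L * (\<integral>\<^sup>+y. indicator ?B y * ennreal (\<bar>v x - v y\<bar> powr p) \<partial>lborel)" if x: "x \<in> ?B" for x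
    proof -
      have "(\<integral>\<^sup>+z. indicator ?V z * ennreal (\<bar>u (cinv c x) - u z\<bar> powr p) \<partial>vol)
        \<le> ennreal L * (\<integral>\<^sup>+y. indicator ?B y * ennreal (\<bar>u (cinv c x) - u (cinv c y)\<bar> powr p) \<partial>lborel)"
        by (rule nn_integral_good_ball(2)[OF gb]) (use um in auto)
      also have "(\<integral>\<^sup>+y. indicator ?B y * ennreal (\<bar>u (cinv c x) - u (cinv c y)\<bar> powr p) \<partial>lborel)
        = (\<integral>\<^sup>+y. indicator ?B y * ennreal (\<bar>v x - v y\<bar> powr p) \<partial>lborel)"
        using veq[OF x] by (intro nn_integral_cong) (auto simp: veq indicator_def simp del: mem_ball)
      finally show ?thesis .
    qed
    have "osc p ?V ?V u \<le> ennreal L * (\<integral>\<^sup>+x. indicator ?B x * (\<integral>\<^sup>+z. indicator ?V z * ennreal (\<bar>u (cinv c x) - u z\<bar> powr p) \<partial>vol) \<partial>lborel)"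
      unfolding osc_def
      by (rule nn_integral_good_ball(2)[OF gb _ _ osc_inner_measurable[OF um D(8)]]) auto
    also have "(\<integral>\<^sup>+x. indicator ?B x * (\<integral>\<^sup>+z. indicator ?V z * ennreal (\<bar>u (cinv c x) - u z\<bar> powr p) \<partial>vol) \<partial>lborel)
      \<le> (\<integral>\<^sup>+x. ennreal L * (indicator ?B x * (\<integral>\<^sup>+y. indicator ?B y * ennreal (\<bar>v x - v y\<bar> powr p) \<partial>lborel)) \<partial>lborel)"
      using inner by (intro nn_integral_mono) (auto simp: indicator_def simp del: mem_ball)
    also have "\<dots> = ennreal L * (\<integral>\<^sup>+x. indicator ?B x * (\<integral>\<^sup>+y. indicator ?B y * ennreal (\<bar>v x - v y\<bar> powr p) \<partial>lborel) \<partial>lborel)"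
      by (rule nn_integral_cmult) measurable
    also have "\<dots> \<le> ennreal L * (ennreal C * (ennreal (1 / (l * l powr p)) * energy p u))"
      by (rule mult_left_mono[OF order_trans[OF P mult_left_mono[OF Iv]]]) auto
    finally have "osc p ?V ?V u \<le> ennreal L * (ennreal L * (ennreal C * (ennreal (1 / (l * l powr p)) * energy p u)))"
      by (simp add: mult_left_mono)
    also have "\<dots> = ennreal ?K * energy p u"
    proof -
      have "ennreal ?K = ennreal (L * (L * (C * (1 / (l * l powr p)))))" by simp
      also have "\<dots> = ennreal L * (ennreal L * (ennreal C * ennreal (1 / (l * l powr p))))"
        using D(3,4) C(1) by (simp only: ennreal_mult' less_imp_le)
      finally show ?thesis by (simp only: mult.assoc)
    qed
    finally show ?thesis .
  qed
  moreover have "0 \<le> ?K" using C(1) D(3,4) by simp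
  ultimately show ?thesis unfolding osc_bounded_def by blast
qed

lemma osc_bounded_nhd:
  assumes p: "1 \<le> p"
  obtains V where "open V" "x \<in> V" "emeasure vol V < \<infinity>" "osc_bounded p V V"
proof -
  obtain c a r l L where gb: "good_ball c a r l L" "x \<in> cinv c ` ball a r" "open (cinv c ` ball a r)"
    using good_patch_exists[OF open_UNIV UNIV_I] by metis
  show thesis
    by (rule that[OF gb(3,2) good_patch_finite_volume[OF gb(1)] osc_bounded_patch[OF p gb(1)]])
qed

text \<open>The points with a neighbourhood controlled from \<open>U\<close> form an open set. So
  does the complement: a patch \<open>V\<close> meeting that set would overlap a controlled
  neighbourhood in a nonempty open set, of positive volume, through which the bound reaches all of
  \<open>V\<close>.\<close>

lemma osc_bounded_everywhere:
  assumes p: "1 \<le> p" and conn: "connected (UNIV :: 'm set)"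
    and U: "open U" "x0 \<in> U" "emeasure vol U < \<infinity>" "osc_bounded p U U"
  shows "\<exists>V. open V \<and> x \<in> V \<and> osc_bounded p U V"
proof -
  define S where "S = {x. \<exists>V. open V \<and> x \<in> V \<and> osc_bounded p U V}"
  have "open S"
    unfolding open_subopen[of S] by (auto simp: S_def)
  moreover have "open (- S)"
    unfolding open_subopen[of "- S"]
  proof
    fix y assume y: "y \<in> - S"
    obtain V where V: "open V" "y \<in> V" "emeasure vol V < \<infinity>" "osc_bounded p V V"
      by (rule osc_bounded_nhd[OF p])
    have "V \<subseteq> - S"
    proof (rule ccontr)
      assume "\<not> V \<subseteq> - S"
      then obtain z where "z \<in> V" "z \<in> S" by blast
      then obtain W where W: "open W" "z \<in> W" "osc_bounded p U W" unfolding S_def by blast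
      have o: "open (V \<inter> W)" using V W by blast
      have "emeasure vol (V \<inter> W) \<le> emeasure vol V" using V(1) by (intro emeasure_mono) auto
      then have fin: "emeasure vol (V \<inter> W) < \<infinity>" using V(3) by (rule le_less_trans)
      have "osc_bounded p U V"
      proof (rule osc_bounded_trans[OF p])
        show "osc_bounded p U (V \<inter> W)" by (rule osc_bounded_subset[OF W(3)]) auto
        show "osc_bounded p (V \<inter> W) V" by (rule osc_bounded_subset[OF V(4)]) auto
        show "0 < emeasure vol (V \<inter> W)" by (rule open_positive_volume[OF o, of z]) (use \<open>z \<in> V\<close> W in blast)
      qed (use U V o fin in auto)
      then have "y \<in> S" unfolding S_def using V by blast
      then show False using y by blast
    qed
    then show "\<exists>T. open T \<and> y \<in> T \<and> T \<subseteq> - S" using V by blast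
  qed
  moreover have "x0 \<in> S" unfolding S_def using U by blast
  ultimately have "S = UNIV"
    using connectedD[OF conn, of S "- S"] by auto
  then have "x \<in> S" by simp
  then show ?thesis unfolding S_def by (rule CollectD)
qed

text \<open>The constant \<open>c\<close> is a value \<open>u z\<close> with \<open>z\<close> in
  \<open>U\<close>. If all of these failed, integrating the failures over \<open>U\<close> would
  exceed the bound on \<open>osc p U K u\<close>.\<close>

lemma poincare_compact:
  assumes p: "1 \<le> p" and conn: "connected (UNIV :: 'm set)" and K: "compact K"
  shows "\<exists>B\<ge>0. \<forall>u. mCk (Suc 0) u \<longrightarrow> energy p u \<le> ennreal k \<longrightarrow> (\<exists>c. mass p K (\<lambda>x. u x - c) \<le> ennreal B)"
proof -
  obtain U x0 where U: "open U" "x0 \<in> U" "emeasure vol U < \<infinity>" "osc_bounded p U U"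
    using osc_bounded_nhd[OF p] by metis
  have step: "\<exists>V. open V \<and> x \<in> V \<and> (\<forall>W. open W \<longrightarrow> osc_bounded p U W \<longrightarrow> osc_bounded p U (W \<union> V))" for x
  proof -
    obtain V where V: "open V" "x \<in> V" "osc_bounded p U V"
      using osc_bounded_everywhere[OF p conn U] by blast
    have "osc_bounded p U (W \<union> V)" if "open W" "osc_bounded p U W" for W
      by (rule osc_bounded_Un) (use that V U in auto)
    then show ?thesis using V by blast
  qed
  from compact_absorb[where P = "osc_bounded p U", OF K step U(1,4)]
  obtain W where W: "U \<union> K \<subseteq> W" "osc_bounded p U W" by metis
  have "osc_bounded p U K" by (rule osc_bounded_subset[OF W(2)]) (use W in auto)
  then obtain C where C: "0 \<le> C" "\<And>u. mCk (Suc 0) u \<Longrightarrow> osc p U K u \<le> ennreal C * energy p u"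
    unfolding osc_bounded_def by blast
  obtain m where m: "emeasure vol U = ennreal m" "0 \<le> m"
    using U(3) by (metis ennreal_cases infinity_ennreal_def less_irrefl)
  have m0: "0 < m" using open_positive_volume[OF U(1,2)] m by simp
  \<comment> \<open>The summand 1 leaves a surplus \<open>m\<close>, the volume of \<open>U\<close>,
    which makes the contradiction strict.\<close>
  let ?B = "C * max k 0 / m + 1"
  show ?thesis
  proof (rule exI[of _ ?B], intro conjI allI impI)
    show "0 \<le> ?B" using C(1) m0 by simp
    fix u assume u: "mCk (Suc 0) u" and E: "energy p u \<le> ennreal k"
    show "\<exists>c. mass p K (\<lambda>x. u x - c) \<le> ennreal ?B"
    proof (rule ccontr)
      assume "\<not> ?thesis"
      then have gt: "ennreal ?B < mass p K (\<lambda>x. u x - c)" for c by (simp add: not_le)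
      have "ennreal (C * max k 0 + m) = ennreal (?B * m)" using m0 by (simp add: distrib_right)
      also have "\<dots> = ennreal ?B * emeasure vol U" unfolding m(1) using m(2) by (rule ennreal_mult'')
      also have "\<dots> = (\<integral>\<^sup>+z. ennreal ?B * indicator U z \<partial>vol)"
        using U(1) by (simp add: nn_integral_cmult_indicator)
      also have "\<dots> \<le> osc p U K u"
        unfolding osc_def
      proof (rule nn_integral_mono)
        fix z
        have "mass p K (\<lambda>x. u x - u z) = (\<integral>\<^sup>+y. indicator K y * ennreal (\<bar>u z - u y\<bar> powr p) \<partial>vol)"
          unfolding mass_def by (simp add: abs_minus_commute)
        then show "ennreal ?B * indicator U z \<le> indicator U z * (\<integral>\<^sup>+y. indicator K y * ennreal (\<bar>u z - u y\<bar> powr p) \<partial>vol)"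
          using gt[of "u z"] by (cases "z \<in> U") (simp_all add: less_imp_le)
      qed
      also have "\<dots> \<le> ennreal C * ennreal k" by (rule order_trans[OF C(2)[OF u] mult_left_mono[OF E]]) simp
      also have "\<dots> \<le> ennreal C * ennreal (max k 0)" by (intro mult_left_mono ennreal_leI) auto
      also have "\<dots> = ennreal (C * max k 0)" using C(1) by (simp add: ennreal_mult')
      finally have "C * max k 0 + m \<le> C * max k 0" using C(1) by (simp add: ennreal_le_iff)
      then show False using m0 by simp
    qed
  qed
qed

text \<open>Coordinate balls lie in compact sets and countably many of them cover the space.
  \<open>L\<close> is put into every term because the volume bound in the hyperbolicity proof is for
  compact sets containing a fixed one.\<close>

lemma compact_exhaustion:
  assumes "compact L"
  obtains K :: "nat \<Rightarrow> 'm set" where "\<And>n. compact (K n)" "\<And>n. L \<subseteq> K n" "incseq K" "(\<Union>n. K n) = UNIV"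
proof -
  define \<G> :: "'m set set" where "\<G> = {V. open V \<and> (\<exists>K. compact K \<and> V \<subseteq> K)}"
  have "openin (top_of_set UNIV) S" if "S \<in> \<G>" for S using that by (simp add: \<G>_def)
  from Lindelof_openin[OF this]
  obtain \<F> where \<F>: "\<F> \<subseteq> \<G>" "countable \<F>" "\<Union>\<F> = \<Union>\<G>" by blast
  have "x \<in> \<Union>\<G>" for x
  proof -
    obtain c a r l M where gb: "good_ball c a r l M" and x: "x \<in> cinv c ` ball a r"
      using good_patch_exists[OF open_UNIV UNIV_I] by metis
    have "compact (cinv c ` cball a r)"
      by (rule compact_chart_preimage[OF good_ballD(1)[OF gb] compact_cball good_ballD(5)[OF gb]])
    moreover have "cinv c ` ball a r \<subseteq> cinv c ` cball a r" using ball_subset_cball by blast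
    ultimately have "cinv c ` ball a r \<in> \<G>" unfolding \<G>_def using good_ballD(9)[OF gb] by blast
    then show ?thesis using x by (rule UnionI)
  qed
  then have U: "\<Union>\<F> = UNIV" unfolding \<F>(3) by blast
  then have ne: "\<F> \<noteq> {}" by auto
  define V where "V = from_nat_into \<F>"
  have "V n \<in> \<G>" for n using from_nat_into[OF ne, of n] \<F>(1) unfolding V_def by blast
  then have "\<exists>K. compact K \<and> V n \<subseteq> K" for n unfolding \<G>_def by blast
  then obtain H where H: "\<And>n. compact (H n)" "\<And>n. V n \<subseteq> H n" by metis
  have UV: "(\<Union>n. V n) = UNIV" using U range_from_nat_into[OF ne \<F>(2)] by (simp add: V_def)
  show thesis
  proof (rule that[of "\<lambda>n. L \<union> (\<Union>i\<le>n. H i)"])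
    show "compact (L \<union> (\<Union>i\<le>n. H i))" for n
      by (intro compact_Un assms compact_UN) (auto simp: H)
    show "incseq (\<lambda>n. L \<union> (\<Union>i\<le>n. H i))"
    proof (rule incseq_SucI)
      show "L \<union> (\<Union>i\<le>n. H i) \<subseteq> L \<union> (\<Union>i\<le>Suc n. H i)" for n
        by (rule Un_mono[OF subset_refl UN_mono]) auto
    qed
    have "x \<in> (\<Union>n. L \<union> (\<Union>i\<le>n. H i))" for x
    proof -
      have "x \<in> (\<Union>n. V n)" unfolding UV by (rule UNIV_I)
      then obtain i where "x \<in> V i" by blast
      then have "x \<in> L \<union> (\<Union>j\<le>i. H j)" using H(2)[of i] by blast
      then show ?thesis by (rule UN_I[OF UNIV_I])
    qed
    then show "(\<Union>n. L \<union> (\<Union>i\<le>n. H i)) = UNIV" by (rule UNIV_eq_I[symmetric])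
  qed auto
qed

section \<open>Hyperbolicity\<close>

lemma hyperbolic_if_sobolev_outside:
  assumes p: "1 \<le> p" and q: "1 \<le> q" and F: "compact F" and inf: "emeasure vol UNIV = \<infinity>"
    and s: "sobolev_bound p q (UNIV - F)"
  shows "p_hyperbolic A g p"
proof (rule ccontr)
  assume nh: "\<not> p_hyperbolic A g p"
  have oF: "open (UNIV - F)" using compact_imp_closed[OF F] by (simp add: open_Diff)
  obtain \<zeta> W where \<zeta>: "\<zeta> \<in> Cc_inf A UNIV" "\<And>x. 0 \<le> \<zeta> x" "\<And>x. \<zeta> x \<le> 1" "open W" "F \<subseteq> W" "\<And>x. x \<in> W \<Longrightarrow> \<zeta> x = 1"
    by (rule compact_cutoff[OF F], rule that)
  have \<zeta>C: "\<zeta> \<in> Cc_k A (Suc 0) UNIV" by (rule Cc_inf_imp_Cc_k[OF \<zeta>(1)])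
  then obtain L where \<zeta>k: "mCk (Suc 0) \<zeta>" and L: "compact L" "\<And>x. x \<notin> L \<Longrightarrow> \<zeta> x = 0"
    unfolding Cc_k_iff by blast
  obtain e where e: "energy p \<zeta> = ennreal e" "0 \<le> e"
    using energy_finite[OF p \<zeta>C] by (metis ennreal_cases infinity_ennreal_def less_irrefl)
  obtain D B where D: "\<And>t. (smooth_step has_real_derivative D t) (at t)" and B: "\<And>t. \<bar>D t\<bar> \<le> B" "0 < B"
    using smooth_step_deriv by metis
  \<comment> \<open>\<open>B powr p\<close> will bound the energy of the truncated competitor,
    \<open>e\<close> is that of the cutoff, and \<open>4 powr p\<close> is the constant of
    \<open>energy_add_le\<close>. None of them depends on the compact set \<open>K\<close>
    below.\<close>
  let ?k = "4 powr p * (B powr p + e)"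
  obtain C where C: "\<And>w. w \<in> Cc_k A (Suc 0) (UNIV - F) \<Longrightarrow> energy p w \<le> ennreal ?k \<Longrightarrow> mass q UNIV w \<le> ennreal C"
    using sobolev_bound_C1[OF p q oF s] by blast
  have bound: "emeasure vol (K - L) \<le> ennreal C" if K: "compact K" "L \<subseteq> K" for K
  proof -
    have "capacity A g p K = 0" using nh K unfolding p_hyperbolic_def by (meson not_gr_zero)
    then have "capacity A g p K < 1" by simp
    then obtain \<phi> where \<phi>: "\<phi> \<in> Cc_k A (Suc 0) UNIV" "\<And>x. x \<in> K \<Longrightarrow> 1 \<le> \<phi> x" "energy p \<phi> < 1"
      unfolding capacity_def INF_less_iff energy_def by auto
    obtain H where H: "mCk (Suc 0) \<phi>" "compact H" "\<And>x. x \<notin> H \<Longrightarrow> \<phi> x = 0"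
      using \<phi>(1) unfolding Cc_k_iff by blast
    \<comment> \<open>\<open>\<phi>\<close> is only at least 1 on \<open>K\<close>. The step makes
      it exactly 1 there and keeps the support compact, since it sends 0 to 0.\<close>
    define h where "h x = smooth_step (\<phi> x)" for x
    have hk: "mCk (Suc 0) h" unfolding h_def[abs_def] by (rule mCk_compose[OF H(1) Ck_on_smooth_step])
    have hK: "h x = 1" if "x \<in> K" for x unfolding h_def by (rule smooth_step_ge_1[OF \<phi>(2)[OF that]])
    have h0: "h x = 0" if "x \<notin> H" for x unfolding h_def by (rule smooth_step_le_0) (simp add: H(3)[OF that])
    have m: "mCk (Suc 0) (\<lambda>x. -1 * \<zeta> x)" by (rule mCk_cmult[OF \<zeta>k])
    define w where "w x = h x + -1 * \<zeta> x" for x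
    have wk: "mCk (Suc 0) w" unfolding w_def[abs_def] by (rule mCk_add[OF hk m])
    have "w x = 0" if "x \<in> W" for x
    proof -
      \<comment> \<open>The cutoff is 1 on \<open>W\<close> and 0 off \<open>L\<close>, so
        \<open>W\<close> lies in \<open>L\<close> and hence in \<open>K\<close>, where
        \<open>h\<close> is 1 as well.\<close>
      have "x \<in> L" using \<zeta>(6)[OF that] L(2) by fastforce
      then show ?thesis using hK K \<zeta>(6)[OF that] by (auto simp: w_def)
    qed
    then have w0: "w x = 0" if "x \<notin> (H \<union> L) - W" for x
      using that h0 L(2) by (auto simp: w_def)
    have "compact (H \<union> L - W)" by (rule compact_diff[OF compact_Un[OF H(2) L(1)] \<zeta>(4)])
    moreover have "H \<union> L - W \<subseteq> UNIV - F" using \<zeta>(5) by blast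
    ultimately have wC: "w \<in> Cc_k A (Suc 0) (UNIV - F)" unfolding Cc_k_iff using wk w0 by blast
    have "energy p h \<le> energy p (\<lambda>x. B * \<phi> x)"
      unfolding energy_def
    proof (intro nn_integral_mono ennreal_leI powr_mono2)
      fix x
      have "gn h x = \<bar>D (\<phi> x)\<bar> * gn \<phi> x" unfolding h_def[abs_def] by (rule gn_compose[OF H(1) Ck_on_smooth_step D])
      also have "\<dots> \<le> B * gn \<phi> x" using B(1) gn_nonneg[OF H(1)] by (rule mult_right_mono)
      finally show "gn h x \<le> gn (\<lambda>x. B * \<phi> x) x" using B(2) by (simp add: gn_cmult[OF H(1)])
    qed (use p gn_nonneg[OF hk] in auto)
    also have "\<dots> = ennreal (B powr p) * energy p \<phi>" using B(2) by (simp add: energy_cmult[OF H(1)])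
    also have "\<dots> \<le> ennreal (B powr p) * 1" using \<phi>(3) by (intro mult_left_mono) auto
    finally have Eh: "energy p h \<le> ennreal (B powr p)" by simp
    have "energy p w \<le> ennreal (4 powr p) * (energy p h + energy p (\<lambda>x. -1 * \<zeta> x))"
      unfolding w_def[abs_def] by (rule energy_add_le[OF _ hk m]) (use p in simp)
    also have "\<dots> \<le> ennreal (4 powr p) * (ennreal (B powr p) + ennreal e)"
      unfolding energy_cmult[OF \<zeta>k] e(1) by (intro mult_left_mono add_mono Eh) simp_all
    also have "\<dots> = ennreal ?k" using e(2) by (simp flip: ennreal_mult' ennreal_plus)
    finally have "energy p w \<le> ennreal ?k" .
    then have Mw: "mass q UNIV w \<le> ennreal C" by (rule C[OF wC])
    have KL: "K - L \<in> sets vol" unfolding sets_vol by (intro sets.Diff borel_compact K L(1))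
    have "emeasure vol (K - L) = (\<integral>\<^sup>+x. indicator (K - L) x \<partial>vol)" using KL by simp
    also have "\<dots> \<le> mass q UNIV w"
      unfolding mass_def
    proof (rule nn_integral_mono)
      \<comment> \<open>On \<open>K - L\<close> the truncated competitor is 1 and the cutoff is 0,
        so \<open>w\<close> is 1.\<close>
      show "indicator (K - L) x \<le> indicator UNIV x * ennreal (\<bar>w x\<bar> powr q)" for x
        using hK[of x] L(2)[of x] by (cases "x \<in> K - L") (auto simp: w_def)
    qed
    finally show ?thesis using Mw by (rule order_trans)
  qed
  have finL: "emeasure vol L < \<infinity>" by (rule compact_finite_volume[OF L(1)])
  obtain K :: "nat \<Rightarrow> 'm set" where K: "\<And>n. compact (K n)" "\<And>n. L \<subseteq> K n" "incseq K" "(\<Union>n. K n) = UNIV"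
    by (rule compact_exhaustion[OF L(1)], rule that)
  have Ks: "range K \<subseteq> sets vol" using K(1) by (auto intro: borel_compact)
  have "emeasure vol (K n) \<le> ennreal C + emeasure vol L" for n
  proof -
    have "K n = (K n - L) \<union> L" using K(2) by blast
    then have "emeasure vol (K n) \<le> emeasure vol (K n - L) + emeasure vol L"
      using emeasure_subadditive[of "K n - L" vol L] borel_compact[OF K(1)] borel_compact[OF L(1)] by auto
    also have "\<dots> \<le> ennreal C + emeasure vol L" by (intro add_mono bound K) simp
    finally show ?thesis .
  qed
  then have "(SUP n. emeasure vol (K n)) \<le> ennreal C + emeasure vol L" by (intro SUP_least)
  then have "emeasure vol UNIV \<le> ennreal C + emeasure vol L"
    using SUP_emeasure_incseq[OF Ks K(3)] K(4) by simp
  also have "\<dots> < \<infinity>" using finL by (simp add: ennreal_add_less_top)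
  finally show False using inf by simp
qed

section \<open>The global Sobolev inequality\<close>

text \<open>With \<open>c\<close> close to \<open>u\<close> in \<open>L\<^sup>p\<close>, the function \<open>u + \<zeta> (c - u)\<close> has small energy and equals \<open>c\<close> where
  \<open>\<zeta> = 1\<close>; if \<open>\<bar>c\<bar>\<close> were large, dividing by \<open>c\<close> would contradict the positive capacity.\<close>

lemma hyperbolic_poincare:
  assumes p: "1 \<le> p" and conn: "connected (UNIV :: 'm set)" and h: "p_hyperbolic A g p" and L: "compact L"
  shows "\<exists>C. \<forall>u\<in>Cc_k A (Suc 0) UNIV. energy p u \<le> ennreal k \<longrightarrow> mass p L u \<le> ennreal C"
proof -
  obtain K0 where K0: "compact K0" "0 < capacity A g p K0" using h unfolding p_hyperbolic_def by blast
  \<comment> \<open>A finite positive lower bound, to be divided by; as an element of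
    \<open>ennreal\<close> the capacity might be infinite, and then 1 serves.\<close>
  obtain \<kappa> :: real where \<kappa>: "0 < \<kappa>" "ennreal \<kappa> \<le> capacity A g p K0"
  proof (cases "capacity A g p K0")
    case (real r)
    then show ?thesis using K0(2) that[of r] by auto
  next
    case top
    then show ?thesis using that[of 1] by simp
  qed
  obtain \<zeta> W where \<zeta>: "\<zeta> \<in> Cc_inf A UNIV" "\<And>x. 0 \<le> \<zeta> x" "\<And>x. \<zeta> x \<le> 1" "K0 \<subseteq> W" "\<And>x. x \<in> W \<Longrightarrow> \<zeta> x = 1"
    by (rule compact_cutoff[OF K0(1)], rule that)
  have \<zeta>C: "\<zeta> \<in> Cc_k A (Suc 0) UNIV" by (rule Cc_inf_imp_Cc_k[OF \<zeta>(1)])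
  then have \<zeta>k: "mCk (Suc 0) \<zeta>" using Cc_k_iff by blast
  obtain G S where G: "0 \<le> G" "compact S" "\<And>x. gn \<zeta> x \<le> G * indicator S x"
    using gn_support[OF \<zeta>C] by metis
  \<comment> \<open>On \<open>L\<close> closeness of \<open>u\<close> to a constant is the aim; on
    \<open>S\<close> it controls the term with the gradient of \<open>\<zeta>\<close>.\<close>
  have LS: "compact (L \<union> S)" by (rule compact_Un[OF L G(2)])
  obtain B where B: "0 \<le> B" "\<And>u. mCk (Suc 0) u \<Longrightarrow> energy p u \<le> ennreal (max k 0) \<Longrightarrow>
      \<exists>c. mass p (L \<union> S) (\<lambda>x. u x - c) \<le> ennreal B"
    using poincare_compact[OF p conn LS, of "max k 0"] by blast
  obtain v where v: "emeasure vol L = ennreal v" "0 \<le> v"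
    using compact_finite_volume[OF L] by (metis ennreal_cases infinity_ennreal_def less_irrefl)
  have Ls: "L \<in> sets borel" "S \<in> sets borel" using L G(2) by (auto intro: borel_compact)
  \<comment> \<open>\<open>?Y\<close> bounds the energy of \<open>\<zeta> x * (c - u x)\<close>
    through \<open>energy_cutoff_le\<close>, and \<open>?X\<close> that of its sum with
    \<open>u\<close>. The capacity then forces
    \<open>\<bar>c\<bar> powr p \<le> ?X / \<kappa>\<close>.\<close>
  let ?Y = "4 powr p * (G powr p * B + max k 0)"
  let ?X = "4 powr p * (max k 0 + ?Y)"
  have X0: "0 \<le> ?Y" "0 \<le> ?X" using B(1) by auto
  let ?C = "2 powr p * (B + ?X / \<kappa> * v)"
  show ?thesis
  proof (rule exI[of _ ?C], intro ballI impI)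
    fix u assume u: "u \<in> Cc_k A (Suc 0) UNIV" and E: "energy p u \<le> ennreal k"
    have uk: "mCk (Suc 0) u" using u Cc_k_iff by blast
    have E': "energy p u \<le> ennreal (max k 0)" by (rule order_trans[OF E ennreal_leI]) simp
    obtain c where c: "mass p (L \<union> S) (\<lambda>x. u x - c) \<le> ennreal B" using B(2)[OF uk E'] by blast
    have d: "mCk (Suc 0) (\<lambda>x. u x - c)" by (rule mCk_diff[OF uk mCk_const])
    have cL: "mass p L (\<lambda>x. u x - c) \<le> ennreal B" by (rule order_trans[OF mass_mono c]) blast
    have cp: "\<bar>c\<bar> powr p \<le> ?X / \<kappa>"
    proof (cases "c = 0")
      case True
      then show ?thesis using p X0(2) \<kappa>(1) by simp
    next
      case False
      have dm: "mCk (Suc 0) (\<lambda>x. c + -1 * u x)" by (intro mCk_add mCk_const mCk_cmult uk)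
      have "gn (\<lambda>x. c + -1 * u x) x = gn u x" for x
        unfolding gn_affine[OF uk] by simp
      then have Edm: "energy p (\<lambda>x. c + -1 * u x) = energy p u" by (simp add: energy_def)
      have Mdm: "mass p S (\<lambda>x. c + -1 * u x) \<le> ennreal B"
      proof -
        have "mass p S (\<lambda>x. c + -1 * u x) = mass p S (\<lambda>x. u x - c)"
          by (simp add: mass_def abs_minus_commute)
        also have "\<dots> \<le> ennreal B" by (rule order_trans[OF mass_mono c]) blast
        finally show ?thesis .
      qed
      have "energy p (\<lambda>x. \<zeta> x * (c + -1 * u x)) \<le> ennreal (4 powr p) *
          (ennreal (G powr p) * mass p S (\<lambda>x. c + -1 * u x) + energy p (\<lambda>x. c + -1 * u x))"
        by (rule energy_cutoff_le[OF p \<zeta>k _ G(3,1) Ls(2) dm]) (use \<zeta>(2,3) in \<open>simp add: abs_le_iff order_trans[of _ 0]\<close>)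
      also have "\<dots> \<le> ennreal (4 powr p) * (ennreal (G powr p) * ennreal B + ennreal (max k 0))"
        unfolding Edm by (intro mult_left_mono add_mono Mdm E') simp_all
      also have "\<dots> = ennreal ?Y" using B(1) by (simp flip: ennreal_mult' ennreal_plus)
      finally have E2: "energy p (\<lambda>x. \<zeta> x * (c + -1 * u x)) \<le> ennreal ?Y" .
      define f where "f x = u x + \<zeta> x * (c + -1 * u x)" for x
      have prodC: "(\<lambda>x. \<zeta> x * (c + -1 * u x)) \<in> Cc_k A (Suc 0) UNIV"
        using Cc_k_mult[OF \<zeta>C dm] by (simp add: mult.commute)
      have fC: "f \<in> Cc_k A (Suc 0) UNIV" unfolding f_def[abs_def] by (rule Cc_k_add[OF u prodC])
      then have fk: "mCk (Suc 0) f" using Cc_k_iff by blast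
      have pk: "mCk (Suc 0) (\<lambda>x. \<zeta> x * (c + -1 * u x))" by (rule mCk_mult[OF \<zeta>k dm])
      have "energy p f \<le> ennreal (4 powr p) * (energy p u + energy p (\<lambda>x. \<zeta> x * (c + -1 * u x)))"
        unfolding f_def[abs_def] by (rule energy_add_le[OF _ uk pk]) (use p in simp)
      also have "\<dots> \<le> ennreal (4 powr p) * (ennreal (max k 0) + ennreal ?Y)"
        by (intro mult_left_mono add_mono E' E2) simp
      also have "\<dots> = ennreal ?X" using X0(1) by (simp flip: ennreal_mult' ennreal_plus)
      finally have Ef: "energy p f \<le> ennreal ?X" .
      have f1: "1 / c * f x = 1" if "x \<in> K0" for x
        using \<zeta>(4,5) that False by (auto simp: f_def)
      have "(\<lambda>x. 1 / c * f x) \<in> Cc_k A (Suc 0) UNIV" by (rule Cc_k_mult[OF fC mCk_const])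
      then have "capacity A g p K0 \<le> energy p (\<lambda>x. 1 / c * f x)"
        unfolding capacity_def energy_def using f1 by (intro INF_lower) auto
      also have "\<dots> = ennreal (\<bar>1 / c\<bar> powr p) * energy p f" by (rule energy_cmult[OF fk])
      also have "\<dots> \<le> ennreal (\<bar>1 / c\<bar> powr p) * ennreal ?X" by (rule mult_left_mono[OF Ef]) simp
      also have "\<dots> = ennreal (\<bar>1 / c\<bar> powr p * ?X)" by (rule ennreal_mult'[symmetric]) simp
      finally have "ennreal \<kappa> \<le> ennreal (\<bar>1 / c\<bar> powr p * ?X)" using \<kappa>(2) by (rule order_trans[rotated])
      then have "\<kappa> \<le> \<bar>1 / c\<bar> powr p * ?X" using X0(2) by (subst (asm) ennreal_le_iff) auto
      also have "\<bar>1 / c\<bar> powr p = 1 / \<bar>c\<bar> powr p" by (simp add: powr_divide)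
      finally show ?thesis using False \<kappa>(1) by (simp add: field_simps)
    qed
    have "mass p L (\<lambda>x. (u x - c) + c) \<le> ennreal (2 powr p) * (mass p L (\<lambda>x. u x - c) + mass p L (\<lambda>x. c))"
      by (rule mass_add_le[OF _ mCk_measurable[OF d] _ Ls(1)]) (use p in auto)
    also have "mass p L (\<lambda>x. c) = ennreal (\<bar>c\<bar> powr p) * emeasure vol L"
      unfolding mass_def using Ls(1) by (subst mult.commute) (simp add: nn_integral_cmult_indicator)
    also have "\<dots> = ennreal (\<bar>c\<bar> powr p * v)" unfolding v(1) by (rule ennreal_mult'[symmetric]) simp
    also have "\<dots> \<le> ennreal (?X / \<kappa> * v)" by (intro ennreal_leI mult_right_mono cp v)
    finally have "mass p L (\<lambda>x. (u x - c) + c) \<le> ennreal (2 powr p) * (ennreal B + ennreal (?X / \<kappa> * v))"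
      using cL by (meson add_mono mult_left_mono order_trans order_refl zero_le)
    also have "\<dots> = ennreal ?C" using B(1) X0(2) \<kappa>(1) v(2) by (simp flip: ennreal_mult' ennreal_plus)
    finally show "mass p L u \<le> ennreal ?C" by simp
  qed
qed

text \<open>The gradients of the cutoffs that glue the local bounds cost the \<open>L\<^sup>p\<close> norm on a compact set.\<close>

lemma sobolev_with_remainder:
  assumes p: "1 \<le> p" and q: "1 \<le> q" and F: "compact F" and ne: "F \<noteq> UNIV" and s: "sobolev_bound p q (UNIV - F)"
  shows "\<exists>L. compact L \<and> (\<forall>k. \<exists>C. \<forall>u\<in>Cc_inf A UNIV.
    energy p u \<le> ennreal k \<longrightarrow> mass p L u \<le> ennreal k \<longrightarrow> mass q UNIV u \<le> ennreal C)"
proof -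
  define P where "P W \<longleftrightarrow> (\<exists>L. compact L \<and> (\<forall>k. \<exists>C. \<forall>u\<in>Cc_inf A W.
    energy p u \<le> ennreal k \<longrightarrow> mass p L u \<le> ennreal k \<longrightarrow> mass q UNIV u \<le> ennreal C))" for W
  have oF: "open (UNIV - F)" using compact_imp_closed[OF F] by (simp add: open_Diff)
  obtain x1 where x1: "x1 \<in> UNIV - F" using ne by blast
  \<comment> \<open>Off \<open>F\<close> the hypothesis holds without remainder, so \<open>L\<close>
    starts empty; each annexed neighbourhood adds the support \<open>S\<close> of a cutoff
    gradient.\<close>
  have P0: "P (UNIV - F)" unfolding P_def
  proof (rule exI[of _ "{}"], intro conjI allI compact_empty)
    fix k
    obtain C where "\<forall>u\<in>Cc_inf A (UNIV - F). energy p u \<le> ennreal k \<longrightarrow> mass q UNIV u \<le> ennreal C"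
      using s unfolding sobolev_bound_def by blast
    then show "\<exists>C. \<forall>u\<in>Cc_inf A (UNIV - F).
        energy p u \<le> ennreal k \<longrightarrow> mass p {} u \<le> ennreal k \<longrightarrow> mass q UNIV u \<le> ennreal C"
      by (intro exI[of _ C]) blast
  qed
  have step: "\<exists>V. open V \<and> x \<in> V \<and> (\<forall>W. open W \<longrightarrow> P W \<longrightarrow> P (W \<union> V))" for x
  proof -
    obtain U where U: "open U" "x \<in> U" "sobolev_bound p q U" by (rule sobolev_bound_transfer[OF p q oF x1 s])
    obtain b V where b: "b \<in> Cc_inf A U" "\<And>x. 0 \<le> b x" "\<And>x. b x \<le> 1" "open V" "x \<in> V" "\<And>x. x \<in> V \<Longrightarrow> b x = 1"
      by (rule local_cutoff[OF U(1,2)], rule that)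
    have bC: "b \<in> Cc_k A (Suc 0) U" by (rule Cc_inf_imp_Cc_k[OF b(1)])
    have bk: "mCk k b" for k using b(1) Cc_inf_iff by blast
    obtain G S where G: "0 \<le> G" "compact S" "\<And>x. gn b x \<le> G * indicator S x"
      using gn_support[OF bC] by metis
    have Ss: "S \<in> sets borel" using G(2) by (rule borel_compact)
    have b1k: "mCk k (\<lambda>x. 1 - b x)" for k by (rule mCk_diff[OF mCk_const bk])
    have "gn (\<lambda>x. 1 - b x) x = gn b x" for x
      using gn_affine[OF bk, of 1 "-1" x] by simp
    then have G1: "gn (\<lambda>x. 1 - b x) x \<le> G * indicator S x" for x using G(3) by simp
    have babs: "\<bar>b x\<bar> \<le> 1" "\<bar>1 - b x\<bar> \<le> 1" for x using b(2,3)[of x] by auto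
    have "P (W \<union> V)" if PW: "P W" for W
    proof -
      obtain L where L: "compact L" "\<And>k. \<exists>C. \<forall>u\<in>Cc_inf A W.
        energy p u \<le> ennreal k \<longrightarrow> mass p L u \<le> ennreal k \<longrightarrow> mass q UNIV u \<le> ennreal C"
        using PW unfolding P_def by blast
      have "\<exists>C. \<forall>u\<in>Cc_inf A (W \<union> V). energy p u \<le> ennreal k \<longrightarrow> mass p (L \<union> S) u \<le> ennreal k \<longrightarrow> mass q UNIV u \<le> ennreal C" for k
      proof -
        \<comment> \<open>The second summand bounds the energies of \<open>b * u\<close> and
          \<open>(1 - b) * u\<close>, the first the mass of the latter on \<open>L\<close>. They are
          added because the induction hypothesis takes one number for both.\<close>
        let ?k = "max k 0 + 4 powr p * (G powr p * max k 0 + max k 0)"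
        obtain C1 where C1: "\<And>u. u \<in> Cc_inf A U \<Longrightarrow> energy p u \<le> ennreal ?k \<Longrightarrow> mass q UNIV u \<le> ennreal C1"
          using U(3) unfolding sobolev_bound_def by blast
        obtain C2 where C2: "\<And>u. u \<in> Cc_inf A W \<Longrightarrow> energy p u \<le> ennreal ?k \<Longrightarrow> mass p L u \<le> ennreal ?k \<Longrightarrow> mass q UNIV u \<le> ennreal C2"
          using L(2)[of ?k] by blast
        let ?C = "2 powr q * (max C1 0 + max C2 0)"
        show ?thesis
        proof (rule exI[of _ ?C], intro ballI impI)
          fix u assume u: "u \<in> Cc_inf A (W \<union> V)" and E: "energy p u \<le> ennreal k" and M: "mass p (L \<union> S) u \<le> ennreal k"
          have uk: "mCk k u" for k using u Cc_inf_iff by blast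
          have kk: "ennreal k \<le> ennreal (max k 0)" by (intro ennreal_leI) simp
          have E': "energy p u \<le> ennreal (max k 0)" by (rule order_trans[OF E kk])
          have MS: "mass p S u \<le> ennreal (max k 0)"
            by (rule order_trans[OF mass_mono order_trans[OF M kk]]) blast
          have MassL: "mass p L u \<le> ennreal (max k 0)"
            by (rule order_trans[OF mass_mono order_trans[OF M kk]]) blast
          have kb: "ennreal (4 powr p) * (ennreal (G powr p) * mass p S u + energy p u) \<le> ennreal ?k"
          proof -
            have "ennreal (4 powr p) * (ennreal (G powr p) * mass p S u + energy p u)
              \<le> ennreal (4 powr p) * (ennreal (G powr p) * ennreal (max k 0) + ennreal (max k 0))"
              by (intro mult_left_mono add_mono MS E') simp_all
            also have "\<dots> = ennreal (4 powr p * (G powr p * max k 0 + max k 0))" by (simp flip: ennreal_mult' ennreal_plus)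
            also have "\<dots> \<le> ennreal ?k" by (intro ennreal_leI) simp
            finally show ?thesis .
          qed
          have "energy p (\<lambda>x. b x * u x) \<le> ennreal ?k"
            by (rule order_trans[OF energy_cutoff_le[OF p bk babs(1) G(3,1) Ss uk] kb])
          moreover have "(\<lambda>x. b x * u x) \<in> Cc_inf A U"
            using Cc_inf_mult[OF b(1) uk] by (simp add: mult.commute)
          ultimately have "mass q UNIV (\<lambda>x. b x * u x) \<le> ennreal C1" by (rule C1[rotated])
          then have M1: "mass q UNIV (\<lambda>x. b x * u x) \<le> ennreal (max C1 0)"
            by (rule order_trans) (intro ennreal_leI, simp)
          have E2: "energy p (\<lambda>x. (1 - b x) * u x) \<le> ennreal ?k"
            by (rule order_trans[OF energy_cutoff_le[OF p b1k babs(2) G1 G(1) Ss uk] kb])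
          have u2: "(\<lambda>x. (1 - b x) * u x) \<in> Cc_inf A W"
          proof -
            have "(\<lambda>x. (1 - b x) * u x) \<in> Cc_k A k (UNIV \<inter> W)" for k
              by (rule Cc_k_mult_compl[OF _ bk b(6,4)]) (use Cc_inf_imp_Cc_k[OF u] in simp)
            then show ?thesis by (simp add: Cc_inf_def)
          qed
          have "mass p L (\<lambda>x. (1 - b x) * u x) \<le> mass p L u"
            unfolding mass_def
          proof (intro nn_integral_mono mult_left_mono ennreal_leI powr_mono2)
            show "\<bar>(1 - b x) * u x\<bar> \<le> \<bar>u x\<bar>" for x
              using mult_right_mono[OF babs(2)[of x] abs_ge_zero[of "u x"]] by (simp add: abs_mult)
          qed (use p in auto)
          also have "\<dots> \<le> ennreal ?k" by (rule order_trans[OF MassL ennreal_leI]) simp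
          finally have "mass p L (\<lambda>x. (1 - b x) * u x) \<le> ennreal ?k" .
          then have "mass q UNIV (\<lambda>x. (1 - b x) * u x) \<le> ennreal C2" by (rule C2[OF u2 E2])
          then have M2: "mass q UNIV (\<lambda>x. (1 - b x) * u x) \<le> ennreal (max C2 0)"
            by (rule order_trans) (intro ennreal_leI, simp)
          have "mass q UNIV (\<lambda>x. b x * u x + (1 - b x) * u x)
            \<le> ennreal (2 powr q) * (mass q UNIV (\<lambda>x. b x * u x) + mass q UNIV (\<lambda>x. (1 - b x) * u x))"
            by (rule mass_add_le[OF _ mCk_measurable[OF mCk_mult[OF bk uk]] mCk_measurable[OF mCk_mult[OF b1k uk]]])
               (use q in simp_all)
          also have "\<dots> \<le> ennreal (2 powr q) * (ennreal (max C1 0) + ennreal (max C2 0))"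
            by (intro mult_left_mono add_mono M1 M2) simp
          also have "\<dots> = ennreal ?C" by (simp flip: ennreal_mult' ennreal_plus)
          finally show "mass q UNIV u \<le> ennreal ?C" by (simp add: algebra_simps)
        qed
      qed
      then show ?thesis unfolding P_def using compact_Un[OF L(1) G(2)] by blast
    qed
    then show ?thesis using b(4,5) by blast
  qed
  from compact_absorb[where P = P, OF F step oF P0]
  obtain W where W: "(UNIV - F) \<union> F \<subseteq> W" "P W" by metis
  then have "W = UNIV" by blast
  then show ?thesis using W(2) unfolding P_def by simp
qed

text \<open>The remainder in \<open>sobolev_with_remainder\<close> is an L^p norm over a compact
  set, which \<open>hyperbolic_poincare\<close> bounds by the energy alone.\<close>

lemma sobolev_bound_global:
  assumes p: "1 \<le> p" and q: "1 \<le> q" and conn: "connected (UNIV :: 'm set)" and F: "compact F" and ne: "F \<noteq> UNIV"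
    and s: "sobolev_bound p q (UNIV - F)" and h: "p_hyperbolic A g p"
  shows "sobolev_bound p q UNIV"
proof -
  obtain L where L: "compact L" "\<And>k. \<exists>C. \<forall>u\<in>Cc_inf A UNIV.
    energy p u \<le> ennreal k \<longrightarrow> mass p L u \<le> ennreal k \<longrightarrow> mass q UNIV u \<le> ennreal C"
    using sobolev_with_remainder[OF p q F ne s] by blast
  show ?thesis
    unfolding sobolev_bound_def
  proof
    fix k
    obtain C where C: "\<And>u. u \<in> Cc_k A (Suc 0) UNIV \<Longrightarrow> energy p u \<le> ennreal k \<Longrightarrow> mass p L u \<le> ennreal C"
      using hyperbolic_poincare[OF p conn h L(1), of k] by blast
    obtain C' where C': "\<And>u. u \<in> Cc_inf A UNIV \<Longrightarrow> energy p u \<le> ennreal (max k C) \<Longrightarrow> mass p L u \<le> ennreal (max k C)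
       \<Longrightarrow> mass q UNIV u \<le> ennreal C'"
      using L(2)[of "max k C"] by blast
    have le: "ennreal k \<le> ennreal (max k C)" "ennreal C \<le> ennreal (max k C)" by (intro ennreal_leI; simp)+
    show "\<exists>C. \<forall>u\<in>Cc_inf A UNIV. energy p u \<le> ennreal k \<longrightarrow> mass q UNIV u \<le> ennreal C"
    proof (rule exI[of _ C'], intro ballI impI)
      fix u assume u: "u \<in> Cc_inf A UNIV" and E: "energy p u \<le> ennreal k"
      show "mass q UNIV u \<le> ennreal C'"
        by (rule C'[OF u order_trans[OF E le(1)] order_trans[OF C[OF Cc_inf_imp_Cc_k[OF u] E] le(2)]])
    qed
  qed
qed

section \<open>From bounds back to norms\<close>

text \<open>The Bochner integral in \<open>Lp_norm\<close> would be 0 for a non-integrable function.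
  Compact support makes the extended integral finite, and then the two agree.\<close>

lemma Lp_norm_mass:
  assumes q: "1 \<le> q" and u: "u \<in> Cc_inf A U"
  obtains a where "0 \<le> a" "mass q UNIV u = ennreal a" "Lp_norm vol q u = a powr (1 / q)"
proof -
  have uC: "u \<in> Cc_k A (Suc 0) U" by (rule Cc_inf_imp_Cc_k[OF u])
  have um: "u \<in> borel_measurable borel" using uC Cc_k_iff mCk_measurable by blast
  obtain a where a: "mass q UNIV u = ennreal a" "0 \<le> a"
    using mass_finite[OF q uC] by (metis ennreal_cases infinity_ennreal_def less_irrefl)
  have "(\<integral>x. \<bar>u x\<bar> powr q \<partial>vol) = enn2real (\<integral>\<^sup>+x. ennreal (\<bar>u x\<bar> powr q) \<partial>vol)"
    by (rule integral_eq_nn_integral) (use um in auto)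
  also have "\<dots> = a" using a by (simp add: mass_def)
  finally show thesis using that[of a] a by (simp add: Lp_norm_def)
qed

lemma Lp_norm_energy:
  assumes p: "1 \<le> p" and u: "u \<in> Cc_inf A U"
  obtains a where "0 \<le> a" "energy p u = ennreal a" "Lp_norm vol p (gn u) = a powr (1 / p)"
proof -
  have uC: "u \<in> Cc_k A (Suc 0) U" by (rule Cc_inf_imp_Cc_k[OF u])
  then have uk: "mCk (Suc 0) u" using Cc_k_iff by blast
  obtain a where a: "energy p u = ennreal a" "0 \<le> a"
    using energy_finite[OF p uC] by (metis ennreal_cases infinity_ennreal_def less_irrefl)
  have "(\<integral>x. \<bar>gn u x\<bar> powr p \<partial>vol) = enn2real (\<integral>\<^sup>+x. ennreal (\<bar>gn u x\<bar> powr p) \<partial>vol)"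
    by (rule integral_eq_nn_integral) (use gn_measurable[OF uk] in auto)
  also have "\<dots> = a" using a gn_nonneg[OF uk] by (simp add: energy_def)
  finally show thesis using that[of a] a by (simp add: Lp_norm_def)
qed

lemma sobolev_imp_bound:
  assumes p: "1 \<le> p" and q: "1 \<le> q" and s: "sobolev_inequality A g q p U"
  shows "sobolev_bound p q U"
  unfolding sobolev_bound_def
proof
  fix k :: real
  obtain S where S: "0 < S" "\<And>u. u \<in> Cc_inf A U \<Longrightarrow> S * Lp_norm vol q u \<le> Lp_norm vol p (gn u)"
    using s unfolding sobolev_inequality_def by blast
  \<comment> \<open>\<open>ennreal k\<close> is 0 for negative \<open>k\<close>, which
    \<open>max k 0\<close> accounts for.\<close>
  let ?C = "(max k 0 powr (1 / p) / S) powr q"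
  show "\<exists>C. \<forall>u\<in>Cc_inf A U. energy p u \<le> ennreal k \<longrightarrow> mass q UNIV u \<le> ennreal C"
  proof (rule exI[of _ ?C], intro ballI impI)
    fix u assume u: "u \<in> Cc_inf A U" and E: "energy p u \<le> ennreal k"
    obtain a where a: "0 \<le> a" "mass q UNIV u = ennreal a" "Lp_norm vol q u = a powr (1 / q)"
      by (rule Lp_norm_mass[OF q u])
    obtain e where e: "0 \<le> e" "energy p u = ennreal e" "Lp_norm vol p (gn u) = e powr (1 / p)"
      by (rule Lp_norm_energy[OF p u])
    have "ennreal e \<le> ennreal (max k 0)" using E unfolding e(2) by (rule order_trans) (intro ennreal_leI, simp)
    then have "e \<le> max k 0" using e(1) by (simp add: ennreal_le_iff)
    then have "e powr (1 / p) \<le> max k 0 powr (1 / p)" using e(1) p by (intro powr_mono2) auto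
    then have "S * a powr (1 / q) \<le> max k 0 powr (1 / p)"
      using S(2)[OF u] unfolding a(3) e(3) by (rule order_trans[rotated])
    then have "a powr (1 / q) \<le> max k 0 powr (1 / p) / S" using S(1) by (simp add: field_simps)
    then have "(a powr (1 / q)) powr q \<le> ?C" using q by (intro powr_mono2) auto
    also have "(a powr (1 / q)) powr q = a" using a(1) q by (simp add: powr_powr)
    finally show "mass q UNIV u \<le> ennreal ?C" unfolding a(2) by (rule ennreal_leI)
  qed
qed

text \<open>If the energy of \<open>u\<close> is positive, it is normalised to \<open>1\<close>; if it vanishes, every multiple of \<open>u\<close> is
  bounded by the same constant.\<close>

lemma bound_imp_sobolev:
  assumes p: "1 \<le> p" and q: "1 \<le> q" and s: "sobolev_bound p q U"
  shows "sobolev_inequality A g q p U"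
proof -
  obtain C0 where C0: "\<And>u. u \<in> Cc_inf A U \<Longrightarrow> energy p u \<le> ennreal 1 \<Longrightarrow> mass q UNIV u \<le> ennreal C0"
    using s unfolding sobolev_bound_def by blast
  define C where "C = max C0 1"
  have C: "0 < C" by (simp add: C_def)
  have C1: "mass q UNIV u \<le> ennreal C" if "u \<in> Cc_inf A U" "energy p u \<le> ennreal 1" for u
    by (rule order_trans[OF C0[OF that] ennreal_leI]) (simp add: C_def)
  \<comment> \<open>Energy 1 means mass at most \<open>C\<close>, hence L^q norm at most
    \<open>C powr (1 / q)\<close>; homogeneity makes its inverse the Sobolev constant.\<close>
  define S where "S = 1 / C powr (1 / q)"
  have S: "0 < S" using C by (simp add: S_def)
  have "S * Lp_norm vol q u \<le> Lp_norm vol p (gn u)" if u: "u \<in> Cc_inf A U" for u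
  proof -
    have uk: "mCk k u" for k using u Cc_inf_iff by blast
    obtain a where a: "0 \<le> a" "mass q UNIV u = ennreal a" "Lp_norm vol q u = a powr (1 / q)"
      by (rule Lp_norm_mass[OF q u])
    obtain e where e: "0 \<le> e" "energy p u = ennreal e" "Lp_norm vol p (gn u) = e powr (1 / p)"
      by (rule Lp_norm_energy[OF p u])
    have scale: "t powr q * a \<le> C" if t: "0 \<le> t" "t powr p * e \<le> 1" for t
    proof -
      have tu: "(\<lambda>x. t * u x) \<in> Cc_inf A U" by (rule Cc_inf_mult[OF u mCk_const])
      have "energy p (\<lambda>x. t * u x) = ennreal (t powr p * e)"
        unfolding energy_cmult[OF uk] e(2) using t(1) by (simp add: ennreal_mult')
      also have "\<dots> \<le> ennreal 1" by (rule ennreal_leI[OF t(2)])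
      finally have "mass q UNIV (\<lambda>x. t * u x) \<le> ennreal C" by (rule C1[OF tu])
      moreover have "mass q UNIV (\<lambda>x. t * u x) = ennreal (t powr q * a)"
        using mass_cmult[OF mCk_measurable[OF uk], of UNIV q t] a(2) t(1) by (simp add: ennreal_mult')
      ultimately show ?thesis using C by (simp add: ennreal_le_iff)
    qed
    show ?thesis
    proof (cases "e = 0")
      case True
      have "a = 0"
      proof (rule ccontr)
        assume "a \<noteq> 0"
        then have a0: "0 < a" using a(1) by simp
        \<comment> \<open>Chosen so that \<open>?t powr q * a = C + 1\<close>; at zero energy
          \<open>scale\<close> admits every nonnegative factor.\<close>
        let ?t = "((C + 1) / a) powr (1 / q)"
        have "?t powr q * a = C + 1" using q a0 C by (simp add: powr_powr)
        moreover have "?t powr q * a \<le> C" by (rule scale) (use True in auto)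
        ultimately show False by simp
      qed
      then show ?thesis using a e by simp
    next
      case False
      then have e0: "0 < e" using e(1) by simp
      let ?t = "(1 / e) powr (1 / p)"
      have "?t powr p * e = 1" using p e0 by (simp add: powr_powr)
      then have "?t powr q * a \<le> C" by (intro scale) auto
      then have "(?t powr q * a) powr (1 / q) \<le> C powr (1 / q)" using q a(1) by (intro powr_mono2) auto
      also have "(?t powr q * a) powr (1 / q) = ?t * a powr (1 / q)"
        using q a(1) e0 by (simp add: powr_mult powr_powr)
      also have "?t = 1 / e powr (1 / p)" using e0 by (simp add: powr_divide)
      finally show ?thesis unfolding a(3) e(3) S_def using e0 C by (simp add: field_simps)
    qed
  qed
  then show ?thesis unfolding sobolev_inequality_def using S by blast
qed

end

theorem theorem3p2:
  fixes A :: "('m::{t2_space,second_countable_topology}, 'n::{finite,wellorder}) chart set"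
    and g :: "('m, 'n) metric"
    and p q :: real
    and F :: "'m set"
  assumes "1 \<le> p" and "1 \<le> q"
    and "riemannian_manifold A g"
    and "connected (UNIV :: 'm set)"
    and "emeasure (riem_vol A g) UNIV = \<infinity>"
    and "compact F"
    and "sobolev_inequality A g q p (UNIV - F)"
  shows "p_hyperbolic A g p \<and> sobolev_inequality A g q p UNIV"
proof -
  interpret riemannian A g by unfold_locales fact
  have s: "sobolev_bound p q (UNIV - F)" by (rule sobolev_imp_bound) fact+
  have h: "p_hyperbolic A g p"
    by (rule hyperbolic_if_sobolev_outside[OF assms(1,2,6,5) s])
  \<comment> \<open>A compact set has finite volume. A point off \<open>F\<close> is what the
    transfer of local inequalities starts from.\<close>
  have "F \<noteq> UNIV" using compact_finite_volume[OF assms(6)] assms(5) by auto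
  then have "sobolev_bound p q UNIV" by (rule sobolev_bound_global[OF assms(1,2,4,6) _ s h])
  then show ?thesis using h bound_imp_sobolev[OF assms(1,2)] by blast
qed

end
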